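(* Let $N\ge 2$, $L>0$, $I_L=(0,L)$, let $\Omega\in BV(I_L,Sk(N))$ be a continuous function of bounded variation with values in the skew-symmetric $N\times N$ matrices, and let $\mathbb G\in SO(N)$. Then the system $$DG=-(G^\top)^{-1}D\Omega,\qquad G(0)=\mathbb G$$ admits a unique solution $G$ in $BV(I_L,\mathbb R^{N\times N})$, and this solution is a continuous function of bounded variation $G:I_L\to SO(N)$.
   Context: $Sk(N)=\{B\in\mathbb R^{N\times N}: B^\top=-B\}$, and $SO(N)$ is the special orthogonal group. For $X\subset\mathbb R^{N\times N}$, $BV(I_L,X)$ is the set of matrix-valued functions of bounded variation on $I_L$ (distributional derivative a finite matrix-valued Borel measure) with values in $X$ for Lebesgue-a.e. $s$. A BV function $u$ has one-sided limits $u(s^\pm)$ at each $s\in I_L$; one sets $u(0)=u(0^+)$, $u(L)=u(L^-)$, and $u$ is called continuous if $Du$ has no atomic (jump) part, i.e. $u$ has a continuous representative. The first line of the system is an equality of matrix-valued Borel measures on $I_L$, where $G$ on the right-hand side is the precise representative $G(s)=\frac12(G(s^+)+G(s^-))$; it is part of the notion of solution that the matrix $G(s)$ is invertible for every $s\in I_L$. Explicitly, the equation means $\int_{I_L}G^i_j(s)\varphi'(s)\,ds=\int_{I_L}\varphi(s)\,\big((G(s)^\top)^{-1}\,dD\Omega(s)\big)^i_j$ for all $i,j=1,\dots,N$ and all $\varphi\in C^\infty_c(I_L)$, where $H^i_j$ is the generic entry of $H$. *)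

theory Defs
  imports "HOL-Analysis.Analysis"
begin

section \<open>Finite vector-valued and signed measures\<close>

text \<open>A finite vector measure on a measurable space is a countably additive set function with
  values in a normed space. Only the measurable space underlying \<open>M\<close> is used, and values
  of the set function outside \<open>sets M\<close> are irrelevant. (Applied to the constant empty
  sequence, the condition gives value 0 on the empty set.)\<close>

definition vector_measure :: "'a measure \<Rightarrow> ('a set \<Rightarrow> 'b::real_normed_vector) \<Rightarrow> bool" where
  "vector_measure M \<nu> \<longleftrightarrow>
     (\<forall>A::nat \<Rightarrow> 'a set. range A \<subseteq> sets M \<longrightarrow> disjoint_family A \<longrightarrow>
        (\<lambda>i. \<nu> (A i)) sums \<nu> (\<Union>i. A i))"

text \<open>The upper variation of a signed measure, i.e. the positive part of its Jordan
  decomposition; the negative part is the upper variation of the negated measure. Truncation of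
  negative values by \<open>ennreal\<close> is harmless since the empty set contributes 0.\<close>

definition upper_variation :: "'a measure \<Rightarrow> ('a set \<Rightarrow> real) \<Rightarrow> 'a measure" where
  "upper_variation M \<nu> =
     measure_of (space M) (sets M) (\<lambda>A. SUP B\<in>{B \<in> sets M. B \<subseteq> A}. ennreal (\<nu> B))"

definition signed_integrable :: "'a measure \<Rightarrow> ('a set \<Rightarrow> real) \<Rightarrow> ('a \<Rightarrow> real) \<Rightarrow> bool" where
  "signed_integrable M \<nu> f \<longleftrightarrow>
     integrable (upper_variation M \<nu>) f \<and> integrable (upper_variation M (\<lambda>A. - \<nu> A)) f"

definition signed_integral :: "'a measure \<Rightarrow> ('a set \<Rightarrow> real) \<Rightarrow> ('a \<Rightarrow> real) \<Rightarrow> real" where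
  "signed_integral M \<nu> f =
     (LINT x|upper_variation M \<nu>. f x) - (LINT x|upper_variation M (\<lambda>A. - \<nu> A). f x)"

text \<open>The supremum above is indeed a measure, so \<open>measure_of\<close> does not degenerate.\<close>

lemma vector_measure_empty:
  assumes "vector_measure M \<nu>" shows "\<nu> {} = 0"
proof -
  have "(\<lambda>i::nat. \<nu> {}) sums \<nu> (\<Union>i::nat. {})"
    using assms unfolding vector_measure_def
    by (elim allE[of _ "\<lambda>_. {}"]) (auto simp: disjoint_family_on_def)
  then have "(\<lambda>i::nat. \<nu> {}) \<longlonglongrightarrow> 0"
    by (intro summable_LIMSEQ_zero sums_summable)
  then show ?thesis by (simp add: LIMSEQ_const_iff)
qed

lemma vector_measure_Un:
  assumes "vector_measure M \<nu>" "A \<in> sets M" "B \<in> sets M" "A \<inter> B = {}"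
  shows "\<nu> (A \<union> B) = \<nu> A + \<nu> B"
proof -
  have "(\<lambda>i. \<nu> (binaryset A B i)) sums \<nu> (\<Union>i. binaryset A B i)"
    using assms unfolding vector_measure_def
    by (elim allE[of _ "binaryset A B"])
       (auto simp: disjoint_family_on_def binaryset_def split: if_splits)
  moreover have "(\<lambda>i. \<nu> (binaryset A B i)) sums (\<nu> A + \<nu> B)"
    by (rule binaryset_sums) (rule vector_measure_empty[OF assms(1)])
  ultimately show ?thesis
    using sums_unique2 by (auto simp: UN_binaryset_eq)
qed

lemma emeasure_upper_variation:
  assumes vm: "vector_measure M \<nu>" and A: "A \<in> sets M"
  shows "emeasure (upper_variation M \<nu>) A = (SUP B\<in>{B \<in> sets M. B \<subseteq> A}. ennreal (\<nu> B))"
proof -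
  define U where "U A = (SUP B\<in>{B \<in> sets M. B \<subseteq> A}. ennreal (\<nu> B))" for A
  have U_ge: "ennreal (\<nu> B) \<le> U A" if "B \<in> sets M" "B \<subseteq> A" for A B
    unfolding U_def using that by (intro SUP_upper) auto
  have U_empty: "U {} = 0"
  proof -
    have "{B \<in> sets M. B \<subseteq> {}} = {{}}" by auto
    then show ?thesis unfolding U_def by (simp only:) (simp add: vector_measure_empty[OF vm])
  qed
  have U_mono: "U A \<le> U B" if "A \<subseteq> B" for A B
    unfolding U_def using that by (intro SUP_subset_mono) auto
  have super: "U A + U B \<le> U (A \<union> B)" if "A \<inter> B = {}" for A B
  proof -
    have ne: "{B \<in> sets M. B \<subseteq> A} \<noteq> {}" for A by auto
    have *: "ennreal (\<nu> C) + ennreal (\<nu> D) \<le> U (A \<union> B)"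
      if C: "C \<in> sets M" "C \<subseteq> A" and D: "D \<in> sets M" "D \<subseteq> B" for C D
    proof -
      consider "\<nu> C \<le> 0" | "\<nu> D \<le> 0" | "\<nu> C \<ge> 0" "\<nu> D \<ge> 0" by linarith
      then show ?thesis
      proof cases
        case 1 then show ?thesis using D U_ge[of D "A \<union> B"] by (auto simp: ennreal_neg)
      next
        case 2 then show ?thesis using C U_ge[of C "A \<union> B"] by (auto simp: ennreal_neg)
      next
        case 3
        have "\<nu> (C \<union> D) = \<nu> C + \<nu> D"
          using C D \<open>A \<inter> B = {}\<close> by (intro vector_measure_Un[OF vm]) auto
        moreover have "ennreal (\<nu> (C \<union> D)) \<le> U (A \<union> B)" using C D by (intro U_ge) auto
        ultimately show ?thesis using 3 by (simp add: ennreal_plus)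
      qed
    qed
    have "ennreal (\<nu> C) + U B \<le> U (A \<union> B)" if C: "C \<in> sets M" "C \<subseteq> A" for C
      unfolding U_def[of B] ennreal_SUP_add_right[OF ne] by (intro SUP_least) (use C * in auto)
    then show ?thesis
      unfolding U_def[of A] ennreal_SUP_add_left[OF ne, symmetric] by (intro SUP_least) auto
  qed
  have "countably_additive (sets M) U"
  proof (rule countably_additiveI)
    fix A :: "nat \<Rightarrow> 'a set"
    assume A: "range A \<subseteq> sets M" "disjoint_family A" "(\<Union>i. A i) \<in> sets M"
    show "(\<Sum>i. U (A i)) = U (\<Union>i. A i)"
    proof (rule antisym)
      have "(\<Sum>i<n. U (A i)) \<le> U (\<Union>i<n. A i)" for n
      proof (induction n)
        case (Suc n)
        have disj: "(\<Union>i<n. A i) \<inter> A n = {}"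
        proof -
          have "A i \<inter> A n = {}" if "i < n" for i
            using A(2) that unfolding disjoint_family_on_def by (metis UNIV_I less_irrefl)
          then show ?thesis by blast
        qed
        have "(\<Sum>i<Suc n. U (A i)) \<le> U (\<Union>i<n. A i) + U (A n)"
          using Suc by (simp add: add_right_mono)
        also have "\<dots> \<le> U ((\<Union>i<n. A i) \<union> A n)" by (rule super[OF disj])
        finally show ?case by (simp add: lessThan_Suc Un_commute)
      qed (simp add: U_empty)
      then have "(\<Sum>i<n. U (A i)) \<le> U (\<Union>i. A i)" for n
        by (rule order_trans) (auto intro!: U_mono)
      then show "(\<Sum>i. U (A i)) \<le> U (\<Union>i. A i)"
        by (intro suminf_le_const) auto
    next
      have "ennreal (\<nu> B) \<le> (\<Sum>i. U (A i))" if B: "B \<in> sets M" "B \<subseteq> (\<Union>i. A i)" for B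
      proof -
        have "(\<lambda>i. \<nu> (B \<inter> A i)) sums \<nu> (\<Union>i. B \<inter> A i)"
          using vm unfolding vector_measure_def
          by (elim allE[of _ "\<lambda>i. B \<inter> A i"])
             (use A B in \<open>auto simp: disjoint_family_on_def\<close>)
        moreover have "(\<Union>i. B \<inter> A i) = B" using B by auto
        ultimately have "(\<lambda>n. \<Sum>i<n. \<nu> (B \<inter> A i)) \<longlonglongrightarrow> \<nu> B"
          by (simp add: sums_def)
        then have lim: "(\<lambda>n. ennreal (\<Sum>i<n. \<nu> (B \<inter> A i))) \<longlonglongrightarrow> ennreal (\<nu> B)"
          by (rule tendsto_ennrealI)
        have "ennreal (\<Sum>i<n. \<nu> (B \<inter> A i)) \<le> (\<Sum>i. U (A i))" for n
        proof -
          have "ennreal (\<Sum>i<n. \<nu> (B \<inter> A i)) \<le> ennreal (\<Sum>i<n. max 0 (\<nu> (B \<inter> A i)))"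
            by (intro ennreal_leI sum_mono) auto
          also have "\<dots> = (\<Sum>i<n. ennreal (max 0 (\<nu> (B \<inter> A i))))"
            by (subst sum_ennreal) auto
          also have "\<dots> = (\<Sum>i<n. ennreal (\<nu> (B \<inter> A i)))"
            by (intro sum.cong refl) (auto simp: max_def ennreal_neg)
          also have "\<dots> \<le> (\<Sum>i<n. U (A i))"
            using A B by (intro sum_mono U_ge) auto
          also have "\<dots> \<le> (\<Sum>i. U (A i))" by (rule sum_le_suminf) auto
          finally show ?thesis .
        qed
        then show ?thesis by (intro LIMSEQ_le_const2[OF lim]) auto
      qed
      then show "U (\<Union>i. A i) \<le> (\<Sum>i. U (A i))"
        unfolding U_def[of "\<Union>i. A i"] by (intro SUP_least) auto
    qed
  qed
  then show ?thesis
    unfolding upper_variation_def U_def[symmetric] using A U_empty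
    by (intro emeasure_measure_of_sigma) (simp_all add: sets.sigma_algebra_axioms positive_def)
qed


section \<open>Functions of bounded variation on an open interval\<close>

text \<open>Smooth functions with compact support in \<open>I\<close>, extended by 0 to the real line.\<close>

definition test_functions :: "real set \<Rightarrow> (real \<Rightarrow> real) set" where
  "test_functions I = {\<phi>. (\<forall>k. (deriv ^^ k) \<phi> differentiable_on UNIV) \<and>
     compact (closure {x. \<phi> x \<noteq> 0}) \<and> closure {x. \<phi> x \<noteq> 0} \<subseteq> I}"

abbreviation borel_on :: "real set \<Rightarrow> real measure" where
  "borel_on I \<equiv> restrict_space borel I"

text \<open>\<open>\<mu>\<close> is the distributional derivative of \<open>u\<close> on \<open>I\<close>; as usual, functions are
  representatives of their almost-everywhere classes.\<close>

definition has_distr_deriv ::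
    "real set \<Rightarrow> (real \<Rightarrow> real^'n^'n) \<Rightarrow> (real set \<Rightarrow> real^'n^'n) \<Rightarrow> bool" where
  "has_distr_deriv I u \<mu> \<longleftrightarrow> vector_measure (borel_on I) \<mu> \<and>
     (\<forall>\<phi>\<in>test_functions I. \<forall>i j.
        (LINT s:I|lebesgue. u s $ i $ j * deriv \<phi> s) =
        - signed_integral (borel_on I) (\<lambda>A. \<mu> A $ i $ j) \<phi>)"

definition BV :: "real set \<Rightarrow> (real^'n^'n) set \<Rightarrow> (real \<Rightarrow> real^'n^'n) set" where
  "BV I X = {u. set_integrable lebesgue I u \<and> (\<exists>\<mu>. has_distr_deriv I u \<mu>) \<and>
     (AE s\<in>I in lebesgue. u s \<in> X)}"

text \<open>The measure \<open>Du\<close>: the choice is unique on the Borel subsets of an open interval, and the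
  values on other sets are never used.\<close>

definition distr_deriv :: "real set \<Rightarrow> (real \<Rightarrow> real^'n^'n) \<Rightarrow> real set \<Rightarrow> real^'n^'n" where
  "distr_deriv I u = (SOME \<mu>. has_distr_deriv I u \<mu>)"

definition no_jump_part :: "real set \<Rightarrow> (real \<Rightarrow> real^'n^'n) \<Rightarrow> bool" where
  "no_jump_part I u \<longleftrightarrow> (\<forall>s\<in>I. distr_deriv I u {s} = 0)"

text \<open>One-sided limits of a function given up to null sets are essential limits: convergence
  along these filters ignores Lebesgue null sets. For functions of bounded variation they exist
  at every point, so the description operator in \<open>Lim\<close> is proper.\<close>

definition ess_at_right :: "real \<Rightarrow> real filter" where
  "ess_at_right s = inf (ae_filter lebesgue) (at_right s)"

definition ess_at_left :: "real \<Rightarrow> real filter" where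
  "ess_at_left s = inf (ae_filter lebesgue) (at_left s)"

definition precise_rep :: "(real \<Rightarrow> real^'n^'n) \<Rightarrow> real \<Rightarrow> real^'n^'n" where
  "precise_rep u s = (1/2) *\<^sub>R (Lim (ess_at_right s) u + Lim (ess_at_left s) u)"


section \<open>The system\<close>

definition Sk :: "(real^'n^'n) set" where
  "Sk = {B. transpose B = - B}"

definition SO :: "(real^'n^'n) set" where
  "SO = {Q. rotation_matrix Q}"

text \<open>The matrix product of the matrix function \<open>(G\<^sup>T)\<^sup>-\<^sup>1\<close> with the matrix measure \<open>D\<Omega>\<close> is taken
  entrywise. As \<open>(G\<^sup>T)\<^sup>-\<^sup>1\<close> could a priori be unbounded, the existence of the integrals on the
  right-hand side is part of the notion of solution (the Bochner integral of a non-integrable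
  function is 0 by convention).\<close>

definition is_solution ::
    "real \<Rightarrow> (real \<Rightarrow> real^'n^'n) \<Rightarrow> real^'n^'n \<Rightarrow> (real \<Rightarrow> real^'n^'n) \<Rightarrow> bool" where
  "is_solution L \<Omega> G0 G \<longleftrightarrow>
     G \<in> BV {0<..<L} UNIV \<and>
     (\<forall>s\<in>{0<..<L}. invertible (precise_rep G s)) \<and>
     (\<forall>\<phi>\<in>test_functions {0<..<L}. \<forall>i j.
        (\<forall>k. signed_integrable (borel_on {0<..<L})
           (\<lambda>A. distr_deriv {0<..<L} \<Omega> A $ k $ j)
           (\<lambda>s. \<phi> s * matrix_inv (transpose (precise_rep G s)) $ i $ k)) \<and>
        (LINT s:{0<..<L}|lebesgue. G s $ i $ j * deriv \<phi> s) =
        (\<Sum>k\<in>UNIV. signed_integral (borel_on {0<..<L})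
           (\<lambda>A. distr_deriv {0<..<L} \<Omega> A $ k $ j)
           (\<lambda>s. \<phi> s * matrix_inv (transpose (precise_rep G s)) $ i $ k))) \<and>
     (G \<longlongrightarrow> G0) (ess_at_right 0)"

end

(*
  A continuous BV function Omega has an atomless derivative, which can be written as h M with a finite
  Borel measure M and an integrable matrix density h, skew-symmetric M-almost everywhere. A solution is
  then a continuous primitive G = c - int (G^T)^{-1} h dM; here the continuity has to come first,
  since the precise representative is only assumed to be invertible pointwise. The product
  rule for primitives (Fubini's theorem, no atoms) gives d(G^T G) = - (h + h^T) dM = 0, so that G is
  orthogonal and the equation becomes linear, dG = - G h dM. The linear equation is solved by its
  Neumann series, whose solution satisfies d(G G^T) = - G (h + h^T) G^T dM = 0. Two orthogonal solutions
  G and P coincide because d(P G^T) = - P (h + h^T) G^T dM = 0 as well: no Gronwall argument is needed.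
*)
theory Submission
  imports Defs
begin

section \<open>Smooth functions and test functions\<close>

text \<open>The order of the factors decides which product is conserved. In the nonlinear equation
  G^T cancels the inverse, so that G^T G changes by -(h + h^T) dM. In the linear equation the
  product G G^T puts h + h^T between G and its transpose, whereas G^T G would not visibly be
  constant. As the matrices are square, either identity gives orthogonality. The obstacle lies at
  the ends of the interval: before orthogonality is known the inverse may be unbounded there, and
  the equation controls it only against test functions. An arbitrary solution is therefore treated
  as a primitive over compact subintervals, and the initial value enters afterwards, as an essential
  limit of the conserved products. One measure M carries all entries of the derivative because the
  matrix product mixes them. The equation is weak in two ways, up to null sets and against test
  functions; the lemma of du Bois-Reymond turns it into an identity of primitives, and their
  continuity then identifies the precise representative.\<close>

definition smooth_real :: "(real \<Rightarrow> real) \<Rightarrow> bool" where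
  "smooth_real f \<longleftrightarrow> (\<forall>k. (deriv ^^ k) f differentiable_on UNIV)"

text \<open>The set \<open>S\<close> is an invariant that contains all iterated derivatives. Each
  smoothness proof thus amounts to a class of differentiable functions closed under
  \<open>deriv\<close>.\<close>

lemma smooth_realI:
  assumes "f \<in> S" "\<And>g. g \<in> S \<Longrightarrow> g differentiable_on UNIV" "\<And>g. g \<in> S \<Longrightarrow> deriv g \<in> S"
  shows "smooth_real f"
proof -
  have "(deriv ^^ k) f \<in> S" for k
    by (induction k) (use assms in auto)
  then show ?thesis
    unfolding smooth_real_def using assms(2) by blast
qed

lemma smooth_real_deriv: "smooth_real f \<Longrightarrow> smooth_real (deriv f)"
  unfolding smooth_real_def by (metis funpow_Suc_right o_apply)

lemma smooth_real_DERIV: "smooth_real f \<Longrightarrow> (f has_real_derivative deriv f x) (at x)"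
  unfolding smooth_real_def
  by (metis DERIV_deriv_iff_real_differentiable UNIV_I differentiable_on_def funpow_0)

lemma smooth_real_differentiable: "smooth_real f \<Longrightarrow> f differentiable_on UNIV"
  unfolding smooth_real_def by (metis funpow_0)

lemma smooth_real_continuous: "smooth_real f \<Longrightarrow> continuous_on S f"
  using smooth_real_differentiable differentiable_imp_continuous_on continuous_on_subset
  by (metis subset_UNIV)

lemma smooth_real_antideriv:
  assumes "\<And>x. (F has_real_derivative f x) (at x)" "smooth_real f"
  shows "smooth_real F"
proof -
  have "deriv F = f"
    using assms(1) DERIV_imp_deriv by blast
  then show ?thesis
    using assms(1) smooth_real_deriv smooth_real_differentiable \<open>smooth_real f\<close>
    by (intro smooth_realI[of F "insert F {g. smooth_real g}"])
       (auto simp: differentiable_on_def real_differentiable_def)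
qed

lemma smooth_real_const: "smooth_real (\<lambda>x. c)"
  by (rule smooth_realI[of _ "range (\<lambda>c x. c)"]) auto

text \<open>A class of functions that is closed under differentiation by the Leibniz rule; the products
  alone are not.\<close>

inductive product_sum :: "(real \<Rightarrow> real) \<Rightarrow> bool" where
  prod: "smooth_real f \<Longrightarrow> smooth_real g \<Longrightarrow> product_sum (\<lambda>x. f x * g x)"
| sum: "product_sum u \<Longrightarrow> product_sum v \<Longrightarrow> product_sum (\<lambda>x. u x + v x)"

lemma product_sum_DERIV:
  "product_sum u \<Longrightarrow> \<exists>u'. product_sum u' \<and> (\<forall>x. (u has_real_derivative u' x) (at x))"
proof (induction rule: product_sum.induct)
  case (prod f g)
  then show ?case
    by (intro exI[of _ "\<lambda>x. deriv f x * g x + f x * deriv g x"])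
       (auto intro!: product_sum.intros smooth_real_deriv derivative_eq_intros smooth_real_DERIV)
next
  case (sum u v)
  then obtain u' v' where "product_sum u'" "product_sum v'"
    "\<forall>x. (u has_real_derivative u' x) (at x)" "\<forall>x. (v has_real_derivative v' x) (at x)" by blast
  then show ?case
    by (intro exI[of _ "\<lambda>x. u' x + v' x"])
       (auto intro!: product_sum.intros derivative_eq_intros)
qed

lemma product_sum_smooth: "product_sum u \<Longrightarrow> smooth_real u"
proof (rule smooth_realI[of u "Collect product_sum"])
  fix g assume "g \<in> Collect product_sum"
  then obtain g' where g': "product_sum g'" "\<forall>x. (g has_real_derivative g' x) (at x)"
    using product_sum_DERIV by blast
  moreover have "deriv g = g'"
    using g'(2) DERIV_imp_deriv by blast
  ultimately show "g differentiable_on UNIV" "deriv g \<in> Collect product_sum"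
    by (auto simp: differentiable_on_def real_differentiable_def)
qed auto

lemma smooth_real_mult: "smooth_real f \<Longrightarrow> smooth_real g \<Longrightarrow> smooth_real (\<lambda>x. f x * g x)"
  by (rule product_sum_smooth[OF product_sum.prod])

lemma smooth_real_add:
  assumes "smooth_real f" "smooth_real g" shows "smooth_real (\<lambda>x. f x + g x)"
  using product_sum_smooth[OF product_sum.sum[OF product_sum.prod product_sum.prod,
      OF assms(1) smooth_real_const assms(2) smooth_real_const, of 1 1]] by simp

lemma smooth_real_affine:
  assumes "smooth_real f" shows "smooth_real (\<lambda>x. f (a * x + b))"
\<comment> \<open>The free factor \<open>c\<close> in the class absorbs the \<open>a\<close> that
  each application of the chain rule produces.\<close>
proof (rule smooth_realI[of _ "{\<lambda>x. c * f (a * x + b) | c f. smooth_real f}"])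
  fix g assume "g \<in> {\<lambda>x. c * f (a * x + b) | c f. smooth_real f}"
  then obtain c f where g: "g = (\<lambda>x. c * f (a * x + b))" "smooth_real f" by blast
  have *: "(g has_real_derivative (c * a) * deriv f (a * x + b)) (at x)" for x
    unfolding g(1)
    by (rule derivative_eq_intros DERIV_chain2[OF smooth_real_DERIV[OF g(2)]] refl | simp)+
  then have "deriv g = (\<lambda>x. (c * a) * deriv f (a * x + b))"
    using DERIV_imp_deriv by blast
  then show "deriv g \<in> {\<lambda>x. c * f (a * x + b) | c f. smooth_real f}"
    using smooth_real_deriv[OF g(2)] by blast
  show "g differentiable_on UNIV"
    using * by (auto simp: differentiable_on_def real_differentiable_def)
next
  show "(\<lambda>x. f (a * x + b)) \<in> {\<lambda>x. c * f (a * x + b) | c f. smooth_real f}"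
    using assms by (intro CollectI exI[of _ 1] exI[of _ f]) auto
qed

text \<open>The case \<open>p = 1\<close> is the usual flat function; the polynomial factor makes the class closed
  under differentiation.\<close>

definition flat_poly :: "real poly \<Rightarrow> real \<Rightarrow> real" where
  "flat_poly p x = (if x > 0 then poly p (1 / x) * exp (- (1 / x)) else 0)"

lemma poly_exp_tendsto_0: "((\<lambda>y::real. poly p y * exp (- y)) \<longlongrightarrow> 0) at_top"
proof -
  have "((\<lambda>y::real. \<Sum>i\<le>degree p. coeff p i * (y ^ i / exp y)) \<longlongrightarrow> (\<Sum>i\<le>degree p. coeff p i * 0)) at_top"
    by (intro tendsto_intros tendsto_power_div_exp_0)
  then show ?thesis
    by (simp add: poly_altdef sum_distrib_right exp_minus divide_inverse mult.assoc)
qed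

text \<open>With y = 1/x the derivative of p(y) e^(-y) is y^2 (p(y) - p'(y)) e^(-y), because dy/dx =
  -y^2; the two nested \<open>pCons 0\<close> are the factor y^2. At 0 the difference quotient from
  the right is y p(y) e^(-y) with y tending to infinity, and the exponential wins.\<close>

lemma flat_poly_DERIV:
  "(flat_poly p has_real_derivative flat_poly (pCons 0 (pCons 0 (p - pderiv p))) x) (at x)"
proof -
  consider "x > 0" | "x < 0" | "x = 0" by linarith
  then show ?thesis
  proof cases
    case 1
    have e: "((\<lambda>x. exp (- (1 / x))) has_real_derivative exp (- (1 / x)) * (1 / x\<^sup>2)) (at x)"
      using 1 by (auto intro!: derivative_eq_intros simp: power2_eq_square)
    have i: "((\<lambda>x::real. 1 / x) has_real_derivative - (1 / x\<^sup>2)) (at x)"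
      using 1 by (auto intro!: derivative_eq_intros simp: power2_eq_square)
    have "((\<lambda>x. poly p (1 / x) * exp (- (1 / x))) has_real_derivative
        poly (pderiv p) (1 / x) * - (1 / x\<^sup>2) * exp (- (1 / x)) +
        exp (- (1 / x)) * (1 / x\<^sup>2) * poly p (1 / x)) (at x)"
      by (rule DERIV_mult[OF DERIV_chain2[OF poly_DERIV i] e])
    moreover have "poly (pderiv p) (1 / x) * - (1 / x\<^sup>2) * exp (- (1 / x)) +
        exp (- (1 / x)) * (1 / x\<^sup>2) * poly p (1 / x) = flat_poly (pCons 0 (pCons 0 (p - pderiv p))) x"
      using 1 by (simp add: flat_poly_def power2_eq_square algebra_simps)
    moreover have "\<forall>\<^sub>F x in nhds x. flat_poly p x = poly p (1 / x) * exp (- (1 / x))"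
      by (rule eventually_mono[OF eventually_nhds_in_open[of "{0<..}" x]])
         (use 1 in \<open>auto simp: flat_poly_def\<close>)
    ultimately show ?thesis using DERIV_cong_ev[OF refl _ refl] by metis
  next
    case 2
    have "\<forall>\<^sub>F x in nhds x. flat_poly p x = 0"
      by (rule eventually_mono[OF eventually_nhds_in_open[of "{..<0}" x]])
         (use 2 in \<open>auto simp: flat_poly_def\<close>)
    then show ?thesis using 2 DERIV_cong_ev[of x x "flat_poly p" "\<lambda>_. 0" 0 0]
      by (simp add: flat_poly_def)
  next
    case 3
    have "((\<lambda>y. flat_poly p y / y) \<longlongrightarrow> 0) (at_right 0)"
    proof (rule Lim_transform_eventually)
      show "((\<lambda>y. poly (pCons 0 p) (inverse y) * exp (- (inverse y))) \<longlongrightarrow> 0) (at_right 0)"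
        by (rule filterlim_compose[OF poly_exp_tendsto_0 filterlim_inverse_at_top_right])
      show "\<forall>\<^sub>F y in at_right 0. poly (pCons 0 p) (inverse y) * exp (- (inverse y)) = flat_poly p y / y"
        by (auto simp: eventually_at_filter flat_poly_def field_simps)
    qed
    moreover have "((\<lambda>y. flat_poly p y / y) \<longlongrightarrow> 0) (at_left 0)"
      by (rule Lim_transform_eventually[OF tendsto_const])
         (auto simp: eventually_at_filter flat_poly_def)
    ultimately have "((\<lambda>y. flat_poly p y / y) \<longlongrightarrow> 0) (at 0)"
      by (simp add: filterlim_at_split)
    then show ?thesis unfolding 3 has_field_derivative_iff
      by (simp add: flat_poly_def)
  qed
qed

lemma smooth_flat_poly: "smooth_real (flat_poly p)"
proof (rule smooth_realI[of _ "range flat_poly"])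
  fix g assume "g \<in> range flat_poly"
  then obtain p where p: "g = flat_poly p" by blast
  show "deriv g \<in> range flat_poly"
    using flat_poly_DERIV[of p] DERIV_imp_deriv unfolding p by blast
  show "g differentiable_on UNIV"
    using flat_poly_DERIV[of p] unfolding p
    by (auto simp: differentiable_on_def real_differentiable_def)
qed auto

text \<open>The shift by 1 keeps the support inside \<open>{x + 1 / m..y - 1 / m}\<close>, so that these are test functions
  even on \<open>{x<..<y}\<close>; for \<open>m = 0\<close> the function vanishes.\<close>

definition bump :: "real \<Rightarrow> real \<Rightarrow> nat \<Rightarrow> real \<Rightarrow> real" where
  "bump x y m t = flat_poly 1 (m * (t - x) - 1) * flat_poly 1 (m * (y - t) - 1)"

lemma smooth_bump: "smooth_real (bump x y m)"
  using smooth_real_mult[OF smooth_real_affine smooth_real_affine, OF smooth_flat_poly smooth_flat_poly,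
      of 1 m "- (m * x) - 1" 1 "- m" "m * y - 1"]
  by (simp add: bump_def[abs_def] algebra_simps)

lemma flat_poly_1_bounds: "0 \<le> flat_poly 1 x" "flat_poly 1 x \<le> 1"
  by (auto simp: flat_poly_def)

lemma flat_poly_1_mono: "x \<le> y \<Longrightarrow> flat_poly 1 x \<le> flat_poly 1 y"
  by (auto simp: flat_poly_def frac_le)

lemma bump_bounds: "0 \<le> bump x y m t" "bump x y m t \<le> 1"
  by (auto simp: bump_def flat_poly_1_bounds mult_le_one)

lemma bump_nonzero:
  assumes "bump x y m t \<noteq> 0" shows "m > 0" "x + 1 / m < t" "t < y - 1 / m"
proof -
  have *: "m * (t - x) - 1 > 0" "m * (y - t) - 1 > 0"
    using assms by (auto simp: bump_def flat_poly_def split: if_splits)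
  then show "m > 0" by (cases m) auto
  then show "x + 1 / m < t" "t < y - 1 / m"
    using * by (auto simp: field_simps)
qed

text \<open>Inside the interval both arguments of \<open>flat_poly 1\<close> tend to infinity, where
  this function tends to 1; outside, every bump vanishes. With the uniform bound by 1, dominated
  convergence then allows testing against indicators of open intervals.\<close>

lemma bump_tendsto: "(\<lambda>m. bump x y m t) \<longlonglongrightarrow> indicator {x<..<y} t"
proof (cases "t \<in> {x<..<y}")
  case True
  have f: "(\<lambda>m::nat. flat_poly 1 (m * d - 1)) \<longlonglongrightarrow> 1" if "d > 0" for d :: real
  proof -
    have lim: "filterlim (\<lambda>m::nat. m * d - 1) at_top sequentially"
      using that
      by (intro filterlim_tendsto_add_at_top[of "\<lambda>_. -1" "-1", simplified add.commute[of "-1"], simplified]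
          filterlim_at_top_mult_tendsto_pos[OF tendsto_const] filterlim_real_sequentially)
    then have "(\<lambda>m::nat. exp (- (1 / (m * d - 1)))) \<longlonglongrightarrow> exp (- 0)"
      by (intro tendsto_intros tendsto_divide_0[OF tendsto_const] filterlim_at_top_imp_at_infinity)
    moreover have "\<forall>\<^sub>F m in sequentially. m * d - 1 > 0"
      using lim unfolding filterlim_at_top_dense by blast
    then have "\<forall>\<^sub>F m in sequentially. exp (- (1 / (m * d - 1))) = flat_poly 1 (m * d - 1)"
      by eventually_elim (auto simp: flat_poly_def)
    ultimately show ?thesis
      by (simp add: Lim_transform_eventually)
  qed
  show ?thesis
    using tendsto_mult[OF f[of "t - x"] f[of "y - t"]] True by (simp add: bump_def)
next
  case False
  have "bump x y m t = 0" for m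
  proof (rule ccontr)
    assume *: "bump x y m t \<noteq> 0"
    have "1 / real m \<ge> 0" by simp
    then show False
      using bump_nonzero(2,3)[OF *] False unfolding greaterThanLessThan_iff by linarith
  qed
  then show ?thesis using False by simp
qed

section \<open>Test functions: membership, supports, bounds\<close>

lemma test_functionsI:
  assumes "smooth_real \<phi>" "\<And>x. \<phi> x \<noteq> 0 \<Longrightarrow> c \<le> x \<and> x \<le> d" "{c..d} \<subseteq> I"
  shows "\<phi> \<in> test_functions I"
proof -
  have "closure {x. \<phi> x \<noteq> 0} \<subseteq> {c..d}"
    using assms(2) by (intro closure_minimal) auto
  then show ?thesis
    using assms(1,3) bounded_subset[OF bounded_closed_interval[of c d]]
    unfolding test_functions_def smooth_real_def compact_eq_bounded_closed by blast
qed

lemma bump_test: 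
  assumes "a \<le> x" "y \<le> b" shows "bump x y m \<in> test_functions {a<..<b}"
proof (cases "m = 0")
  case True
  then have "bump x y m t = 0" for t using bump_nonzero(1)[of x y m t] by auto
  then show ?thesis
    \<comment> \<open>The empty interval \<open>{1..0}\<close> serves as support of the zero
      function, whatever \<open>a\<close> and \<open>b\<close> are.\<close>
    by (intro test_functionsI[of _ 1 0] smooth_bump) auto
next
  case False
  then have "1 / real m > 0" by simp
  then have "{x + 1 / m..y - 1 / m} \<subseteq> {a<..<b}"
    using assms by (auto simp del: zero_less_divide_1_iff of_nat_0_less_iff zero_less_divide_iff)
  then show ?thesis
    using bump_nonzero(2,3)[of x y m]
    by (intro test_functionsI[of _ "x + 1 / m" "y - 1 / m"] smooth_bump) (auto simp: less_imp_le)
qed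

lemma test_function_smooth: "\<phi> \<in> test_functions I \<Longrightarrow> smooth_real \<phi>"
  by (auto simp: test_functions_def smooth_real_def)

lemma test_function_support:
  assumes "\<phi> \<in> test_functions {a<..<b}" "a < b"
  obtains c d where "a < c" "c \<le> d" "d < b" "\<And>x. x \<notin> {c..d} \<Longrightarrow> \<phi> x = 0"
proof (cases "{x. \<phi> x \<noteq> 0} = {}")
  case True
  \<comment> \<open>The zero function has empty support; the midpoint keeps \<open>c \<le> d\<close>
    true.\<close>
  then show ?thesis using assms by (intro that[of "(a+b)/2" "(a+b)/2"]) auto
next
  case False
  define K where "K = closure {x. \<phi> x \<noteq> 0}"
  have K: "compact K" "K \<noteq> {}" "K \<subseteq> {a<..<b}"
    using assms False by (auto simp: K_def test_functions_def)
  obtain c d where "c \<in> K" "\<forall>t\<in>K. c \<le> t" "d \<in> K" "\<forall>t\<in>K. t \<le> d"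
    using compact_attains_inf[OF K(1,2)] compact_attains_sup[OF K(1,2)] by blast
  moreover have "\<phi> x \<noteq> 0 \<Longrightarrow> x \<in> K" for x
    using closure_subset by (force simp: K_def)
  ultimately show ?thesis
    using K by (intro that[of c d]) auto
qed

lemma test_function_deriv_0:
  assumes "\<And>x. x \<notin> {c..d} \<Longrightarrow> \<phi> x = (0::real)" "x \<notin> {c..d}"
  shows "deriv \<phi> x = 0"
proof -
  have "eventually (\<lambda>x. x \<in> - {c..d}) (nhds x)"
    using assms(2) by (intro eventually_nhds_in_open) auto
  then have "eventually (\<lambda>x. \<phi> x = 0) (nhds x)"
    by (rule eventually_mono) (use assms(1) in auto)
  then show ?thesis
    using deriv_cong_ev[of \<phi> "\<lambda>_. 0" x x] by simp
qed

lemma bounded_continuous_support: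
  fixes f :: "real \<Rightarrow> real"
  assumes "continuous_on UNIV f" "\<And>x. x \<notin> {c..d} \<Longrightarrow> f x = 0"
  obtains B where "\<And>x. \<bar>f x\<bar> \<le> B"
proof -
  have bdd: "bounded (f ` {c..d})"
    using continuous_on_subset[OF assms(1)] by (intro compact_imp_bounded compact_continuous_image) auto
  obtain B where B: "\<And>x. x \<in> {c..d} \<Longrightarrow> \<bar>f x\<bar> \<le> B"
    using bdd unfolding bounded_iff by (metis imageI real_norm_def)
  have "\<bar>f x\<bar> \<le> max B 0" for x
    using B[of x] assms(2)[of x] by (cases "x \<in> {c..d}") auto
  then show ?thesis using that by blast
qed

section \<open>Signed measures and densities\<close>

lemma sets_upper_variation [simp]: "sets (upper_variation M \<nu>) = sets M"
  by (simp add: upper_variation_def)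

lemma vector_measure_bounded_linear:
  assumes "bounded_linear f" "vector_measure M \<nu>" shows "vector_measure M (\<lambda>A. f (\<nu> A))"
  using assms bounded_linear.sums unfolding vector_measure_def by blast

lemma vector_measure_minus: "vector_measure M \<nu> \<Longrightarrow> vector_measure M (\<lambda>A. - \<nu> A)"
  by (rule vector_measure_bounded_linear[OF bounded_linear_minus[OF bounded_linear_ident]])

lemma vector_measure_Diff:
  assumes "vector_measure M \<nu>" "A \<in> sets M" "B \<in> sets M" "B \<subseteq> A"
  shows "\<nu> (A - B) = \<nu> A - \<nu> B"
  using vector_measure_Un[OF assms(1), of B "A - B"] assms by (simp add: Un_absorb1)

text \<open>If the total variation \<open>T\<close> were infinite, one could split off infinitely many disjoint pieces with
  \<open>\<bar>\<nu>\<bar> \<ge> 1\<close>, always keeping a remainder of infinite variation.\<close>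

lemma finite_upper_variation:
  assumes \<nu>: "vector_measure M \<nu>"
  shows "emeasure (upper_variation M \<nu>) (space M) < \<infinity>"
proof (rule ccontr)
  define T where "T A = emeasure (upper_variation M \<nu>) A + emeasure (upper_variation M (\<lambda>A. - \<nu> A)) A" for A
  note \<nu>' = vector_measure_minus[OF \<nu>]
  assume "\<not> ?thesis"
  then have "emeasure (upper_variation M \<nu>) (space M) = top" by (simp add: not_less top_unique)
  then have T0: "T (space M) = \<infinity>" by (simp add: T_def)
  have step: "\<exists>B\<in>sets M. B \<subseteq> A \<and> T B = \<infinity> \<and> 1 \<le> \<bar>\<nu> (A - B)\<bar>" if A: "A \<in> sets M" "T A = \<infinity>" for A
  proof -
    \<comment> \<open>The margin \<open>1 + \<bar>\<nu> A\<bar>\<close> makes both \<open>C\<close>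
      and \<open>A - C\<close> have \<bar>\<nu>\<bar> at least 1, so either of them may be split off
      and the one of infinite variation kept.\<close>
    have "\<exists>C\<in>sets M. C \<subseteq> A \<and> 1 + \<bar>\<nu> A\<bar> \<le> \<bar>\<nu> C\<bar>"
    proof -
      have sup: "\<exists>C\<in>sets M. C \<subseteq> A \<and> 1 + \<bar>\<nu> A\<bar> \<le> \<kappa> C"
        if "vector_measure M \<kappa>" "emeasure (upper_variation M \<kappa>) A = \<infinity>" for \<kappa>
      proof -
        have "ennreal (1 + \<bar>\<nu> A\<bar>) < (SUP B\<in>{B \<in> sets M. B \<subseteq> A}. ennreal (\<kappa> B))"
          using that A by (simp add: emeasure_upper_variation[symmetric])
        then obtain C where "C \<in> sets M" "C \<subseteq> A" "ennreal (1 + \<bar>\<nu> A\<bar>) < ennreal (\<kappa> C)"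
          unfolding less_SUP_iff by blast
        moreover from this(3) have "1 + \<bar>\<nu> A\<bar> < \<kappa> C"
          by (subst (asm) ennreal_less_iff) auto
        ultimately show ?thesis by (intro bexI[of _ C]) auto
      qed
      have "emeasure (upper_variation M \<nu>) A = \<infinity> \<or> emeasure (upper_variation M (\<lambda>A. - \<nu> A)) A = \<infinity>"
        using A(2) by (simp add: T_def)
      then show ?thesis
      proof
        assume "emeasure (upper_variation M \<nu>) A = \<infinity>"
        from sup[OF \<nu> this] obtain C where "C \<in> sets M" "C \<subseteq> A" "1 + \<bar>\<nu> A\<bar> \<le> \<nu> C" by blast
        then show ?thesis by (intro bexI[of _ C]) auto
      next
        assume "emeasure (upper_variation M (\<lambda>A. - \<nu> A)) A = \<infinity>"
        from sup[OF \<nu>' this] obtain C where "C \<in> sets M" "C \<subseteq> A" "1 + \<bar>\<nu> A\<bar> \<le> - \<nu> C" by blast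
        then show ?thesis by (intro bexI[of _ C]) auto
      qed
    qed
    then obtain C where C: "C \<in> sets M" "C \<subseteq> A" "1 + \<bar>\<nu> A\<bar> \<le> \<bar>\<nu> C\<bar>" by blast
    have add: "emeasure N A = emeasure N C + emeasure N (A - C)" if "sets N = sets M" for N
      using plus_emeasure[of C N "A - C"] C A that by (simp add: Un_absorb1)
    have "T A = T C + T (A - C)"
      unfolding T_def by (subst (1 2) add) (simp_all add: ac_simps)
    then have "T C = \<infinity> \<or> T (A - C) = \<infinity>"
      using A(2) by (metis ennreal_add_eq_top infinity_ennreal_def)
    then consider "T C = \<infinity>" | "T (A - C) = \<infinity>" by blast
    then show ?thesis
    proof cases
      case 1
      then show ?thesis using C A vector_measure_Diff[OF \<nu> A(1) C(1,2)] by (intro bexI[of _ C]) auto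
    next
      case 2
      have "A - (A - C) = C" using C by blast
      then show ?thesis using 2 C A by (intro bexI[of _ "A - C"]) auto
    qed
  qed
  obtain A where A: "\<And>n. A n \<in> sets M \<and> T (A n) = \<infinity>"
    "\<And>n. A (Suc n) \<subseteq> A n \<and> 1 \<le> \<bar>\<nu> (A n - A (Suc n))\<bar>"
  proof -
    have "\<exists>A. \<forall>n. (A n \<in> sets M \<and> T (A n) = \<infinity>) \<and> (A (Suc n) \<subseteq> A n \<and> 1 \<le> \<bar>\<nu> (A n - A (Suc n))\<bar>)"
    proof (rule dependent_nat_choice)
      show "\<exists>x. x \<in> sets M \<and> T x = \<infinity>" using T0 by blast
    qed (use step in blast)
    then show ?thesis using that by blast
  qed
  have dec: "decseq A" using A(2) by (intro decseq_SucI) auto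
  have "(A m - A (Suc m)) \<inter> (A n - A (Suc n)) = {}" if "m < n" for m n
    using decseqD[OF dec, of "Suc m" n] that by auto
  then have disj: "disjoint_family (\<lambda>n. A n - A (Suc n))"
    unfolding disjoint_family_on_def by (metis Int_commute linorder_neqE_nat)
  moreover have "range (\<lambda>n. A n - A (Suc n)) \<subseteq> sets M"
    using A(1) by auto
  ultimately have "(\<lambda>n. \<nu> (A n - A (Suc n))) sums \<nu> (\<Union>n. A n - A (Suc n))"
    using \<nu> unfolding vector_measure_def by blast
  then have "(\<lambda>n. \<nu> (A n - A (Suc n))) \<longlonglongrightarrow> 0"
    by (intro summable_LIMSEQ_zero sums_summable)
  then have "\<forall>\<^sub>F n in sequentially. \<bar>\<nu> (A n - A (Suc n))\<bar> < 1"
    by (auto dest: tendstoD[where e=1])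
  then obtain n where "\<bar>\<nu> (A n - A (Suc n))\<bar> < 1"
    by (auto simp: eventually_sequentially)
  then show False using A(2)[of n] by linarith
qed

section \<open>Jordan decomposition and common densities\<close>

lemma finite_measure_upper_variation:
  "vector_measure M \<nu> \<Longrightarrow> finite_measure (upper_variation M \<nu>)"
  using finite_upper_variation[of M \<nu>]
  by (intro finite_measureI) (auto simp: upper_variation_def space_measure_of_conv)

text \<open>For B inside A, \<nu>(B) = \<nu>(A) - \<nu>(A - B) is at most \<nu>(A) plus the negative
  variation of A. The supremum over B gives one inequality, and the same argument for -\<nu> gives
  the other; finiteness of the variations permits the subtraction.\<close>

lemma jordan_decomposition:
  assumes \<nu>: "vector_measure M \<nu>" and A: "A \<in> sets M"
  shows "\<nu> A = measure (upper_variation M \<nu>) A - measure (upper_variation M (\<lambda>A. - \<nu> A)) A"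
proof -
  have upper: "\<kappa> B \<le> measure (upper_variation M \<kappa>) A"
    if "vector_measure M \<kappa>" "B \<in> sets M" "B \<subseteq> A" for \<kappa> B
  proof -
    interpret finite_measure "upper_variation M \<kappa>" by (rule finite_measure_upper_variation[OF that(1)])
    have "ennreal (\<kappa> B) \<le> emeasure (upper_variation M \<kappa>) A"
      unfolding emeasure_upper_variation[OF that(1) A] using that by (intro SUP_upper) auto
    then show ?thesis by (simp add: emeasure_eq_measure)
  qed
  have le: "measure (upper_variation M \<kappa>) A \<le> \<kappa> A + measure (upper_variation M (\<lambda>A. - \<kappa> A)) A"
    if "vector_measure M \<kappa>" for \<kappa>
  proof -
    interpret finite_measure "upper_variation M \<kappa>" by (rule finite_measure_upper_variation[OF that])
    let ?c = "\<kappa> A + measure (upper_variation M (\<lambda>A. - \<kappa> A)) A"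
    note \<kappa>' = vector_measure_minus[OF that]
    have "emeasure (upper_variation M \<kappa>) A \<le> ennreal ?c"
      unfolding emeasure_upper_variation[OF that A]
    proof (intro SUP_least ennreal_leI)
      fix B assume "B \<in> {B \<in> sets M. B \<subseteq> A}"
      then show "\<kappa> B \<le> ?c"
        using upper[OF \<kappa>', of "A - B"] vector_measure_Diff[OF that A, of B] A by auto
    qed
    moreover have "?c \<ge> 0" using upper[OF \<kappa>', of A] A by auto
    ultimately show ?thesis by (simp add: emeasure_eq_measure)
  qed
  show ?thesis
    using le[OF \<nu>] le[OF vector_measure_minus[OF \<nu>]] by simp
qed

lemma finite_sum_measure:
  assumes "finite F" "F \<noteq> {}" "\<And>i. i \<in> F \<Longrightarrow> finite_measure (N i)" "\<And>i. i \<in> F \<Longrightarrow> sets (N i) = sets S"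
  obtains M where "finite_measure M" "sets M = sets S"
    "\<And>A. A \<in> sets S \<Longrightarrow> emeasure M A = (\<Sum>i\<in>F. emeasure (N i) A)"
proof -
  define M where "M = measure_of (space S) (sets S) (\<lambda>A. \<Sum>i\<in>F. emeasure (N i) A)"
  have sets: "sets M = sets S" by (simp add: M_def)
  have em: "emeasure M A = (\<Sum>i\<in>F. emeasure (N i) A)" if "A \<in> sets S" for A
    unfolding M_def
  proof (rule emeasure_measure_of_sigma)
    show "countably_additive (sets S) (\<lambda>A. \<Sum>i\<in>F. emeasure (N i) A)"
    proof (rule countably_additiveI)
      fix A :: "nat \<Rightarrow> _"
      assume A: "range A \<subseteq> sets S" "disjoint_family A" "(\<Union>i. A i) \<in> sets S"
      have "(\<Sum>n. \<Sum>i\<in>F. emeasure (N i) (A n)) = (\<Sum>i\<in>F. \<Sum>n. emeasure (N i) (A n))"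
        by (rule suminf_sum) auto
      also have "\<dots> = (\<Sum>i\<in>F. emeasure (N i) (\<Union>n. A n))"
        using A assms(4) by (intro sum.cong refl suminf_emeasure) auto
      finally show "(\<Sum>n. \<Sum>i\<in>F. emeasure (N i) (A n)) = (\<Sum>i\<in>F. emeasure (N i) (\<Union>n. A n))" .
    qed
  qed (use that in \<open>auto simp: positive_def sets.sigma_algebra_axioms\<close>)
  have "finite_measure M"
    using em[of "space S"] assms sets_eq_imp_space_eq[OF sets] 
    by (intro finite_measureI) (auto simp: finite_measure.emeasure_finite)
  then show ?thesis using that sets em by blast
qed

text \<open>\<open>M\<close> is the sum of the positive and negative variations of all \<nu> i. Each
  of them is absolutely continuous with respect to \<open>M\<close>, and \<open>h i\<close> is the
  difference of two Radon-Nikodym derivatives. The last property says that \<open>M\<close> is no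
  larger than necessary; through it the absence of atoms passes from the signed measures to
  \<open>M\<close>.\<close>

lemma signed_measures_common_density:
  fixes \<nu> :: "'i \<Rightarrow> 'a set \<Rightarrow> real"
  assumes F: "finite F" "F \<noteq> {}" and \<nu>: "\<And>i. i \<in> F \<Longrightarrow> vector_measure S (\<nu> i)"
  obtains M h where "finite_measure M" "sets M = sets S"
    "\<And>i. i \<in> F \<Longrightarrow> integrable M (h i)"
    "\<And>i A. i \<in> F \<Longrightarrow> A \<in> sets S \<Longrightarrow> \<nu> i A = (LINT x:A|M. h i x)"
    "\<And>A. A \<in> sets S \<Longrightarrow> (\<And>B i. i \<in> F \<Longrightarrow> B \<in> sets S \<Longrightarrow> B \<subseteq> A \<Longrightarrow> \<nu> i B = 0) \<Longrightarrow> emeasure M A = 0"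
proof -
  \<comment> \<open>The flag \<open>b\<close> selects the sign: \<open>True\<close> gives the
    positive variation, \<open>False\<close> the negative one.\<close>
  define N where "N = (\<lambda>(i, b). upper_variation S (\<lambda>A. (if b then 1 else -1) * \<nu> i A))"
  have vm: "vector_measure S (\<lambda>A. (if b then 1 else -1) * \<nu> i A)" if "i \<in> F" for i b
    using \<nu>[OF that] vector_measure_minus[OF \<nu>[OF that]] by auto
  have finN: "finite_measure (N p)" if "p \<in> F \<times> UNIV" for p
    using vm finite_measure_upper_variation that unfolding N_def by (auto simp del: mult_minus_left)
  have setsN: "sets (N p) = sets S" for p by (auto simp: N_def split: prod.split)
  obtain M where M: "finite_measure M" "sets M = sets S"
    "\<And>A. A \<in> sets S \<Longrightarrow> emeasure M A = (\<Sum>p\<in>F \<times> UNIV. emeasure (N p) A)"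
    by (rule finite_sum_measure[of "F \<times> UNIV" N S]) (use F finN setsN in auto)
  interpret finite_measure M by (rule M)
  have "\<exists>D. D \<in> borel_measurable M \<and> (\<forall>x. 0 \<le> D x) \<and> N p = density M (\<lambda>x. ennreal (D x))"
    if p: "p \<in> F \<times> UNIV" for p
  proof -
    have ac: "absolutely_continuous M (N p)"
      unfolding absolutely_continuous_def
      using F p by (auto simp: null_sets_def M setsN)
    obtain D where D: "D \<in> borel_measurable M" "AE x in M. RN_deriv M (N p) x = ennreal (D x)" "\<And>x. 0 \<le> D x"
      using real_RN_deriv[OF finN[OF p] ac] setsN M(2) by metis
    have "density M (\<lambda>x. ennreal (D x)) = density M (RN_deriv M (N p))"
      using D by (intro density_cong) auto
    also have "\<dots> = N p" using ac setsN M(2) by (intro density_RN_deriv) auto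
    finally show ?thesis using D by auto
  qed
  then obtain D where D: "\<And>p. p \<in> F \<times> UNIV \<Longrightarrow> D p \<in> borel_measurable M"
    "\<And>p x. p \<in> F \<times> UNIV \<Longrightarrow> 0 \<le> D p x"
    "\<And>p. p \<in> F \<times> UNIV \<Longrightarrow> N p = density M (\<lambda>x. ennreal (D p x))" by metis
  have int: "integrable M (\<lambda>x. indicator A x * D p x) \<and> measure (N p) A = (LINT x:A|M. D p x)"
    if p: "p \<in> F \<times> UNIV" and A: "A \<in> sets S" for A p
  proof -
    note [measurable] = D(1)[OF p]
    have [measurable]: "A \<in> sets M" using A M by simp
    have em: "emeasure (N p) A = (\<integral>\<^sup>+x. ennreal (indicator A x * D p x) \<partial>M)"
      unfolding D(3)[OF p] by (subst emeasure_density)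
         (auto intro!: nn_integral_cong simp: indicator_def)
    interpret N: finite_measure "N p" by (rule finN[OF p])
    have i: "integrable M (\<lambda>x. indicator A x * D p x)"
      using em[symmetric] D(2)[OF p] N.emeasure_finite[of A]
      by (intro integrableI_nonneg) (auto simp: less_top[symmetric])
    moreover have "measure (N p) A = (LINT x:A|M. D p x)"
      unfolding measure_def em set_lebesgue_integral_def using i D(2)[OF p]
      by (subst nn_integral_eq_integral) (auto simp: integral_nonneg_AE)
    ultimately show ?thesis by blast
  qed
  have sp: "space M = space S" using M(2) sets_eq_imp_space_eq by blast
  define h where "h i x = D (i, True) x - D (i, False) x" for i x
  show ?thesis
  proof (rule that[of M h])
    have *: "integrable M (D p)" if "p \<in> F \<times> UNIV" for p
      using int[OF that, of "space S"] Bochner_Integration.integrable_cong[OF refl, of M "\<lambda>x. indicator (space S) x * D p x" "D p"] sp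
      by auto
    show "integrable M (h i)" if "i \<in> F" for i
      unfolding h_def using * that by auto
    show "\<nu> i A = (LINT x:A|M. h i x)" if "i \<in> F" "A \<in> sets S" for i A
      using jordan_decomposition[OF \<nu>[OF that(1)] that(2)] int[of "(i, True)" A] int[of "(i, False)" A] that
      by (simp add: N_def h_def set_lebesgue_integral_def algebra_simps)
    fix A assume A: "A \<in> sets S" and zero: "\<And>B i. i \<in> F \<Longrightarrow> B \<in> sets S \<Longrightarrow> B \<subseteq> A \<Longrightarrow> \<nu> i B = 0"
    have "emeasure (N p) A = 0" if "p \<in> F \<times> UNIV" for p
    proof -
      obtain i b where p: "p = (i, b)" by force
      have i: "i \<in> F" using that p by simp
      have "emeasure (N p) A = (SUP B\<in>{B \<in> sets S. B \<subseteq> A}. ennreal ((if b then 1 else -1) * \<nu> i B))"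
        unfolding p N_def prod.case by (rule emeasure_upper_variation[OF vm[OF i] A])
      also have "\<dots> \<le> 0"
        by (intro SUP_least) (use zero[OF i] in simp)
      finally show ?thesis by simp
    qed
    then show "emeasure M A = 0" using M(3)[OF A] by simp
  qed (use M in auto)
qed

lemma bounded_linear_entry: "bounded_linear (\<lambda>A :: real^'m^'n. A $ i $ j)"
  by (intro bounded_linear_compose[OF bounded_linear_vec_nth bounded_linear_vec_nth])

lemma integrable_vec:
  fixes h :: "'n::finite \<Rightarrow> 'a \<Rightarrow> 'b::euclidean_space"
  assumes "\<And>i. integrable M (h i)"
  shows "integrable M (\<lambda>x. \<chi> i. h i x)"
proof -
  have "bounded_linear (axis i :: 'b \<Rightarrow> 'b^'n)" for i :: 'n
    by (intro linear_conv_bounded_linear[THEN iffD1] linearI) (auto simp: axis_def vec_eq_iff)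
  then have "integrable M (\<lambda>x. axis i (h i x) :: 'b^'n)" for i
    using integrable_bounded_linear assms by blast
  then have "integrable M (\<lambda>x. \<Sum>i\<in>UNIV. axis i (h i x) :: 'b^'n)" by auto
  also have "(\<lambda>x. \<Sum>i\<in>UNIV. axis i (h i x) :: 'b^'n) = (\<lambda>x. \<chi> i. h i x)"
    by (simp add: fun_eq_iff vec_eq_iff axis_def)
  finally show ?thesis .
qed

lemma integrable_matrix:
  fixes h :: "'n::finite \<Rightarrow> 'm::finite \<Rightarrow> 'a \<Rightarrow> real"
  assumes "\<And>i j. integrable M (h i j)"
  shows "integrable M (\<lambda>x. (\<chi> i j. h i j x))"
  using assms by (intro integrable_vec)

text \<open>The common dominating measure of the entries lives on \<open>I\<close>. It is pushed
  forward to the whole line and \<open>h\<close> is extended by 0, so that integrals over half lines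
  \<open>{..s}\<close> can serve as primitives. Points outside \<open>I\<close> get measure 0, hence
  the last conclusion holds for all \<open>s\<close>.\<close>

lemma matrix_measure_density:
  fixes \<mu> :: "real set \<Rightarrow> real^'n^'n"
  assumes \<mu>: "vector_measure (borel_on I) \<mu>" and I: "I \<in> sets borel"
  obtains M h where "finite_measure M" "sets M = sets borel" "integrable M h"
    "\<And>x. x \<notin> I \<Longrightarrow> h x = 0"
    "\<And>A. A \<in> sets borel \<Longrightarrow> A \<subseteq> I \<Longrightarrow> \<mu> A = (LINT x:A|M. h x)"
    "(\<And>s. s \<in> I \<Longrightarrow> \<mu> {s} = 0) \<Longrightarrow> (\<And>s. emeasure M {s} = 0)"
proof -
  obtain N g where N: "finite_measure N" "sets N = sets (borel_on I)"
    "\<And>i. integrable N (g i)"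
    "\<And>i A. A \<in> sets (borel_on I) \<Longrightarrow> \<mu> A $ fst i $ snd i = (LINT x:A|N. g i x)"
    "\<And>A. A \<in> sets (borel_on I) \<Longrightarrow> (\<And>B i. B \<in> sets (borel_on I) \<Longrightarrow> B \<subseteq> A \<Longrightarrow> \<mu> B $ fst i $ snd i = 0) \<Longrightarrow> emeasure N A = 0"
  proof (rule signed_measures_common_density[of "UNIV :: ('n \<times> 'n) set" "borel_on I" "\<lambda>p A. \<mu> A $ fst p $ snd p"])
    show "vector_measure (borel_on I) (\<lambda>A. \<mu> A $ fst p $ snd p)" for p
      by (rule vector_measure_bounded_linear[OF bounded_linear_entry \<mu>])
  qed auto
  have spN: "space N = I" using sets_eq_imp_space_eq[OF N(2)] by (simp add: space_restrict_space)
  have id[measurable]: "(\<lambda>x. x) \<in> measurable N borel"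
    unfolding measurable_cong_sets[OF N(2) refl] by (rule measurable_restrict_space1) simp
  define M where "M = distr N borel (\<lambda>x. x)"
  define h where "h x = (if x \<in> I then (\<chi> i j. g (i, j) x) else 0)" for x
  have hm[measurable]: "h \<in> borel_measurable borel"
  proof -
    have "(\<lambda>x. (\<chi> i j. g (i, j) x)) \<in> borel_measurable N"
      using integrable_matrix[of N "\<lambda>i j. g (i, j)"] N(3) by auto
    then have "(\<lambda>x. indicator I x *\<^sub>R (\<chi> i j. g (i, j) x)) \<in> borel_measurable borel"
      using I unfolding measurable_cong_sets[OF N(2) refl] by (subst (asm) borel_measurable_restrict_space_iff) auto
    also have "(\<lambda>x. indicator I x *\<^sub>R (\<chi> i j. g (i, j) x)) = h"
      by (auto simp: h_def)
    finally show ?thesis .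
  qed
  have hi: "integrable N h"
    using integrable_matrix[of N "\<lambda>i j. g (i, j)"] N(3)
    by (subst Bochner_Integration.integrable_cong[OF refl, of N _ "\<lambda>x. (\<chi> i j. g (i, j) x)"]) (auto simp: h_def spN)
  show ?thesis
  proof (rule that[of M h])
    show "finite_measure M" unfolding M_def by (rule finite_measure.finite_measure_distr[OF N(1) id])
    show "integrable M h" unfolding M_def by (subst integrable_distr_eq) (use hi in auto)
    show "\<mu> A = (LINT x:A|M. h x)" if A: "A \<in> sets borel" "A \<subseteq> I" for A
    proof -
      have A': "A \<in> sets (borel_on I)" using A I by (auto simp: sets_restrict_space_iff)
      then have [measurable]: "A \<in> sets N" using N by simp
      have "set_integrable N A h" using hi unfolding set_integrable_def by (intro integrable_mult_indicator) auto
      then have "(LINT x:A|N. h x) $ i $ j = (LINT x:A|N. h x $ i $ j)" for i j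
        unfolding set_lebesgue_integral_def set_integrable_def
        by (subst integral_bounded_linear[OF bounded_linear_entry, symmetric]) auto
      also have "(LINT x:A|N. h x $ i $ j) = (LINT x:A|N. g (i, j) x)" for i j
        using A by (intro set_lebesgue_integral_cong) (auto simp: h_def)
      also have "(LINT x:A|N. g (i, j) x) = \<mu> A $ i $ j" for i j
        using N(4)[OF A', of "(i, j)"] by simp
      finally have "(LINT x:A|N. h x) = \<mu> A" by (simp add: vec_eq_iff)
      then show ?thesis
        using A unfolding M_def set_lebesgue_integral_def by (subst integral_distr) auto
    qed
    show "emeasure M {s} = 0" if z: "\<And>s. s \<in> I \<Longrightarrow> \<mu> {s} = 0" for s
    proof (cases "s \<in> I")
      case True
      then have "{s} \<in> sets (borel_on I)" using I by (auto simp: sets_restrict_space_iff)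
      moreover have "\<mu> B = 0" if "B \<subseteq> {s}" for B
        using that z[OF True] vector_measure_empty[OF \<mu>] by (auto simp: subset_singleton_iff)
      ultimately have "emeasure N {s} = 0" by (intro N(5)) auto
      then show ?thesis using True by (simp add: M_def emeasure_distr spN)
    next
      case False
      then show ?thesis by (simp add: M_def emeasure_distr spN)
    qed
  qed (auto simp: M_def h_def)
qed

section \<open>Integration against signed measures with a density\<close>

lemma vector_measure_set_integral:
  fixes h :: "'a \<Rightarrow> 'b::{banach, second_countable_topology}"
  assumes "integrable M h" "\<And>A. A \<in> sets S \<Longrightarrow> A \<in> sets M" "\<And>A. A \<in> sets S \<Longrightarrow> \<nu> A = (LINT x:A|M. h x)"
  shows "vector_measure S \<nu>"
  unfolding vector_measure_def
proof (intro allI impI)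
  fix A :: "nat \<Rightarrow> _" assume A: "range A \<subseteq> sets S" "disjoint_family A"
  have "(\<lambda>i. LINT x:A i|M. h x) sums (LINT x:(\<Union>i. A i)|M. h x)"
    unfolding set_lebesgue_integral_def
  proof -
    have U: "(\<Union>i. A i) \<in> sets M" using A assms(2) by auto
    have si: "set_integrable M (\<Union>i. A i) h"
      using assms(1) U unfolding set_integrable_def by (intro integrable_mult_indicator) auto
    \<comment> \<open>Disjointness of the sets bounds the partial sums by the integral of
      \<open>norm (h x)\<close>; this justifies exchanging series and integral.\<close>
    have s: "summable (\<lambda>i. LINT x|M. norm (indicator (A i) x *\<^sub>R h x))"
    proof (rule bounded_imp_summable)
      fix n
      have "(\<Sum>i\<le>n. LINT x|M. norm (indicator (A i) x *\<^sub>R h x)) = (LINT x|M. (\<Sum>i\<le>n. norm (indicator (A i) x *\<^sub>R h x)))"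
        using A assms by (subst Bochner_Integration.integral_sum) (auto intro!: integrable_norm integrable_mult_indicator simp del: norm_scaleR)
      also have "\<dots> \<le> (LINT x|M. norm (h x))"
      proof (rule integral_mono)
        show "integrable M (\<lambda>x. \<Sum>i\<le>n. norm (indicator (A i) x *\<^sub>R h x))"
          using A assms by (auto intro!: integrable_norm integrable_mult_indicator simp del: norm_scaleR)
        fix x
        have "(\<Sum>i\<le>n. indicator (A i) x :: real) = indicator (\<Union>i\<le>n. A i) x"
          by (rule indicator_UN_disjoint[symmetric]) (use A in \<open>auto simp: disjoint_family_on_def\<close>)
        then show "(\<Sum>i\<le>n. norm (indicator (A i) x *\<^sub>R h x)) \<le> norm (h x)"
          by (simp add: sum_distrib_right[symmetric] mult_left_le_one_le)
      qed (use assms in auto)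
      finally show "(\<Sum>i\<le>n. LINT x|M. norm (indicator (A i) x *\<^sub>R h x)) \<le> (LINT x|M. norm (h x))" .
    qed auto
    have pt: "(\<lambda>i. indicator (A i) x *\<^sub>R h x) sums (indicator (\<Union>i. A i) x *\<^sub>R h x)" for x
      using A by (intro sums_scaleR_left indicator_sums) (auto simp: disjoint_family_on_def)
    have "(\<lambda>i. LINT x|M. indicator (A i) x *\<^sub>R h x) sums (LINT x|M. (\<Sum>i. indicator (A i) x *\<^sub>R h x))"
    proof (rule sums_integral)
      show "integrable M (\<lambda>x. indicator (A i) x *\<^sub>R h x)" for i
        using A assms by (auto intro!: integrable_mult_indicator)
      have "summable (\<lambda>i. norm (indicator (A i) x *\<^sub>R h x))" for x
      proof -
        have "(\<lambda>i. indicator (A i) x :: real) sums (indicator (\<Union>i. A i) x)"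
          using A by (intro indicator_sums) (auto simp: disjoint_family_on_def)
        then have "summable (\<lambda>i. indicator (A i) x * norm (h x))"
          by (rule summable_mult2[OF sums_summable])
        then show ?thesis by simp
      qed
      then show "AE x in M. summable (\<lambda>i. norm (indicator (A i) x *\<^sub>R h x))" by simp
    qed (rule s)
    also have "(\<lambda>x. \<Sum>i. indicator (A i) x *\<^sub>R h x) = (\<lambda>x. indicator (\<Union>i. A i) x *\<^sub>R h x)"
      using pt by (auto simp: sums_unique[symmetric])
    finally show "(\<lambda>i. LINT x|M. indicator (A i) x *\<^sub>R h x) sums (LINT x|M. indicator (\<Union>i. A i) x *\<^sub>R h x)" .
  qed
  moreover have "(\<Union>i. A i) \<in> sets S" using A by auto
  ultimately show "(\<lambda>i. \<nu> (A i)) sums \<nu> (\<Union>i. A i)" using A assms(3) by (simp add: image_subset_iff)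
qed

text \<open>The supremum over subsets of \<open>A\<close> is attained at the part of
  \<open>A\<close> where \<open>h\<close> is nonnegative: enlarging the set beyond it only adds
  negative contributions.\<close>

lemma upper_variation_density:
  fixes h :: "real \<Rightarrow> real"
  assumes M: "sets M = sets borel" and h: "integrable M h" and I: "I \<in> sets borel"
    and \<nu>: "\<And>A. A \<in> sets borel \<Longrightarrow> A \<subseteq> I \<Longrightarrow> \<nu> A = (LINT x:A|M. h x)"
  shows "upper_variation (borel_on I) \<nu> = density (restrict_space M I) (\<lambda>x. ennreal (max 0 (h x)))"
proof (rule measure_eqI)
  have sr: "sets (restrict_space M I) = sets (borel_on I)" using M by (rule sets_restrict_space_cong)
  then show "sets (upper_variation (borel_on I) \<nu>) = sets (density (restrict_space M I) (\<lambda>x. ennreal (max 0 (h x))))"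
    by simp
  have in_sets: "A \<in> sets (borel_on I) \<longleftrightarrow> A \<in> sets borel \<and> A \<subseteq> I" for A
    using I by (auto simp: sets_restrict_space_iff)
  have vm: "vector_measure (borel_on I) \<nu>"
    by (rule vector_measure_set_integral[OF h]) (use M \<nu> in_sets in auto)
  have hm[measurable]: "h \<in> borel_measurable M" using h by auto
  have spM: "space M = UNIV" using M sets_eq_imp_space_eq by fastforce
  fix A assume "A \<in> sets (upper_variation (borel_on I) \<nu>)"
  then have A: "A \<in> sets (borel_on I)" "A \<in> sets borel" "A \<subseteq> I" using in_sets by auto
  note [measurable_cong] = M
  note [measurable] = A(2)
  have set_int: "ennreal (LINT x:B|M. max 0 (h x)) = (\<integral>\<^sup>+x. ennreal (max 0 (h x)) * indicator B x \<partial>M)"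
    if [measurable]: "B \<in> sets borel" for B
  proof -
    have "integrable M (\<lambda>x. indicator B x *\<^sub>R max 0 (h x))"
      using h by (intro integrable_mult_indicator integrable_max) auto
    then show ?thesis
      unfolding set_lebesgue_integral_def
      by (subst nn_integral_eq_integral[symmetric]) (auto intro!: nn_integral_cong simp: indicator_def)
  qed
  have dens: "emeasure (density (restrict_space M I) (\<lambda>x. ennreal (max 0 (h x)))) A = ennreal (LINT x:A|M. max 0 (h x))"
  proof -
    have "emeasure (density (restrict_space M I) (\<lambda>x. ennreal (max 0 (h x)))) A
        = (\<integral>\<^sup>+x. ennreal (max 0 (h x)) * indicator A x \<partial>(restrict_space M I))"
      using A sr by (intro emeasure_density measurable_restrict_space1) auto
    also have "\<dots> = (\<integral>\<^sup>+x. ennreal (max 0 (h x)) * indicator A x * indicator I x \<partial>M)"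
      using I M spM by (intro nn_integral_restrict_space) auto
    also have "\<dots> = (\<integral>\<^sup>+x. ennreal (max 0 (h x)) * indicator A x \<partial>M)"
      using A by (intro nn_integral_cong) (auto simp: indicator_def)
    finally show ?thesis using A by (simp add: set_int)
  qed
  have "(SUP B\<in>{B \<in> sets (borel_on I). B \<subseteq> A}. ennreal (\<nu> B)) = ennreal (LINT x:A|M. max 0 (h x))"
  proof (rule antisym)
    show "(SUP B\<in>{B \<in> sets (borel_on I). B \<subseteq> A}. ennreal (\<nu> B)) \<le> ennreal (LINT x:A|M. max 0 (h x))"
    proof (intro SUP_least ennreal_leI)
      fix B assume B: "B \<in> {B \<in> sets (borel_on I). B \<subseteq> A}"
      then have [measurable]: "B \<in> sets borel" using in_sets by auto
      have "\<nu> B = (LINT x:B|M. h x)" using B in_sets by (intro \<nu>) auto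
      also have "\<dots> \<le> (LINT x:A|M. max 0 (h x))"
        unfolding set_lebesgue_integral_def
        by (intro integral_mono integrable_mult_indicator integrable_max)
           (use B h M in \<open>auto simp: indicator_def\<close>)
      finally show "\<nu> B \<le> (LINT x:A|M. max 0 (h x))" .
    qed
    define B where "B = A \<inter> {x \<in> space M. 0 \<le> h x}"
    have [measurable]: "B \<in> sets M" unfolding B_def by measurable
    have B: "B \<in> sets (borel_on I)" "B \<subseteq> A" "B \<in> sets borel"
      using A M by (auto simp: in_sets B_def)
    have "(LINT x:A|M. max 0 (h x)) = (LINT x:B|M. h x)"
      unfolding set_lebesgue_integral_def by (intro Bochner_Integration.integral_cong refl) (auto simp: B_def indicator_def)
    also have "\<dots> = \<nu> B" using B A by (intro \<nu>[symmetric]) auto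
    finally show "ennreal (LINT x:A|M. max 0 (h x)) \<le> (SUP B\<in>{B \<in> sets (borel_on I). B \<subseteq> A}. ennreal (\<nu> B))"
      using B by (auto intro!: SUP_upper2[of B])
  qed
  then show "emeasure (upper_variation (borel_on I) \<nu>) A = emeasure (density (restrict_space M I) (\<lambda>x. ennreal (max 0 (h x)))) A"
    using dens emeasure_upper_variation[OF vm A(1)] by simp
qed


text \<open>Since \<open>h\<close> is the difference of its positive and negative parts,
  integrability of \<open>f\<close> against both variations yields that of \<open>f * h\<close>;
  conversely each part is bounded by \<bar>h\<bar>. This translates the signed integrals in the
  notion of solution into ordinary integrals against \<open>M\<close>.\<close>

lemma signed_integral_density:
  fixes h :: "real \<Rightarrow> real"
  assumes M: "sets M = sets borel" and h: "integrable M h" and I: "I \<in> sets borel"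
    and \<nu>: "\<And>A. A \<in> sets borel \<Longrightarrow> A \<subseteq> I \<Longrightarrow> \<nu> A = (LINT x:A|M. h x)"
    and f: "f \<in> borel_measurable (borel_on I)"
  shows "signed_integrable (borel_on I) \<nu> f \<longleftrightarrow> set_integrable M I (\<lambda>x. f x * h x)" (is ?thesis1)
    and "set_integrable M I (\<lambda>x. f x * h x) \<Longrightarrow> signed_integral (borel_on I) \<nu> f = (LINT x:I|M. f x * h x)"
proof -
  have sr: "sets (restrict_space M I) = sets (borel_on I)" using M by (rule sets_restrict_space_cong)
  have spM: "space M = UNIV" using M sets_eq_imp_space_eq by fastforce
  have hm[measurable]: "h \<in> borel_measurable M" using h by auto
  note [measurable_cong] = M
  have Is: "I \<inter> space M \<in> sets M" using I M spM by simp
  have mh: "(\<lambda>x. max 0 (g x)) \<in> borel_measurable (restrict_space M I)" if "g \<in> borel_measurable M" for g :: "real \<Rightarrow> real"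
    using that by (intro measurable_restrict_space1) auto
  have f': "f \<in> borel_measurable (restrict_space M I)"
    using f unfolding measurable_cong_sets[OF sr refl] .
  have fI: "(\<lambda>x. indicator I x * f x) \<in> borel_measurable M"
    using f I unfolding measurable_cong_sets[OF M refl] 
    by (subst (asm) borel_measurable_restrict_space_iff) auto
  have up: "upper_variation (borel_on I) \<nu> = density (restrict_space M I) (\<lambda>x. ennreal (max 0 (h x)))"
    by (rule upper_variation_density[OF M h I \<nu>])
  have un: "upper_variation (borel_on I) (\<lambda>A. - \<nu> A) = density (restrict_space M I) (\<lambda>x. ennreal (max 0 (- h x)))"
  proof (rule upper_variation_density[OF M _ I])
    show "- \<nu> A = (LINT x:A|M. - h x)" if "A \<in> sets borel" "A \<subseteq> I" for A
      using \<nu>[OF that] by (simp add: set_lebesgue_integral_def)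
  qed (use h in auto)
  have i: "integrable (density (restrict_space M I) (\<lambda>x. ennreal (max 0 (g x)))) f
      \<longleftrightarrow> integrable M (\<lambda>x. indicator I x * (max 0 (g x) * f x))"
    "integral\<^sup>L (density (restrict_space M I) (\<lambda>x. ennreal (max 0 (g x)))) f
      = integral\<^sup>L M (\<lambda>x. indicator I x * (max 0 (g x) * f x))" if "g \<in> borel_measurable M" for g
    using integrable_density[OF f' mh[OF that]] integral_density[OF f' mh[OF that]]
    by (simp_all add: integrable_restrict_space[OF Is] integral_restrict_space[OF Is])
  have hm': "(\<lambda>x. - h x) \<in> borel_measurable M" by simp
  show eq: ?thesis1
  proof
    assume "signed_integrable (borel_on I) \<nu> f"
    then have "integrable M (\<lambda>x. indicator I x * (max 0 (h x) * f x))" "integrable M (\<lambda>x. indicator I x * (max 0 (- h x) * f x))"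
      unfolding signed_integrable_def up un i(1)[OF hm] i(1)[OF hm'] by auto
    then have "integrable M (\<lambda>x. indicator I x * (max 0 (h x) * f x) - indicator I x * (max 0 (- h x) * f x))"
      by (rule Bochner_Integration.integrable_diff)
    also have "(\<lambda>x. indicator I x * (max 0 (h x) * f x) - indicator I x * (max 0 (- h x) * f x)) = (\<lambda>x. indicator I x *\<^sub>R (f x * h x))"
      by (auto simp: fun_eq_iff max_def)
    finally show "set_integrable M I (\<lambda>x. f x * h x)" unfolding set_integrable_def .
  next
    assume s: "set_integrable M I (\<lambda>x. f x * h x)"
    have "integrable M (\<lambda>x. indicator I x * (max 0 (c * h x) * f x))" if "c = 1 \<or> c = -1" for c
    proof (rule Bochner_Integration.integrable_bound[OF s[unfolded set_integrable_def]])
      show "AE x in M. norm (indicator I x * (max 0 (c * h x) * f x)) \<le> norm (indicator I x *\<^sub>R (f x * h x))"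
        using that by (intro AE_I2) (auto simp: indicator_def abs_mult max_def)
      have "(\<lambda>x. max 0 (c * h x) * (indicator I x * f x)) \<in> borel_measurable M" using fI by measurable
      then show "(\<lambda>x. indicator I x * (max 0 (c * h x) * f x)) \<in> borel_measurable M" by (simp add: ac_simps)
    qed
    from this[of 1] this[of "-1"] show "signed_integrable (borel_on I) \<nu> f"
      unfolding signed_integrable_def up un i(1)[OF hm] i(1)[OF hm'] by auto
  qed
  assume "set_integrable M I (\<lambda>x. f x * h x)"
  then have "signed_integrable (borel_on I) \<nu> f" using eq by simp
  then have *: "integrable M (\<lambda>x. indicator I x * (max 0 (h x) * f x))" "integrable M (\<lambda>x. indicator I x * (max 0 (- h x) * f x))"
    unfolding signed_integrable_def up un i(1)[OF hm] i(1)[OF hm'] by auto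
  have "signed_integral (borel_on I) \<nu> f = (LINT x|M. indicator I x * (max 0 (h x) * f x) - indicator I x * (max 0 (- h x) * f x))"
    unfolding signed_integral_def up un i(2)[OF hm] i(2)[OF hm'] using * by simp
  also have "(\<lambda>x. indicator I x * (max 0 (h x) * f x) - indicator I x * (max 0 (- h x) * f x)) = (\<lambda>x. indicator I x *\<^sub>R (f x * h x))"
    by (auto simp: fun_eq_iff max_def)
  finally show "signed_integral (borel_on I) \<nu> f = (LINT x:I|M. f x * h x)" unfolding set_lebesgue_integral_def .
qed

section \<open>The lemma of du Bois-Reymond\<close>

text \<open>By hypothesis the finite measures with densities \<open>max 0 (f x)\<close> and
  \<open>max 0 (- f x)\<close> agree on half lines, which generate the Borel sets. Hence they are
  equal, and so are their densities almost everywhere; the two parts of a number agree only if both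
  are 0.\<close>

lemma AE_eq_0_half_lines:
  fixes f :: "real \<Rightarrow> real"
  assumes "sigma_finite_measure M" "sets M = sets borel" "integrable M f"
    and zero: "\<And>x. (LINT t:{x<..}|M. f t) = 0"
  shows "AE x in M. f x = 0"
proof -
  interpret sigma_finite_measure M by fact
  note [measurable_cong] = assms(2)
  have [measurable]: "f \<in> borel_measurable M" using assms(3) by auto
  have em: "emeasure (density M (\<lambda>x. ennreal (max 0 (g x)))) {x<..} = ennreal (LINT t:{x<..}|M. max 0 (g t))"
    if g: "integrable M g" for g :: "real \<Rightarrow> real" and x
  proof -
    have i: "integrable M (\<lambda>t. indicator {x<..} t *\<^sub>R max 0 (g t))"
      using g by (intro integrable_mult_indicator integrable_max) auto
    have "emeasure (density M (\<lambda>x. ennreal (max 0 (g x)))) {x<..} = (\<integral>\<^sup>+t. ennreal (max 0 (g t)) * indicator {x<..} t \<partial>M)"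
      using g by (intro emeasure_density) auto
    also have "\<dots> = (\<integral>\<^sup>+t. ennreal (indicator {x<..} t *\<^sub>R max 0 (g t)) \<partial>M)"
      by (intro nn_integral_cong) (auto simp: indicator_def)
    also have "\<dots> = ennreal (LINT t:{x<..}|M. max 0 (g t))"
      unfolding set_lebesgue_integral_def using i by (intro nn_integral_eq_integral) auto
    finally show ?thesis .
  qed
  have eq: "(LINT t:{x<..}|M. max 0 (f t)) = (LINT t:{x<..}|M. max 0 (- f t))" for x
  proof -
    have "(LINT t:{x<..}|M. max 0 (f t)) - (LINT t:{x<..}|M. max 0 (- f t))
        = (LINT t|M. indicator {x<..} t *\<^sub>R max 0 (f t) - indicator {x<..} t *\<^sub>R max 0 (- f t))"
      unfolding set_lebesgue_integral_def
      by (intro Bochner_Integration.integral_diff[symmetric] integrable_mult_indicator integrable_max)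
         (use assms in auto)
    also have "\<dots> = (LINT t:{x<..}|M. f t)"
      unfolding set_lebesgue_integral_def by (intro Bochner_Integration.integral_cong) (auto simp: indicator_def max_def)
    finally show ?thesis using zero by simp
  qed
  have "density M (\<lambda>x. ennreal (max 0 (f x))) = density M (\<lambda>x. ennreal (max 0 (- f x)))"
    by (rule measure_eqI_lessThan) (use assms em[of f] em[of "\<lambda>x. - f x"] eq in \<open>auto simp: less_top[symmetric]\<close>)
  then have "AE x in M. ennreal (max 0 (f x)) = ennreal (max 0 (- f x))"
    by (intro density_unique) auto
  then show ?thesis by eventually_elim (auto simp: max_def split: if_splits)
qed

lemma integrable_continuous_support:
  fixes f :: "real \<Rightarrow> real"
  assumes "continuous_on UNIV f" "\<And>x. x \<notin> {c..d} \<Longrightarrow> f x = 0"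
  shows "integrable lborel f"
proof -
  have "integrable lborel (\<lambda>x. indicator {c..d} x *\<^sub>R f x)"
    using continuous_on_subset[OF assms(1)] by (intro borel_integrable_compact) auto
  also have "(\<lambda>x. indicator {c..d} x *\<^sub>R f x) = f"
    using assms(2) by (auto simp: fun_eq_iff indicator_def)
  finally show ?thesis .
qed

text \<open>A primitive of \<theta> is constant on either side of the support, and the vanishing
  integral makes the two constants equal. Subtracting this constant leaves a function with compact
  support.\<close>

lemma test_function_antideriv:
  assumes "smooth_real \<theta>" "a < c" "c \<le> d" "d < b" "\<And>x. x \<notin> {c..d} \<Longrightarrow> \<theta> x = 0"
    and zero: "integral\<^sup>L lborel \<theta> = 0"
  obtains \<phi> where "\<phi> \<in> test_functions {a<..<b}" "deriv \<phi> = \<theta>"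
proof -
  have cont: "isCont \<theta> x" for x
    using smooth_real_continuous[OF assms(1), of UNIV] by (auto simp: continuous_on_eq_continuous_at)
  obtain F where F: "\<And>x. (F has_real_derivative \<theta> x) (at x)"
    using einterval_antiderivative[of "-\<infinity>" "\<infinity>" \<theta>] cont
    by (auto simp: has_real_derivative_iff_has_vector_derivative)
  have ftc: "(LINT x|lborel. \<theta> x * indicator {x0..y0} x) = F y0 - F x0" if "x0 \<le> y0" for x0 y0
    using that F cont by (intro integral_FTC_Icc_real) auto
  have left: "F x = F c" if "x \<le> c" for x
  proof -
    \<comment> \<open>The assumption on the support says nothing about the endpoint \<open>c\<close>
      itself, which belongs to the closed interval of integration; continuity from the left supplies
      the value.\<close>
    have "\<theta> c = 0" 
    proof -
      have "(\<theta> \<longlongrightarrow> \<theta> c) (at_left c)" by (rule tendsto_within_subset[OF cont[of c, unfolded isCont_def]]) auto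
      moreover have "(\<theta> \<longlongrightarrow> 0) (at_left c)"
        by (rule tendsto_eventually) (use assms(5) in \<open>auto simp: eventually_at_filter\<close>)
      ultimately show ?thesis using tendsto_unique trivial_limit_at_left_real by blast
    qed
    then have "(\<lambda>t. \<theta> t * indicator {x..c} t) = (\<lambda>t. 0)"
      using assms(5) by (force simp: indicator_def)
    then show ?thesis using ftc[OF that] by simp
  qed
  have cd: "F d = F c"
  proof -
    have "(\<lambda>t. \<theta> t * indicator {c..d} t) = \<theta>"
      using assms(5) by (force simp: indicator_def)
    then show ?thesis using ftc[of c d] zero assms by simp
  qed
  have right: "F x = F c" if "x \<ge> d" for x
  proof -
    have "(LINT t|lborel. \<theta> t * indicator {c..x} t) = integral\<^sup>L lborel \<theta>"
      using assms(5) that by (intro Bochner_Integration.integral_cong) (force simp: indicator_def)+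
    then show ?thesis using ftc[of c x] zero that assms by simp
  qed
  define \<phi> where "\<phi> x = F x - F c" for x
  have D: "(\<phi> has_real_derivative \<theta> x) (at x)" for x
    unfolding \<phi>_def by (auto intro!: derivative_eq_intros F)
  have "deriv \<phi> = \<theta>" using D DERIV_imp_deriv by blast
  moreover have "\<phi> \<in> test_functions {a<..<b}"
  proof (rule test_functionsI)
    show "smooth_real \<phi>" using D assms(1) by (rule smooth_real_antideriv)
    show "c \<le> x \<and> x \<le> d" if "\<phi> x \<noteq> 0" for x
      using that left[of x] right[of x] by (cases "x \<le> c"; cases "d \<le> x") (auto simp: \<phi>_def)
  qed (use assms in auto)
  ultimately show ?thesis using that by blast
qed

text \<open>\<open>AE_eq_0_half_lines\<close> asks for a measure on the Borel sets, whereas a BV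
  function is only Lebesgue measurable. The Borel representative is extended by 0 so that its
  integrals can be taken over the whole line.\<close>

lemma borel_representative:
  fixes v :: "real \<Rightarrow> real"
  assumes "set_integrable lebesgue I v" "I \<in> sets borel"
  obtains w where "integrable lborel w" "AE x\<in>I in lebesgue. v x = w x" "\<And>x. x \<notin> I \<Longrightarrow> w x = 0"
    "\<And>g. g \<in> borel_measurable borel \<Longrightarrow> (LINT s:I|lebesgue. v s * g s) = (LINT s|lborel. w s * g s)"
proof -
  have "(\<lambda>x. indicator I x *\<^sub>R v x) \<in> borel_measurable lebesgue"
    using assms unfolding set_integrable_def by auto
  then obtain w' where w': "w' \<in> borel_measurable lborel" "AE x in lborel. indicator I x *\<^sub>R v x = w' x"
    using completion_ex_borel_measurable_real by blast
  define w where "w x = indicator I x * w' x" for x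
  have [measurable]: "I \<in> sets borel" "w' \<in> borel_measurable borel" using assms w' by auto
  have wm: "w \<in> borel_measurable lborel" unfolding w_def by measurable
  have AE: "AE x in lebesgue. indicator I x *\<^sub>R v x = w x"
    using AE_completion[OF w'(2)] by eventually_elim (auto simp: w_def indicator_def split: if_splits)
  have wl: "w \<in> borel_measurable lebesgue" using wm by (rule measurable_completion)
  have "integrable lebesgue w"
    using assms(1) AE wl unfolding set_integrable_def by (subst integrable_cong_AE[where g="\<lambda>x. indicator I x *\<^sub>R v x"]) auto
  then have "integrable lborel w" using integrable_completion[OF wm] by simp
  moreover have "(LINT s:I|lebesgue. v s * g s) = (LINT s|lborel. w s * g s)" if g: "g \<in> borel_measurable borel" for g
  proof -
    have g': "g \<in> borel_measurable lebesgue" using g by (intro measurable_completion) simp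
    have m: "(\<lambda>x. indicator I x *\<^sub>R v x) \<in> borel_measurable lebesgue"
      using assms unfolding set_integrable_def by auto
    have "(\<lambda>s. (indicator I s *\<^sub>R v s) * g s) \<in> borel_measurable lebesgue" using m g' by measurable
    then have m': "(\<lambda>s. indicator I s *\<^sub>R (v s * g s)) \<in> borel_measurable lebesgue" by (simp add: mult.assoc)
    have "(LINT s:I|lebesgue. v s * g s) = (LINT s|lebesgue. w s * g s)"
      unfolding set_lebesgue_integral_def
    proof (rule integral_cong_AE[OF m'])
      show "(\<lambda>s. w s * g s) \<in> borel_measurable lebesgue" using wl g' by measurable
      show "AE s in lebesgue. indicator I s *\<^sub>R (v s * g s) = w s * g s"
        using AE by eventually_elim (metis mult.assoc real_scaleR_def)
    qed
    also have "\<dots> = (LINT s|lborel. w s * g s)"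
      using borel_measurable_times[OF wm, of g] g by (intro integral_completion) simp
    finally show ?thesis .
  qed
  moreover have "AE x\<in>I in lebesgue. v x = w x" using AE by eventually_elim auto
  ultimately show ?thesis using that[of w] by (auto simp: w_def)
qed

text \<open>Bumps \<open>\<psi>\<close> are corrected by a multiple of a fixed bump \<open>\<rho>\<close> to have a test function as antiderivative;
  this determines the integral of \<open>v\<close> against \<open>\<psi>\<close>, hence over intervals.\<close>

lemma du_bois_reymond:
  fixes v :: "real \<Rightarrow> real"
  assumes ab: "a < b" and v: "set_integrable lebesgue {a<..<b} v"
    and zero: "\<And>\<phi>. \<phi> \<in> test_functions {a<..<b} \<Longrightarrow> (LINT s:{a<..<b}|lebesgue. v s * deriv \<phi> s) = 0"
  obtains c where "AE s\<in>{a<..<b} in lebesgue. v s = c"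
proof -
  obtain w where w: "integrable lborel w" "AE x\<in>{a<..<b} in lebesgue. v x = w x" "\<And>x. x \<notin> {a<..<b} \<Longrightarrow> w x = 0"
    "\<And>g. g \<in> borel_measurable borel \<Longrightarrow> (LINT s:{a<..<b}|lebesgue. v s * g s) = (LINT s|lborel. w s * g s)"
    by (rule borel_representative[OF v]) auto
  have meas: "smooth_real f \<Longrightarrow> f \<in> borel_measurable borel" for f
    by (intro borel_measurable_continuous_onI smooth_real_continuous)
  have zero': "(LINT s|lborel. w s * deriv \<phi> s) = 0" if "\<phi> \<in> test_functions {a<..<b}" for \<phi>
    using zero[OF that] w(4)[OF meas[OF smooth_real_deriv[OF test_function_smooth[OF that]]]] by simp
  have wmult: "integrable lborel (\<lambda>s. w s * g s)" if "g \<in> borel_measurable borel" "\<And>x. \<bar>g x\<bar> \<le> B" for g B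
  proof (rule Bochner_Integration.integrable_bound[of _ "\<lambda>s. w s * B"])
    show "AE x in lborel. norm (w x * g x) \<le> norm (w x * B)"
      using that(2) by (intro AE_I2) (auto simp: abs_mult intro!: mult_left_mono order_trans[OF that(2) abs_ge_self])
  qed (use w that in auto)
  have bm: "bump x b m \<in> test_functions {a<..<b}" if "a \<le> x" for x m
    using bump_test that by blast
  have bumpw: "integrable lborel (\<lambda>s. w s * bump x y m s)" for x y m
    by (rule wmult[of _ 1]) (use meas smooth_bump bump_bounds in auto)
  have limw: "(\<lambda>m. LINT s|lborel. w s * bump x b m s) \<longlonglongrightarrow> (LINT s|lborel. w s * indicator {x<..<b} s)" for x
  proof (rule integral_dominated_convergence[where w="\<lambda>s. norm (w s)"])
    show "AE s in lborel. (\<lambda>m. w s * bump x b m s) \<longlonglongrightarrow> w s * indicator {x<..<b} s"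
      by (intro AE_I2 tendsto_intros bump_tendsto)
    show "AE s in lborel. norm (w s * bump x b m s) \<le> norm (w s)" for m
      using bump_bounds by (intro AE_I2) (auto simp: abs_mult intro!: mult_left_le)
  qed (use w bumpw in auto)
  have lim1: "(\<lambda>m. integral\<^sup>L lborel (bump x b m)) \<longlonglongrightarrow> b - x" if "x < b" for x
  proof -
    have "(\<lambda>m. integral\<^sup>L lborel (bump x b m)) \<longlonglongrightarrow> (LINT s|lborel. indicator {x<..<b} s)"
    proof (rule integral_dominated_convergence[where w="indicator {x..b}"])
      show "AE s in lborel. norm (bump x b m s) \<le> indicator {x..b} s" for m
      proof (rule AE_I2)
        fix s
        have "bump x b m s = 0" if "s \<notin> {x..b}"
        proof (rule ccontr)
          assume *: "bump x b m s \<noteq> 0"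
          have "1 / real m \<ge> 0" by simp
          with bump_nonzero(2,3)[OF *] that show False unfolding atLeastAtMost_iff by linarith
        qed
        then show "norm (bump x b m s) \<le> indicator {x..b} s"
          using bump_bounds[of x b m s] by (auto simp: indicator_def)
      qed
    qed (use meas smooth_bump bump_tendsto in \<open>auto simp: integrable_indicator_iff emeasure_lborel_Icc_eq\<close>)
    then show ?thesis using that by simp
  qed
  obtain m0 where m0: "integral\<^sup>L lborel (bump a b m0) \<noteq> 0"
  proof -
    have "\<forall>\<^sub>F m in sequentially. integral\<^sup>L lborel (bump a b m) > 0"
      using lim1[OF ab] ab by (intro order_tendstoD) auto
    then show ?thesis using that by (metis eventually_sequentially less_irrefl order_refl)
  qed
  define \<rho> where "\<rho> = bump a b m0"
  \<comment> \<open>The value is forced: if \<open>w\<close> is constant almost everywhere on the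
    interval, testing against \<rho> gives this quotient.\<close>
  define c where "c = (LINT s|lborel. w s * \<rho> s) / integral\<^sup>L lborel \<rho>"
  have proportional: "(LINT s|lborel. w s * bump x b m s) = c * integral\<^sup>L lborel (bump x b m)" if "a \<le> x" for x m
  proof -
    define \<psi> where "\<psi> = bump x b m"
    define k where "k = integral\<^sup>L lborel \<psi> / integral\<^sup>L lborel \<rho>"
    define \<theta> where "\<theta> s = \<psi> s + (- k) * \<rho> s" for s
    have tests: "\<psi> \<in> test_functions {a<..<b}" "\<rho> \<in> test_functions {a<..<b}"
      using bm that by (auto simp: \<psi>_def \<rho>_def)
    obtain c1 d1 where 1: "a < c1" "c1 \<le> d1" "d1 < b" "\<And>x. x \<notin> {c1..d1} \<Longrightarrow> \<psi> x = 0"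
      using test_function_support[OF tests(1) ab] by metis
    obtain c2 d2 where 2: "a < c2" "c2 \<le> d2" "d2 < b" "\<And>x. x \<notin> {c2..d2} \<Longrightarrow> \<rho> x = 0"
      using test_function_support[OF tests(2) ab] by metis
    have int: "integrable lborel \<psi>" "integrable lborel \<rho>"
      using integrable_continuous_support[OF smooth_real_continuous[OF test_function_smooth[OF tests(1)]] 1(4)]
        integrable_continuous_support[OF smooth_real_continuous[OF test_function_smooth[OF tests(2)]] 2(4)] by auto
    have "smooth_real \<theta>"
      unfolding \<theta>_def by (intro smooth_real_add smooth_real_mult smooth_real_const test_function_smooth[OF tests(1)]
          test_function_smooth[OF tests(2)])
    moreover have "\<theta> s = 0" if "s \<notin> {min c1 c2..max d1 d2}" for s
    proof -
      have "s \<notin> {c1..d1}" "s \<notin> {c2..d2}" using that by (simp_all add: min_le_iff_disj le_max_iff_disj) (blast+)?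
      then show ?thesis using 1(4)[of s] 2(4)[of s] by (simp add: \<theta>_def)
    qed
    moreover have "integral\<^sup>L lborel \<theta> = 0"
    proof -
      have "integral\<^sup>L lborel \<theta> = integral\<^sup>L lborel \<psi> + (- k) * integral\<^sup>L lborel \<rho>"
        unfolding \<theta>_def[abs_def] using int by simp
      then show ?thesis using m0 by (simp add: k_def \<rho>_def[symmetric])
    qed
    ultimately obtain \<phi> where "\<phi> \<in> test_functions {a<..<b}" "deriv \<phi> = \<theta>"
      using 1 2 by (elim test_function_antideriv[of \<theta> a "min c1 c2" "max d1 d2" b]) auto
    then have "(LINT s|lborel. w s * \<theta> s) = 0" using zero' by metis
    moreover have "(LINT s|lborel. w s * \<theta> s) = (LINT s|lborel. w s * \<psi> s) - k * (LINT s|lborel. w s * \<rho> s)"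
    proof -
      have "(\<lambda>s. w s * \<theta> s) = (\<lambda>s. w s * \<psi> s - k * (w s * \<rho> s))"
        by (auto simp: \<theta>_def algebra_simps)
      then show ?thesis using bumpw by (simp add: \<psi>_def \<rho>_def)
    qed
    ultimately show ?thesis by (simp add: \<psi>_def k_def c_def)
  qed
  have int_eq: "(LINT s|lborel. w s * indicator {x<..<b} s) = c * (b - x)" if "a \<le> x" "x < b" for x
  proof (rule LIMSEQ_unique[OF limw])
    show "(\<lambda>m. LINT s|lborel. w s * bump x b m s) \<longlonglongrightarrow> c * (b - x)"
      unfolding proportional[OF that(1)] by (intro tendsto_intros lim1 that)
  qed
  have indc: "integrable lborel (\<lambda>t. c * indicator {p<..<q} t)" if "p \<le> q" for p q :: real
    using that by (simp add: integrable_indicator_iff emeasure_lborel_Ioo)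
  \<comment> \<open>Removing the constant only inside the interval keeps \<open>f\<close> integrable
    on the whole line, where the half-line criterion applies.\<close>
  define f where "f s = w s - c * indicator {a<..<b} s" for s
  have "AE s in lborel. f s = 0"
  proof (rule AE_eq_0_half_lines)
    show "integrable lborel f" unfolding f_def using w(1) ab
      by (intro Bochner_Integration.integrable_diff indc) auto
    fix x
    show "(LINT t:{x<..}|lborel. f t) = 0"
    proof (cases "max x a < b")
      case True
      have "(LINT t:{x<..}|lborel. f t) = (LINT t|lborel. w t * indicator {max x a<..<b} t - c * indicator {max x a<..<b} t)"
        unfolding set_lebesgue_integral_def using w(3)
        by (intro Bochner_Integration.integral_cong) (auto simp: f_def indicator_def)
      also have "\<dots> = (LINT t|lborel. w t * indicator {max x a<..<b} t) - (LINT t|lborel. c * indicator {max x a<..<b} t)"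
        by (intro Bochner_Integration.integral_diff wmult[of _ 1] indc) (use True in \<open>auto simp: indicator_le_1\<close>)
      also have "\<dots> = 0" using int_eq[of "max x a"] True by simp
      finally show ?thesis .
    next
      case False
      then have "(\<lambda>t. indicator {x<..} t *\<^sub>R f t) = (\<lambda>t. 0)"
        using w(3) ab by (auto simp: f_def indicator_def fun_eq_iff)
      then show ?thesis by (simp add: set_lebesgue_integral_def)
    qed
  qed (auto intro: lborel.sigma_finite_measure_axioms)
  from AE_completion[OF this] have "AE s in lebesgue. f s = 0" .
  with w(2) have "AE s\<in>{a<..<b} in lebesgue. v s = c"
    by eventually_elim (auto simp: f_def)
  then show ?thesis using that by blast
qed

section \<open>Primitives with respect to a measure\<close>

lemma borel_measurable_bounded_bilinear:
  fixes prod :: "'a::{real_normed_vector, second_countable_topology} \<Rightarrow> 'b::{real_normed_vector, second_countable_topology} \<Rightarrow> 'c::real_normed_vector"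
  assumes "bounded_bilinear prod" "f \<in> borel_measurable M" "g \<in> borel_measurable M"
  shows "(\<lambda>x. prod (f x) (g x)) \<in> borel_measurable M"
  by (rule borel_measurable_continuous_Pair[OF assms(2,3)])
     (intro bounded_bilinear.continuous_on[OF assms(1)] continuous_intros)

text \<open>Fubini's theorem for prod (g t) (k r) on the plane, cut along the diagonal. The diagonal
  is counted in the first part only, whence a closed half line in one integral and an open one in
  the other; in this form the identity is exact even in the presence of atoms. Lebesgue measure in
  place of \<open>M2\<close> yields integration by parts, two equal measures yield the product
  rule.\<close>

lemma integral_bilinear_split:
  fixes prod :: "'a::{banach, second_countable_topology} \<Rightarrow> 'b::{banach, second_countable_topology} \<Rightarrow> 'c::{banach, second_countable_topology}"
  assumes bl: "bounded_bilinear prod"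
    and M1: "sigma_finite_measure M1" "sets M1 = sets borel" and M2: "sigma_finite_measure M2" "sets M2 = sets borel"
    and g: "integrable M1 g" and k: "integrable M2 (k :: real \<Rightarrow> 'b)"
  shows "integrable M2 (\<lambda>r. prod (LINT t:{..r}|M1. g t) (k r))" (is ?i2)
    and "integrable M1 (\<lambda>t. prod (g t) (LINT r:{..<t}|M2. k r))" (is ?i1)
    and "prod (integral\<^sup>L M1 g) (integral\<^sup>L M2 k) =
       (LINT r|M2. prod (LINT t:{..r}|M1. g t) (k r)) + (LINT t|M1. prod (g t) (LINT r:{..<t}|M2. k r))" (is ?e)
proof -
  interpret bounded_bilinear prod by fact
  interpret M1: sigma_finite_measure M1 by fact
  interpret M2: sigma_finite_measure M2 by fact
  interpret P: pair_sigma_finite M1 M2 ..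
  note [measurable_cong] = M1(2) M2(2)
  have [measurable]: "g \<in> borel_measurable M1" "k \<in> borel_measurable M2" using g k by auto
  define F where "F p = prod (g (fst p)) (k (snd p))" for p
  have Fm: "F \<in> borel_measurable (M1 \<Otimes>\<^sub>M M2)"
    unfolding F_def by (rule borel_measurable_bounded_bilinear[OF bl]) measurable
  obtain K where K: "K \<ge> 0" "\<And>a b. norm (prod a b) \<le> norm a * norm b * K"
    using nonneg_bounded by blast
  have Fi: "integrable (M1 \<Otimes>\<^sub>M M2) F"
  proof (rule Bochner_Integration.integrable_bound[OF _ Fm])
    show "integrable (M1 \<Otimes>\<^sub>M M2) (\<lambda>p. norm (g (fst p)) * norm (k (snd p)) * K)"
    proof (rule P.Fubini_integrable)
      show "integrable M1 (\<lambda>x. \<integral>y. norm (norm (g (fst (x, y))) * norm (k (snd (x, y))) * K) \<partial>M2)"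
        using g k K by (simp add: abs_mult)
      show "AE x in M1. integrable M2 (\<lambda>y. norm (g (fst (x, y))) * norm (k (snd (x, y))) * K)"
        using k by simp
    qed measurable
    show "AE p in M1 \<Otimes>\<^sub>M M2. norm (F p) \<le> norm (norm (g (fst p)) * norm (k (snd p)) * K)"
      unfolding F_def by (intro AE_I2 order_trans[OF K(2)]) simp
  qed
  define S where "S = {p :: real \<times> real. fst p \<le> snd p}"
  have "S \<in> sets (borel \<Otimes>\<^sub>M borel)" unfolding S_def borel_prod
    by (intro borel_closed closed_Collect_le continuous_intros)
  then have S: "S \<in> sets (M1 \<Otimes>\<^sub>M M2)"
    unfolding sets_pair_measure_cong[OF M1(2) M2(2)] .
  define F1 where "F1 = (\<lambda>p. indicator S p *\<^sub>R F p)"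
  define F2 where "F2 = (\<lambda>p. indicator (- S) p *\<^sub>R F p)"
  have F1: "integrable (M1 \<Otimes>\<^sub>M M2) F1"
    unfolding F1_def by (rule integrable_mult_indicator[OF S Fi])
  have F2_eq: "F2 = (\<lambda>p. F p - F1 p)"
    by (rule ext) (simp add: F1_def F2_def indicator_def)
  have F2: "integrable (M1 \<Otimes>\<^sub>M M2) F2"
    unfolding F2_eq by (rule Bochner_Integration.integrable_diff[OF Fi F1])
  have S_iff: "(t, r) \<in> S \<longleftrightarrow> t \<le> r" for t r by (auto simp: S_def)
  have F1_int: "(\<integral>t. F1 (t, r) \<partial>M1) = prod (LINT t:{..r}|M1. g t) (k r)" for r
  proof -
    have "(\<integral>t. F1 (t, r) \<partial>M1) = (\<integral>t. prod (indicator {..r} t *\<^sub>R g t) (k r) \<partial>M1)"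
      by (intro Bochner_Integration.integral_cong) (auto simp: F1_def F_def S_iff indicator_def zero_left)
    also have "\<dots> = prod (LINT t:{..r}|M1. g t) (k r)"
      unfolding set_lebesgue_integral_def using g
      by (intro integral_bounded_linear bounded_linear_left integrable_mult_indicator) auto
    finally show ?thesis .
  qed
  have F2_int: "(\<integral>r. F2 (t, r) \<partial>M2) = prod (g t) (LINT r:{..<t}|M2. k r)" for t
  proof -
    have "(\<integral>r. F2 (t, r) \<partial>M2) = (\<integral>r. prod (g t) (indicator {..<t} r *\<^sub>R k r) \<partial>M2)"
      by (intro Bochner_Integration.integral_cong) (auto simp: F2_def F_def S_iff indicator_def zero_right)
    also have "\<dots> = prod (g t) (LINT r:{..<t}|M2. k r)"
      unfolding set_lebesgue_integral_def using k
      by (intro integral_bounded_linear bounded_linear_right integrable_mult_indicator) auto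
    finally show ?thesis .
  qed
  interpret Q: pair_sigma_finite M2 M1 ..
  have F1': "integrable (M2 \<Otimes>\<^sub>M M1) (\<lambda>(r, t). F1 (t, r))"
    using P.integrable_product_swap[OF F1] .
  show ?i2
    using Q.integrable_fst'[OF F1'] by (simp add: F1_int)
  show ?i1
    using P.integrable_fst'[OF F2] by (simp add: F2_int)
  have "integral\<^sup>L (M1 \<Otimes>\<^sub>M M2) F1 = (LINT r|M2. prod (LINT t:{..r}|M1. g t) (k r))"
    using Q.integral_fst'[OF F1'] P.integral_product_swap[of F1] F1 by (simp add: F1_int)
  moreover have "integral\<^sup>L (M1 \<Otimes>\<^sub>M M2) F2 = (LINT t|M1. prod (g t) (LINT r:{..<t}|M2. k r))"
    using P.integral_fst'[OF F2] by (simp add: F2_int)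
  moreover have "integral\<^sup>L (M1 \<Otimes>\<^sub>M M2) F2 = integral\<^sup>L (M1 \<Otimes>\<^sub>M M2) F - integral\<^sup>L (M1 \<Otimes>\<^sub>M M2) F1"
    unfolding F2_eq using Fi F1 by simp
  moreover have "integral\<^sup>L (M1 \<Otimes>\<^sub>M M2) F = prod (integral\<^sup>L M1 g) (integral\<^sup>L M2 k)"
    using P.integral_fst'[OF Fi] integral_bounded_linear[OF bounded_linear_right k]
      integral_bounded_linear[OF bounded_linear_left g] by (simp add: F_def)
  ultimately show ?e by (simp add: algebra_simps)
qed

text \<open>Dominated convergence: the indicators of \<open>{..X i}\<close> converge pointwise to
  that of \<open>{..s}\<close> if \<open>X\<close> approaches \<open>s\<close> from the right, and
  to that of \<open>{..<s}\<close> from the left. The two limits differ exactly by the contribution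
  of the point \<open>s\<close>.\<close>

lemma primitive_tendsto:
  fixes g :: "real \<Rightarrow> 'a::{banach, second_countable_topology}"
  assumes M: "sets M = sets borel" and g: "integrable M g"
  shows "((\<lambda>s. LINT t:{..s}|M. g t) \<longlongrightarrow> (LINT t:{..s}|M. g t)) (at_right s)" (is ?r)
    and "((\<lambda>s. LINT t:{..s}|M. g t) \<longlongrightarrow> (LINT t:{..<s}|M. g t)) (at_left s)" (is ?l)
proof -
  note [measurable_cong] = M
  have [measurable]: "g \<in> borel_measurable M" using g by auto
  have *: "(\<lambda>i. LINT t:{..X i}|M. g t) \<longlonglongrightarrow> (LINT t:A|M. g t)"
    if [measurable]: "A \<in> sets borel" and "\<And>t. (\<lambda>i. indicator {..X i} t :: real) \<longlonglongrightarrow> indicator A t" for X A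
    unfolding set_lebesgue_integral_def
  proof (rule integral_dominated_convergence[where w="\<lambda>t. norm (g t)"])
    show "AE t in M. (\<lambda>i. indicator {..X i} t *\<^sub>R g t) \<longlonglongrightarrow> indicator A t *\<^sub>R g t"
      using that by (intro AE_I2 tendsto_intros)
    show "AE t in M. norm (indicator {..X i} t *\<^sub>R g t) \<le> norm (g t)" for i
      by (intro AE_I2) (auto simp: indicator_def)
  qed (use g in auto)
  show ?r
    unfolding tendsto_at_iff_sequentially comp_def
  proof (intro allI impI *)
    fix X t assume X: "\<forall>i. X i \<in> {s<..} - {s}" "X \<longlonglongrightarrow> s"
    show "(\<lambda>i. indicator {..X i} t :: real) \<longlonglongrightarrow> indicator {..s} t"
    proof (rule tendsto_eventually, cases "t \<le> s")
      case True
      then have "(indicator {..X i} t :: real) = indicator {..s} t" for i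
        using X(1)[rule_format, of i] by (auto simp: indicator_def)
      then show "\<forall>\<^sub>F i in sequentially. (indicator {..X i} t :: real) = indicator {..s} t" by simp
    next
      case False
      then have "\<forall>\<^sub>F i in sequentially. X i < t" using X(2) by (intro order_tendstoD) auto
      then show "\<forall>\<^sub>F i in sequentially. (indicator {..X i} t :: real) = indicator {..s} t"
        by eventually_elim (use False in \<open>auto simp: indicator_def\<close>)
    qed
  qed auto
  show ?l
    unfolding tendsto_at_iff_sequentially comp_def
  proof (intro allI impI *)
    fix X t assume X: "\<forall>i. X i \<in> {..<s} - {s}" "X \<longlonglongrightarrow> s"
    show "(\<lambda>i. indicator {..X i} t :: real) \<longlonglongrightarrow> indicator {..<s} t"
    proof (rule tendsto_eventually, cases "t < s")
      case False
      then have "(indicator {..X i} t :: real) = indicator {..<s} t" for i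
        using X(1)[rule_format, of i] by (auto simp: indicator_def)
      then show "\<forall>\<^sub>F i in sequentially. (indicator {..X i} t :: real) = indicator {..<s} t" by simp
    next
      case True
      then have "\<forall>\<^sub>F i in sequentially. X i > t" using X(2) by (intro order_tendstoD) auto
      then show "\<forall>\<^sub>F i in sequentially. (indicator {..X i} t :: real) = indicator {..<s} t"
        by eventually_elim (use True in \<open>auto simp: indicator_def\<close>)
    qed
  qed auto
qed

lemma borel_measurable_primitive:
  fixes g :: "real \<Rightarrow> 'a::{banach, second_countable_topology}"
  assumes "sigma_finite_measure M" "sets M = sets borel" "integrable M g"
  shows "(\<lambda>s. LINT t:{..s}|M. g t) \<in> borel_measurable borel"
proof -
  interpret sigma_finite_measure M by fact
  have [measurable]: "g \<in> borel_measurable borel"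
    using assms(3) unfolding measurable_cong_sets[OF assms(2) refl, symmetric] by auto
  have "(\<lambda>(s, t). if t \<le> s then g t else 0) \<in> borel_measurable (borel \<Otimes>\<^sub>M borel)"
    by measurable
  then have "(\<lambda>(s, t). if t \<le> s then g t else 0) \<in> borel_measurable (borel \<Otimes>\<^sub>M M)"
    unfolding measurable_cong_sets[OF sets_pair_measure_cong[OF refl assms(2)] refl] .
  then have "(\<lambda>s. LINT t|M. (if t \<le> s then g t else 0)) \<in> borel_measurable borel"
    by (rule borel_measurable_lebesgue_integral)
  also have "(\<lambda>s. LINT t|M. (if t \<le> s then g t else 0)) = (\<lambda>s. LINT t:{..s}|M. g t)"
    unfolding set_lebesgue_integral_def by (intro ext Bochner_Integration.integral_cong) auto
  finally show ?thesis .
qed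

lemma integral_lessThan_atMost:
  fixes g :: "real \<Rightarrow> 'a::{banach, second_countable_topology}"
  assumes "sets M = sets borel" "emeasure M {s} = 0"
  shows "(LINT t:{..<s}|M. g t) = (LINT t:{..s}|M. g t)"
  unfolding set_lebesgue_integral_def
  by (rule integral_discrete_difference[of "{s}"]) (use assms in \<open>auto simp: indicator_def\<close>)

lemma continuous_primitive:
  fixes g :: "real \<Rightarrow> 'a::{banach, second_countable_topology}"
  assumes "sets M = sets borel" "integrable M g" "\<And>s. emeasure M {s} = 0"
  shows "continuous_on A (\<lambda>s. LINT t:{..s}|M. g t)"
proof -
  have "isCont (\<lambda>s. LINT t:{..s}|M. g t) s" for s
    using primitive_tendsto[OF assms(1,2), of s] integral_lessThan_atMost[OF assms(1,3), of s g]
    by (simp add: isCont_def filterlim_at_split)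
  then show ?thesis by (intro continuous_at_imp_continuous_on) auto
qed

lemma primitive_bounded:
  fixes g :: "real \<Rightarrow> 'a::{banach, second_countable_topology}"
  assumes "sets M = sets borel" "integrable M g" "A \<in> sets borel"
  shows "norm (LINT t:A|M. g t) \<le> (LINT t|M. norm (g t))"
proof -
  have "norm (LINT t:A|M. g t) \<le> (LINT t|M. norm (indicator A t *\<^sub>R g t))"
    unfolding set_lebesgue_integral_def by (rule integral_norm_bound)
  also have "\<dots> \<le> (LINT t|M. norm (g t))"
    using assms by (intro integral_mono integrable_norm integrable_mult_indicator) (auto simp: indicator_def)
  finally show ?thesis .
qed

section \<open>Integration by parts against test functions\<close>

text \<open>The last identity is stated for the open half line because this is the shape that
  \<open>integral_bilinear_split\<close> produces.\<close>

lemma test_function_integral_deriv: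
  assumes "\<phi> \<in> test_functions {a<..<b}" "a < b"
  shows "integrable lborel (deriv \<phi>)" "integral\<^sup>L lborel (deriv \<phi>) = 0"
    "(LINT r:{..<t}|lborel. deriv \<phi> r) = \<phi> t"
proof -
  obtain c d where cd: "a < c" "c \<le> d" "d < b" "\<And>x. x \<notin> {c..d} \<Longrightarrow> \<phi> x = 0"
    using test_function_support[OF assms] by metis
  note smooth = test_function_smooth[OF assms(1)]
  have d0: "deriv \<phi> x = 0" if "x \<notin> {c..d}" for x
    using test_function_deriv_0[OF cd(4) that] by auto
  have cont: "continuous_on UNIV (deriv \<phi>)" by (intro smooth_real_continuous smooth_real_deriv smooth)
  show int: "integrable lborel (deriv \<phi>)" using integrable_continuous_support[OF cont d0] by auto
  have ftc: "(LINT x|lborel. deriv \<phi> x * indicator {x0..y0} x) = \<phi> y0 - \<phi> x0" if "x0 \<le> y0" for x0 y0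
    using that smooth_real_DERIV[OF smooth] cont
    by (intro integral_FTC_Icc_real) (auto simp: continuous_on_eq_continuous_at)
  have "integral\<^sup>L lborel (deriv \<phi>) = (LINT x|lborel. deriv \<phi> x * indicator {a..b} x)"
    using cd d0 by (intro Bochner_Integration.integral_cong) (force simp: indicator_def)+
  then show "integral\<^sup>L lborel (deriv \<phi>) = 0" using ftc[of a b] assms cd by auto
  show "(LINT r:{..<t}|lborel. deriv \<phi> r) = \<phi> t"
  proof (cases "t \<le> a")
    case True
    then have "(\<lambda>r. indicator {..<t} r *\<^sub>R deriv \<phi> r) = (\<lambda>r. 0)"
      using d0 cd by (auto simp: indicator_def fun_eq_iff)
    then show ?thesis using cd(4)[of t] cd True by (auto simp: set_lebesgue_integral_def)
  next
    case False
    have "(LINT r:{..<t}|lborel. deriv \<phi> r) = (LINT r:{..t}|lborel. deriv \<phi> r)"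
      by (rule integral_lessThan_atMost) auto
    also have "\<dots> = (LINT x|lborel. deriv \<phi> x * indicator {a..t} x)"
      unfolding set_lebesgue_integral_def
      using cd d0 by (intro Bochner_Integration.integral_cong) (force simp: indicator_def)+
    also have "\<dots> = \<phi> t" using ftc[of a t] False cd(4)[of a] cd by auto
    finally show ?thesis .
  qed
qed

lemma integral_test_function_lebesgue:
  assumes "\<phi> \<in> test_functions {a<..<b}" "a < b" "f \<in> borel_measurable borel"
  shows "(LINT s:{a<..<b}|lebesgue. f s * deriv \<phi> s) = (LINT s|lborel. f s * deriv \<phi> s)"
proof -
  obtain c d where cd: "a < c" "c \<le> d" "d < b" "\<And>x. x \<notin> {c..d} \<Longrightarrow> \<phi> x = 0"
    using test_function_support[OF assms(1,2)] by metis
  note smooth = test_function_smooth[OF assms(1)]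
  have d0: "deriv \<phi> x = 0" if "x \<notin> {c..d}" for x
    using test_function_deriv_0[OF cd(4) that] by auto
  have dm: "deriv \<phi> \<in> borel_measurable borel"
    by (intro borel_measurable_continuous_onI smooth_real_continuous smooth_real_deriv smooth)
  have "(LINT s:{a<..<b}|lebesgue. f s * deriv \<phi> s) = (LINT s|lebesgue. f s * deriv \<phi> s)"
    unfolding set_lebesgue_integral_def using d0 cd
    by (intro Bochner_Integration.integral_cong) (force simp: indicator_def)+
  also have "\<dots> = (LINT s|lborel. f s * deriv \<phi> s)"
    using borel_measurable_times[OF assms(3) dm] by (intro integral_completion) simp
  finally show ?thesis .
qed

text \<open>In \<open>integral_bilinear_split\<close> with \<open>deriv \<phi>\<close> as second
  density, the vanishing integral of \<open>deriv \<phi>\<close> kills the product of the total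
  integrals, and likewise the constant \<open>c\<close>. Measures with atoms are covered, which
  \<open>no_jump_part_continuous\<close> relies on.\<close>

lemma integration_by_parts:
  fixes g :: "real \<Rightarrow> real"
  assumes M: "finite_measure M" "sets M = sets borel" and g: "integrable M g"
    and \<phi>: "\<phi> \<in> test_functions {a<..<b}" "a < b"
  shows "(LINT s:{a<..<b}|lebesgue. (c + (LINT t:{..s}|M. g t)) * deriv \<phi> s) = - (LINT t|M. \<phi> t * g t)"
proof -
  note d = test_function_integral_deriv[OF \<phi>]
  have sf: "sigma_finite_measure M" using M(1) finite_measure.axioms(1) by blast
  note * = integral_bilinear_split[OF bounded_bilinear_mult sf M(2) lborel.sigma_finite_measure_axioms sets_lborel g d(1)]
  have m: "(\<lambda>s. LINT t:{..s}|M. g t) \<in> borel_measurable borel"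
    by (rule borel_measurable_primitive[OF sf M(2) g])
  have "(LINT s:{a<..<b}|lebesgue. (c + (LINT t:{..s}|M. g t)) * deriv \<phi> s)
      = (LINT s|lborel. (c + (LINT t:{..s}|M. g t)) * deriv \<phi> s)"
    by (rule integral_test_function_lebesgue[OF \<phi>]) (use m in measurable)
  also have "\<dots> = (LINT s|lborel. c * deriv \<phi> s) + (LINT s|lborel. (LINT t:{..s}|M. g t) * deriv \<phi> s)"
    using d(1) *(1) by (simp add: distrib_right)
  also have "\<dots> = - (LINT t|M. \<phi> t * g t)"
    using *(3) d(2) by (simp add: d(3) mult.commute)
  finally show ?thesis .
qed

text \<open>By \<open>integration_by_parts\<close> the primitive satisfies the same weak equation as
  \<open>u\<close>, so the lemma of du Bois-Reymond applies to their difference.\<close>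

lemma distr_primitive:
  fixes u g :: "real \<Rightarrow> real"
  assumes M: "finite_measure M" "sets M = sets borel" and g: "integrable M g"
    and ab: "a < b" and u: "set_integrable lebesgue {a<..<b} u"
    and eq: "\<And>\<phi>. \<phi> \<in> test_functions {a<..<b} \<Longrightarrow>
      (LINT s:{a<..<b}|lebesgue. u s * deriv \<phi> s) = - (LINT t|M. \<phi> t * g t)"
  obtains c where "AE s\<in>{a<..<b} in lebesgue. u s = c + (LINT t:{..s}|M. g t)"
proof -
  define U where "U s = (LINT t:{..s}|M. g t)" for s
  have sf: "sigma_finite_measure M" using M(1) finite_measure.axioms(1) by blast
  have m: "U \<in> borel_measurable borel"
    unfolding U_def by (rule borel_measurable_primitive[OF sf M(2) g])
  have Ubd: "\<bar>U s\<bar> \<le> (LINT t|M. norm (g t))" for s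
    using primitive_bounded[OF M(2) g, of "{..s}"] by (simp add: U_def)
  \<comment> \<open>The bounded factor \<open>f\<close> is needed twice: as the constant 1 and as
    the derivative of a test function.\<close>
  have Ui: "set_integrable lebesgue {a<..<b} (\<lambda>s. U s * f s)"
    if f: "f \<in> borel_measurable borel" "\<And>s. \<bar>f s\<bar> \<le> B" for f B
  proof -
    have "integrable lebesgue (\<lambda>s. indicator {a<..<b} s * ((LINT t|M. norm (g t)) * B))"
      using ab by (intro integrable_mult_left) (simp add: integrable_indicator_iff)
    then show ?thesis
      unfolding set_integrable_def
    proof (rule Bochner_Integration.integrable_bound)
      have "(\<lambda>s. indicator {a<..<b} s *\<^sub>R (U s * f s)) \<in> borel_measurable borel"
        using m f(1) by measurable
      then show "(\<lambda>s. indicator {a<..<b} s *\<^sub>R (U s * f s)) \<in> borel_measurable lebesgue"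
        by (intro measurable_completion) simp
      show "AE s in lebesgue. norm (indicator {a<..<b} s *\<^sub>R (U s * f s)) \<le> norm (indicator {a<..<b} s * ((LINT t|M. norm (g t)) * B))"
        using Ubd f(2) by (intro AE_I2) (auto simp: indicator_def abs_mult intro!: mult_mono order_trans[OF f(2) abs_ge_self])
    qed
  qed
  have "set_integrable lebesgue {a<..<b} U" using Ui[of "\<lambda>_. 1" 1] by simp
  then have v: "set_integrable lebesgue {a<..<b} (\<lambda>s. u s - U s)" using u by (rule set_integral_diff(1)[rotated])
  have "(LINT s:{a<..<b}|lebesgue. (u s - U s) * deriv \<phi> s) = 0" if \<phi>: "\<phi> \<in> test_functions {a<..<b}" for \<phi>
  proof -
    obtain c d where cd: "a < c" "c \<le> d" "d < b" "\<And>x. x \<notin> {c..d} \<Longrightarrow> \<phi> x = 0"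
      using test_function_support[OF \<phi> ab] by metis
    have cont: "continuous_on UNIV (deriv \<phi>)"
      by (intro smooth_real_continuous smooth_real_deriv test_function_smooth[OF \<phi>])
    have d0: "deriv \<phi> x = 0" if "x \<notin> {c..d}" for x
      using test_function_deriv_0[OF cd(4) that] by auto
    have "\<exists>B. \<forall>x. \<bar>deriv \<phi> x\<bar> \<le> B"
      by (rule bounded_continuous_support[OF cont d0]) auto
    then obtain B where B: "\<And>x. \<bar>deriv \<phi> x\<bar> \<le> B" by blast
    have dm: "deriv \<phi> \<in> borel_measurable borel" using cont by (rule borel_measurable_continuous_onI)
    then have dml: "deriv \<phi> \<in> borel_measurable lebesgue" by (intro measurable_completion) simp
    have ui: "set_integrable lebesgue {a<..<b} (\<lambda>s. u s * deriv \<phi> s)"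
      unfolding set_integrable_def
    proof (rule Bochner_Integration.integrable_bound)
      show "integrable lebesgue (\<lambda>s. (indicator {a<..<b} s *\<^sub>R u s) * B)"
        using u unfolding set_integrable_def by (rule integrable_mult_left)
      have "(\<lambda>s. (indicator {a<..<b} s *\<^sub>R u s) * deriv \<phi> s) \<in> borel_measurable lebesgue"
        using u dml unfolding set_integrable_def by (intro borel_measurable_times) auto
      then show "(\<lambda>s. indicator {a<..<b} s *\<^sub>R (u s * deriv \<phi> s)) \<in> borel_measurable lebesgue"
        by (simp add: mult.assoc)
      show "AE s in lebesgue. norm (indicator {a<..<b} s *\<^sub>R (u s * deriv \<phi> s)) \<le> norm (indicator {a<..<b} s *\<^sub>R u s * B)"
        using B by (intro AE_I2) (auto simp: indicator_def abs_mult intro!: mult_left_mono order_trans[OF B abs_ge_self])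
    qed
    have "(LINT s:{a<..<b}|lebesgue. (u s - U s) * deriv \<phi> s)
        = (LINT s:{a<..<b}|lebesgue. u s * deriv \<phi> s) - (LINT s:{a<..<b}|lebesgue. U s * deriv \<phi> s)"
      using set_integral_diff(2)[OF ui Ui[OF dm B]] by (simp add: left_diff_distrib)
    then show ?thesis
      using eq[OF \<phi>] integration_by_parts[OF M g \<phi> ab, of 0] by (simp add: U_def)
  qed
  from du_bois_reymond[OF ab v this] obtain c where "AE s\<in>{a<..<b} in lebesgue. u s - U s = c" by blast
  then have "AE s\<in>{a<..<b} in lebesgue. u s = c + U s" by eventually_elim auto
  then show ?thesis using that by (simp add: U_def)
qed

section \<open>Essential one-sided limits and product rule\<close>

lemma AE_interval_ex:
  fixes a b :: real
  assumes "AE x\<in>{a<..<b} in lebesgue. P x" "a < b"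
  obtains x where "x \<in> {a<..<b}" "P x"
proof (rule ccontr)
  assume "\<not> thesis"
  then have *: "\<not> P x" if "x \<in> {a<..<b}" for x using that \<open>\<And>x. x \<in> {a<..<b} \<Longrightarrow> P x \<Longrightarrow> thesis\<close> by blast
  obtain N where N: "N \<in> null_sets lebesgue" "{x \<in> space lebesgue. \<not> (x \<in> {a<..<b} \<longrightarrow> P x)} \<subseteq> N"
    using assms(1) unfolding eventually_ae_filter by blast
  have "{a<..<b} \<subseteq> N" using N(2) * by auto
  then have "emeasure lebesgue {a<..<b} \<le> emeasure lebesgue N"
    using N(1) by (intro emeasure_mono) auto
  then show False using N(1) assms(2) by (auto simp: null_sets_def)
qed

lemma eventually_ess_at_right:
  assumes "AE x\<in>{a<..<b} in lebesgue. P x" "a \<le> s" "s < b"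
  shows "eventually P (ess_at_right s)"
  unfolding ess_at_right_def eventually_inf
proof (intro exI conjI allI impI)
  show "AE x in lebesgue. x \<in> {a<..<b} \<longrightarrow> P x" by fact
  show "\<forall>\<^sub>F x in at_right s. x \<in> {s<..<b}" using assms(3) by (rule eventually_at_right_real)
qed (use assms in auto)

lemma eventually_ess_at_left:
  assumes "AE x\<in>{a<..<b} in lebesgue. P x" "a < s" "s \<le> b"
  shows "eventually P (ess_at_left s)"
  unfolding ess_at_left_def eventually_inf
proof (intro exI conjI allI impI)
  show "AE x in lebesgue. x \<in> {a<..<b} \<longrightarrow> P x" by fact
  show "\<forall>\<^sub>F x in at_left s. x \<in> {a<..<s}" using assms(2) by (rule eventually_at_left_real)
qed (use assms in auto)

text \<open>A one-sided neighbourhood contains an interval of positive length, which no null set can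
  cover. Nontriviality of the filter is what makes essential limits unique and \<open>Lim\<close>
  meaningful.\<close>

lemma ess_at_right_neq_bot: "ess_at_right s \<noteq> bot"
proof
  assume "ess_at_right s = bot"
  then have "eventually (\<lambda>x. False) (ess_at_right s)" by simp
  then obtain Q R where QR: "AE x in lebesgue. Q x" "eventually R (at_right s)" "\<And>x. Q x \<Longrightarrow> R x \<Longrightarrow> False"
    unfolding ess_at_right_def eventually_inf by blast
  obtain b where b: "s < b" "\<And>y. s < y \<Longrightarrow> y < b \<Longrightarrow> R y"
    using QR(2) unfolding eventually_at_right_field by blast
  have "AE x\<in>{s<..<b} in lebesgue. Q x" using QR(1) by eventually_elim simp
  from AE_interval_ex[OF this b(1)] show False using b QR(3) by auto
qed

lemma ess_at_left_neq_bot: "ess_at_left s \<noteq> bot"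
proof
  assume "ess_at_left s = bot"
  then have "eventually (\<lambda>x. False) (ess_at_left s)" by simp
  then obtain Q R where QR: "AE x in lebesgue. Q x" "eventually R (at_left s)" "\<And>x. Q x \<Longrightarrow> R x \<Longrightarrow> False"
    unfolding ess_at_left_def eventually_inf by blast
  obtain b where b: "b < s" "\<And>y. b < y \<Longrightarrow> y < s \<Longrightarrow> R y"
    using QR(2) unfolding eventually_at_left_field by blast
  have "AE x\<in>{b<..<s} in lebesgue. Q x" using QR(1) by eventually_elim simp
  from AE_interval_ex[OF this b(1)] show False using b QR(3) by auto
qed

lemma tendsto_ess_at_right:
  assumes "AE x\<in>{a<..<b} in lebesgue. f x = U x" "a \<le> s" "s < b" "(U \<longlongrightarrow> l) (at_right s)"
  shows "(f \<longlongrightarrow> l) (ess_at_right s)"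
proof -
  have "(U \<longlongrightarrow> l) (ess_at_right s)"
    using assms(4) by (rule tendsto_mono[rotated]) (simp add: ess_at_right_def)
  then show ?thesis
    using tendsto_cong[OF eventually_ess_at_right[OF assms(1-3)]] by blast
qed

lemma tendsto_ess_at_left:
  assumes "AE x\<in>{a<..<b} in lebesgue. f x = U x" "a < s" "s \<le> b" "(U \<longlongrightarrow> l) (at_left s)"
  shows "(f \<longlongrightarrow> l) (ess_at_left s)"
proof -
  have "(U \<longlongrightarrow> l) (ess_at_left s)"
    using assms(4) by (rule tendsto_mono[rotated]) (simp add: ess_at_left_def)
  then show ?thesis
    using tendsto_cong[OF eventually_ess_at_left[OF assms(1-3)]] by blast
qed

lemma precise_rep_eq:
  assumes "AE x\<in>{a<..<b} in lebesgue. f x = U x" "s \<in> {a<..<b}" "isCont U s"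
  shows "precise_rep f s = U s"
proof -
  have "(U \<longlongrightarrow> U s) (at_right s)" "(U \<longlongrightarrow> U s) (at_left s)"
    using assms(3) by (auto simp: isCont_def filterlim_at_split)
  moreover have "a \<le> s" "a < s" "s < b" "s \<le> b" using assms(2) by auto
  ultimately have "Lim (ess_at_right s) f = U s" "Lim (ess_at_left s) f = U s"
    by (auto intro!: tendsto_Lim ess_at_right_neq_bot ess_at_left_neq_bot
        tendsto_ess_at_right[OF assms(1)] tendsto_ess_at_left[OF assms(1)])
  then show ?thesis by (simp add: precise_rep_def scaleR_2[symmetric])
qed

text \<open>An ordinary one-sided limit is also the essential one, and the latter depends only on
  the class modulo null sets.\<close>

lemma AE_eq_one_sided_limits:
  fixes U V :: "real \<Rightarrow> 'a::t2_space"
  assumes AE: "AE x\<in>{a<..<b} in lebesgue. U x = V x" and s: "s \<in> {a<..<b}"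
  shows "(U \<longlongrightarrow> l) (at_right s) \<Longrightarrow> (V \<longlongrightarrow> l') (at_right s) \<Longrightarrow> l = l'"
    and "(U \<longlongrightarrow> l) (at_left s) \<Longrightarrow> (V \<longlongrightarrow> l') (at_left s) \<Longrightarrow> l = l'"
proof -
  have AE': "AE x\<in>{a<..<b} in lebesgue. V x = V x" by simp
  have s': "a \<le> s" "a < s" "s < b" "s \<le> b" using s by auto
  show "l = l'" if "(U \<longlongrightarrow> l) (at_right s)" "(V \<longlongrightarrow> l') (at_right s)"
  proof -
    have "(V \<longlongrightarrow> l) (ess_at_right s)"
      by (rule tendsto_ess_at_right[OF _ s'(1,3) that(1)]) (use AE in \<open>auto elim!: eventually_mono\<close>)
    from tendsto_unique[OF ess_at_right_neq_bot this tendsto_ess_at_right[OF AE' s'(1,3) that(2)]]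
    show ?thesis .
  qed
  show "l = l'" if "(U \<longlongrightarrow> l) (at_left s)" "(V \<longlongrightarrow> l') (at_left s)"
  proof -
    have "(V \<longlongrightarrow> l) (ess_at_left s)"
      by (rule tendsto_ess_at_left[OF _ s'(2,4) that(1)]) (use AE in \<open>auto elim!: eventually_mono\<close>)
    from tendsto_unique[OF ess_at_left_neq_bot this tendsto_ess_at_left[OF AE' s'(2,4) that(2)]]
    show ?thesis .
  qed
qed

text \<open>After truncation of both densities at \<open>s\<close>,
  \<open>integral_bilinear_split\<close> is the product rule up to the open half line; the absence
  of atoms closes it, that is, replaces the left limit of \<open>V\<close> by its value. The
  constants \<open>c\<close> and \<open>d\<close> come back by expanding prod (U s - c) (V s -
  d).\<close>

lemma primitive_bilinear:
  fixes prod :: "'a::{banach, second_countable_topology} \<Rightarrow> 'b::{banach, second_countable_topology} \<Rightarrow> 'c::{banach, second_countable_topology}"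
    and M :: "real measure"
  assumes bl: "bounded_bilinear prod"
    and M: "sigma_finite_measure M" "sets M = sets borel" "\<And>s. emeasure M {s} = 0"
    and g: "integrable M g" and k: "integrable M k"
    and U: "\<And>s. U s = c + (LINT t:{..s}|M. g t)" and V: "\<And>s. V s = d + (LINT t:{..s}|M. k t)"
  shows "integrable M (\<lambda>t. prod (U t) (k t) + prod (g t) (V t))"
    and "prod (U s) (V s) = prod c d + (LINT t:{..s}|M. prod (U t) (k t) + prod (g t) (V t))"
proof -
  interpret bounded_bilinear prod by fact
  have Vlt: "(LINT t:{..<s}|M. k t) = V s - d" for s
    using integral_lessThan_atMost[OF M(2,3), of s k] V by simp
  have Ule: "(LINT t:{..s}|M. g t) = U s - c" for s using U by simp
  have i1: "integrable M (\<lambda>t. prod (U t - c) (k t))" "integrable M (\<lambda>t. prod (g t) (V t - d))"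
    using integral_bilinear_split(1,2)[OF bl M(1,2) M(1,2) g k] by (simp_all add: Vlt Ule)
  have i2: "integrable M (\<lambda>t. prod c (k t))" "integrable M (\<lambda>t. prod (g t) d)"
    using integrable_bounded_linear[OF bounded_linear_right k] integrable_bounded_linear[OF bounded_linear_left g] by auto
  have iU: "integrable M (\<lambda>t. prod (U t) (k t))"
    using Bochner_Integration.integrable_add[OF i1(1) i2(1)] by (simp add: diff_left)
  have iV: "integrable M (\<lambda>t. prod (g t) (V t))"
    using Bochner_Integration.integrable_add[OF i1(2) i2(2)] by (simp add: diff_right)
  show "integrable M (\<lambda>t. prod (U t) (k t) + prod (g t) (V t))"
    using iU iV by auto
  \<comment> \<open>The total integrals of the truncated densities are the increments
    \<open>U s - c\<close> and \<open>V s - d\<close>.\<close>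
  define gs ks where "gs = (\<lambda>t. indicator {..s} t *\<^sub>R g t)" and "ks = (\<lambda>t. indicator {..s} t *\<^sub>R k t)"
  have ms: "{..r} \<in> sets M" "{..<r} \<in> sets M" for r using M(2) by auto
  have int: "integrable M gs" "integrable M ks"
    unfolding gs_def ks_def using g k ms by (auto intro!: integrable_mult_indicator)
  have gs: "(LINT t:{..r}|M. gs t) = U r - c" if "r \<le> s" for r
    unfolding Ule[symmetric] set_lebesgue_integral_def gs_def
    by (intro Bochner_Integration.integral_cong) (use that in \<open>auto simp: indicator_def\<close>)
  have ks: "(LINT t:{..<r}|M. ks t) = V r - d" if "r \<le> s" for r
    unfolding Vlt[symmetric] set_lebesgue_integral_def ks_def
    by (intro Bochner_Integration.integral_cong) (use that in \<open>auto simp: indicator_def\<close>)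
  have "prod (integral\<^sup>L M gs) (integral\<^sup>L M ks) =
       (LINT r|M. prod (LINT t:{..r}|M. gs t) (ks r)) + (LINT t|M. prod (gs t) (LINT r:{..<t}|M. ks r))"
    by (rule integral_bilinear_split(3)[OF bl M(1,2) M(1,2) int])
  also have "(LINT r|M. prod (LINT t:{..r}|M. gs t) (ks r)) = (LINT r|M. indicator {..s} r *\<^sub>R (prod (U r) (k r) - prod c (k r)))"
    by (intro Bochner_Integration.integral_cong) (auto simp: ks_def gs indicator_def zero_right diff_left)
  also have "\<dots> = (LINT r:{..s}|M. prod (U r) (k r)) - (LINT r:{..s}|M. prod c (k r))"
    unfolding set_lebesgue_integral_def scaleR_diff_right using iU i2 ms
    by (intro Bochner_Integration.integral_diff integrable_mult_indicator) auto
  also have "(LINT r:{..s}|M. prod c (k r)) = prod c (V s - d)"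
  proof -
    have "(LINT r:{..s}|M. prod c (k r)) = (LINT r|M. prod c (indicator {..s} r *\<^sub>R k r))"
      unfolding set_lebesgue_integral_def by (intro Bochner_Integration.integral_cong) (auto simp: scaleR_right)
    also have "\<dots> = prod c (LINT r|M. indicator {..s} r *\<^sub>R k r)"
      using int(2) unfolding ks_def by (intro integral_bounded_linear bounded_linear_right)
    finally show ?thesis using V by (simp add: set_lebesgue_integral_def)
  qed
  also have "(LINT t|M. prod (gs t) (LINT r:{..<t}|M. ks r)) = (LINT r|M. indicator {..s} r *\<^sub>R (prod (g r) (V r) - prod (g r) d))"
    by (intro Bochner_Integration.integral_cong) (auto simp: gs_def ks indicator_def zero_left diff_right)
  also have "\<dots> = (LINT r:{..s}|M. prod (g r) (V r)) - (LINT r:{..s}|M. prod (g r) d)"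
    unfolding set_lebesgue_integral_def scaleR_diff_right using iV i2 ms
    by (intro Bochner_Integration.integral_diff integrable_mult_indicator) auto
  also have "(LINT r:{..s}|M. prod (g r) d) = prod (U s - c) d"
  proof -
    have "(LINT r:{..s}|M. prod (g r) d) = (LINT r|M. prod (indicator {..s} r *\<^sub>R g r) d)"
      unfolding set_lebesgue_integral_def by (intro Bochner_Integration.integral_cong) (auto simp: scaleR_left)
    also have "\<dots> = prod (LINT r|M. indicator {..s} r *\<^sub>R g r) d"
      using int(1) unfolding gs_def by (intro integral_bounded_linear bounded_linear_left)
    finally show ?thesis using U by (simp add: set_lebesgue_integral_def)
  qed
  also have "integral\<^sup>L M gs = U s - c" using U by (simp add: gs_def set_lebesgue_integral_def)
  also have "integral\<^sup>L M ks = V s - d" using V by (simp add: ks_def set_lebesgue_integral_def)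
  finally have "prod (U s - c) (V s - d) = (LINT r:{..s}|M. prod (U r) (k r)) - prod c (V s - d)
      + ((LINT r:{..s}|M. prod (g r) (V r)) - prod (U s - c) d)" .
  moreover have "(LINT t:{..s}|M. prod (U t) (k t) + prod (g t) (V t))
      = (LINT r:{..s}|M. prod (U r) (k r)) + (LINT r:{..s}|M. prod (g r) (V r))"
    using iU iV ms by (intro set_integral_add) (auto simp: set_integrable_def intro!: integrable_mult_indicator)
  ultimately show "prod (U s) (V s) = prod c d + (LINT t:{..s}|M. prod (U t) (k t) + prod (g t) (V t))"
    by (simp add: diff_left diff_right algebra_simps)
qed

section \<open>Primitives on compact intervals\<close>

text \<open>Only increments over \<open>{a<..b}\<close> enter, because the density belonging to an
  arbitrary solution is a priori known to be integrable only away from 0 and L. The interval is open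
  on the left so that it continues \<open>{..a}\<close> without overlap.\<close>

definition primitive_on :: "real measure \<Rightarrow> (real \<Rightarrow> 'a::{banach, second_countable_topology}) \<Rightarrow> real \<Rightarrow> real \<Rightarrow> (real \<Rightarrow> 'a) \<Rightarrow> bool" where
  "primitive_on M g a b U \<longleftrightarrow> set_integrable M {a<..b} g \<and> (\<forall>s\<in>{a..b}. U s = U a + (LINT t:{a<..s}|M. g t))"

lemma primitive_onI:
  assumes M: "sets M = sets borel" and g: "integrable M g" and U: "\<And>s. s \<in> {a..b} \<Longrightarrow> U s = c + (LINT t:{..s}|M. g t)"
  shows "primitive_on M g a b U"
  unfolding primitive_on_def
proof (intro conjI ballI)
  have ms: "A \<in> sets borel \<Longrightarrow> set_integrable M A g" for A
    using M g unfolding set_integrable_def by (intro integrable_mult_indicator) auto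
  show "set_integrable M {a<..b} g" by (rule ms) simp
  fix s assume s: "s \<in> {a..b}"
  have "(LINT t:{..a} \<union> {a<..s}|M. g t) = (LINT t:{..a}|M. g t) + (LINT t:{a<..s}|M. g t)"
    by (rule set_integral_Un) (auto intro: ms)
  moreover have "{..a} \<union> {a<..s} = {..s}" using s by auto
  ultimately show "U s = U a + (LINT t:{a<..s}|M. g t)" using U[OF s] U[of a] s by simp
qed

lemma primitive_on_eq: "primitive_on M g a b U \<Longrightarrow> s \<in> {a..b} \<Longrightarrow> U s = U a + (LINT t:{a<..s}|M. g t)"
  unfolding primitive_on_def by blast

lemma primitive_on_integrable: "primitive_on M g a b U \<Longrightarrow> set_integrable M {a<..b} g"
  unfolding primitive_on_def by blast

lemma primitive_onD:
  assumes "primitive_on M g a b U" "s \<in> {a..b}"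
  shows "integrable M (\<lambda>t. indicator {a<..b} t *\<^sub>R g t)"
    "U s = U a + (LINT t:{..s}|M. indicator {a<..b} t *\<^sub>R g t)"
proof -
  show "integrable M (\<lambda>t. indicator {a<..b} t *\<^sub>R g t)"
    using primitive_on_integrable[OF assms(1)] by (simp add: set_integrable_def)
  have "(LINT t:{a<..s}|M. g t) = (LINT t:{..s}|M. indicator {a<..b} t *\<^sub>R g t)"
    unfolding set_lebesgue_integral_def
    by (intro Bochner_Integration.integral_cong) (use assms in \<open>auto simp: indicator_def\<close>)
  then show "U s = U a + (LINT t:{..s}|M. indicator {a<..b} t *\<^sub>R g t)"
    using primitive_on_eq[OF assms] by simp
qed

lemma primitive_on_cong:
  assumes "primitive_on M g a b U" "\<And>t. t \<in> {a<..b} \<Longrightarrow> g t = g' t" "\<And>s. s \<in> {a..b} \<Longrightarrow> U s = U' s"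
  shows "primitive_on M g' a b U'"
proof -
  have i: "(LINT t:{a<..s}|M. g t) = (LINT t:{a<..s}|M. g' t)" if "s \<in> {a..b}" for s
    unfolding set_lebesgue_integral_def
    by (intro Bochner_Integration.integral_cong) (use assms(2) that in \<open>auto simp: indicator_def\<close>)
  have "set_integrable M {a<..b} g \<longleftrightarrow> set_integrable M {a<..b} g'"
    unfolding set_integrable_def
    by (intro Bochner_Integration.integrable_cong) (use assms(2) in \<open>auto simp: indicator_def\<close>)
  moreover have "U' s = U' a + (LINT t:{a<..s}|M. g' t)" if "s \<in> {a..b}" for s
    using primitive_on_eq[OF assms(1) that] i[OF that] that assms(3)[of s] assms(3)[of a] by simp
  ultimately show ?thesis using primitive_on_integrable[OF assms(1)] unfolding primitive_on_def by blast
qed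

lemma primitive_on_bounded_linear:
  assumes "bounded_linear f" "sets M = sets borel" "primitive_on M g a b U"
  shows "primitive_on M (\<lambda>t. f (g t)) a b (\<lambda>s. f (U s))"
proof -
  interpret bounded_linear f by fact
  have i: "integrable M (\<lambda>t. indicator {a<..s} t *\<^sub>R g t)" if "s \<in> {a..b}" for s
  proof -
    have "set_integrable M {a<..s} g"
      by (rule set_integrable_subset[OF primitive_on_integrable[OF assms(3)]]) (use assms(2) that in auto)
    then show ?thesis unfolding set_integrable_def .
  qed
  have eq: "f (LINT t:{a<..s}|M. g t) = (LINT t:{a<..s}|M. f (g t))" if "s \<in> {a..b}" for s
    unfolding set_lebesgue_integral_def
    using integral_bounded_linear[OF assms(1) i[OF that]] by (simp add: scaleR)
  have "f (U s) = f (U a) + (LINT t:{a<..s}|M. f (g t))" if "s \<in> {a..b}" for s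
    unfolding primitive_on_eq[OF assms(3) that] eq[OF that, symmetric] by (rule add)
  moreover have "set_integrable M {a<..b} (\<lambda>t. f (g t))"
    using integrable_bounded_linear[OF assms(1), of M "\<lambda>t. indicator {a<..b} t *\<^sub>R g t"] primitive_on_integrable[OF assms(3)]
    by (simp add: set_integrable_def scaleR)
  ultimately show ?thesis
    unfolding primitive_on_def by blast
qed

text \<open>Extending the densities by 0 outside \<open>{a<..b}\<close> gives global primitives that
  agree with \<open>U\<close> and \<open>V\<close> on the interval, so the global product rule can
  be applied and restricted.\<close>

lemma primitive_on_bilinear:
  fixes prod :: "'a::{banach, second_countable_topology} \<Rightarrow> 'b::{banach, second_countable_topology} \<Rightarrow> 'c::{banach, second_countable_topology}"
    and M :: "real measure"
  assumes bl: "bounded_bilinear prod"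
    and M: "sigma_finite_measure M" "sets M = sets borel" "\<And>s. emeasure M {s} = 0"
    and U: "primitive_on M g a b U" and V: "primitive_on M k a b V"
  shows "primitive_on M (\<lambda>t. prod (U t) (k t) + prod (g t) (V t)) a b (\<lambda>s. prod (U s) (V s))"
proof (cases "a \<le> b")
  case True
  interpret bounded_bilinear prod by fact
  define g' k' where "g' = (\<lambda>t. indicator {a<..b} t *\<^sub>R g t)" and "k' = (\<lambda>t. indicator {a<..b} t *\<^sub>R k t)"
  define U' V' where "U' = (\<lambda>s. U a + (LINT t:{..s}|M. g' t))" and "V' = (\<lambda>s. V a + (LINT t:{..s}|M. k' t))"
  have int: "integrable M g'" "integrable M k'"
    using primitive_onD(1)[OF U, of a] primitive_onD(1)[OF V, of a] True by (auto simp: g'_def k'_def)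
  have eq: "U' s = U s" "V' s = V s" if "s \<in> {a..b}" for s
    using primitive_onD(2)[OF U that] primitive_onD(2)[OF V that] by (auto simp: U'_def V'_def g'_def k'_def)
  note p = primitive_bilinear[OF bl M int, of U' "U a" V' "V a"]
  have "primitive_on M (\<lambda>t. prod (U' t) (k' t) + prod (g' t) (V' t)) a b (\<lambda>s. prod (U' s) (V' s))"
    by (rule primitive_onI[OF M(2)]) (rule p; simp add: U'_def V'_def)+
  then show ?thesis
    by (rule primitive_on_cong) (auto simp: eq g'_def k'_def)
next
  case False
  then show ?thesis by (auto simp: primitive_on_def set_integrable_def)
qed

lemma primitive_on_AE_0:
  assumes "primitive_on M g a b U" "AE t in M. t \<in> {a<..b} \<longrightarrow> g t = 0" "s \<in> {a..b}"
  shows "U s = U a"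
proof -
  have "(LINT t:{a<..s}|M. g t) = 0"
    unfolding set_lebesgue_integral_def
    by (rule integral_eq_zero_AE) (use assms(2,3) in \<open>auto elim!: eventually_mono simp: indicator_def\<close>)
  then show ?thesis using primitive_on_eq[OF assms(1,3)] by simp
qed

section \<open>Linear integral equations\<close>

text \<open>Induction by the product rule for w^(n+1) and w: the terms w^(n+1) \<nu> and (n+1) w^n
  \<nu> w add up to (n+2) w^(n+1) \<nu>. These identities supply the factorials in the bound for the
  Neumann series.\<close>

lemma power_primitive:
  assumes M: "sigma_finite_measure M" "sets M = sets borel" "\<And>s::real. emeasure M {s} = 0"
    and \<nu>: "integrable M \<nu>" and w: "\<And>s. w s = (LINT t:{..s}|M. (\<nu> t :: real))"
  shows "integrable M (\<lambda>t. w t ^ n * \<nu> t) \<and> (\<forall>s. w s ^ Suc n = (LINT t:{..s}|M. real (Suc n) * (w t ^ n * \<nu> t)))"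
proof (induction n)
  case 0
  then show ?case using \<nu> w by simp
next
  case (Suc n)
  have w0: "w s = 0 + (LINT t:{..s}|M. \<nu> t)" for s using w by simp
  have Un: "w s ^ Suc n = 0 + (LINT t:{..s}|M. real (Suc n) * (w t ^ n * \<nu> t))" for s
    using Suc by simp
  have int: "integrable M (\<lambda>t. real (Suc n) * (w t ^ n * \<nu> t))"
    using Suc by (intro integrable_mult_right) auto
  have eq: "w t ^ Suc n * \<nu> t + real (Suc n) * (w t ^ n * \<nu> t) * w t = real (Suc (Suc n)) * (w t ^ Suc n * \<nu> t)" for t
    by (simp add: algebra_simps)
  note * = primitive_bilinear[OF bounded_bilinear_mult M int \<nu> Un w0, unfolded eq]
  have "integrable M (\<lambda>t. w t ^ Suc n * \<nu> t)"
    using *(1) unfolding integrable_mult_right_iff by auto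
  moreover have "w s ^ Suc (Suc n) = (LINT t:{..s}|M. real (Suc (Suc n)) * (w t ^ Suc n * \<nu> t))" for s
    using *(2)[of s] by (simp only: power_Suc2 mult_zero_left add_0)
  ultimately show ?case by blast
qed

text \<open>\<open>F\<close> lists the terms of the Neumann series, and norm (F n s) is at most norm
  x0 times w(s)^n / n!, where w is the primitive of norm h times the constant of the bilinear map.
  The factorial gives uniform convergence however large the total mass of \<open>h\<close>, so the
  whole line is covered at once. The vector \<open>x0\<close> plays the role of the value at minus
  infinity.\<close>

lemma linear_equation_solution:
  fixes prod :: "'a::{banach, second_countable_topology} \<Rightarrow> 'b::{banach, second_countable_topology} \<Rightarrow> 'a"
    and M :: "real measure"
  assumes bl: "bounded_bilinear prod"
    and M: "sigma_finite_measure M" "sets M = sets borel" "\<And>s. emeasure M {s} = 0"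
    and h: "integrable M h"
  obtains G where "continuous_on UNIV G" "integrable M (\<lambda>t. prod (G t) (h t))"
    "\<And>s. G s = x0 + (LINT t:{..s}|M. prod (G t) (h t))"
proof -
  interpret bounded_bilinear prod by fact
  note [measurable_cong] = M(2)
  have hm: "h \<in> borel_measurable M" using h by auto
  obtain K where K: "K \<ge> 0" "\<And>a b. norm (prod a b) \<le> norm a * norm b * K"
    using nonneg_bounded by blast
  define \<nu> where "\<nu> t = norm (h t) * K" for t
  have \<nu>: "integrable M \<nu>" unfolding \<nu>_def using h by auto
  have \<nu>0: "\<nu> t \<ge> 0" for t using K by (simp add: \<nu>_def)
  define w where "w s = (LINT t:{..s}|M. \<nu> t)" for s
  define W where "W = integral\<^sup>L M \<nu>"
  have w_bounds: "0 \<le> w s" "w s \<le> W" for s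
  proof -
    show "0 \<le> w s" unfolding w_def set_lebesgue_integral_def
      by (intro Bochner_Integration.integral_nonneg) (auto simp: \<nu>0)
    show "w s \<le> W" unfolding w_def W_def set_lebesgue_integral_def
      using \<nu> \<nu>0 by (intro integral_mono integrable_mult_indicator) (auto simp: indicator_def M(2))
  qed
  note pow = power_primitive[OF M \<nu> w_def]
  define F where "F = rec_nat (\<lambda>s. x0) (\<lambda>n f s. LINT t:{..s}|M. prod (f t) (h t))"
  have F0: "F 0 s = x0" and FS: "F (Suc n) s = (LINT t:{..s}|M. prod (F n t) (h t))" for n s
    by (auto simp: F_def)
  \<comment> \<open>Continuity provides measurability and boundedness the integrable majorant; this
    applies both to the terms of the series and to its sum.\<close>
  have cont_int: "integrable M (\<lambda>t. prod (f t) (h t))"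
    if f: "continuous_on UNIV f" "\<And>s. norm (f s) \<le> C" for f C
  proof (rule Bochner_Integration.integrable_bound)
    have "f \<in> borel_measurable M"
      unfolding measurable_cong_sets[OF M(2) refl] using f(1) by (rule borel_measurable_continuous_onI)
    then show "(\<lambda>t. prod (f t) (h t)) \<in> borel_measurable M"
      by (rule borel_measurable_bounded_bilinear[OF bl _ hm])
    show "integrable M (\<lambda>t. C * \<nu> t)" using \<nu> by auto
    show "AE t in M. norm (prod (f t) (h t)) \<le> norm (C * \<nu> t)"
    proof (rule AE_I2)
      fix t
      have "norm (prod (f t) (h t)) \<le> norm (f t) * \<nu> t" using K(2)[of "f t" "h t"] by (simp add: \<nu>_def mult.assoc)
      also have "\<dots> \<le> C * \<nu> t" using f(2) \<nu>0 by (intro mult_right_mono)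
      finally show "norm (prod (f t) (h t)) \<le> norm (C * \<nu> t)" by simp
    qed
  qed
  have F: "continuous_on UNIV (F n) \<and> (\<forall>s. norm (F n s) \<le> norm x0 * (w s ^ n / fact n))" for n
  proof (induction n)
    case 0
    have "F 0 = (\<lambda>s. x0)" using F0 by blast
    then show ?case by simp
  next
    case (Suc n)
    have bd: "norm (F n s) \<le> norm x0 * (W ^ n / fact n)" for s
      using Suc w_bounds by (intro order_trans[OF Suc[THEN conjunct2, rule_format]] mult_left_mono divide_right_mono power_mono) auto
    have int: "integrable M (\<lambda>t. prod (F n t) (h t))"
      using Suc bd by (intro cont_int[of _ "norm x0 * (W ^ n / fact n)"]) auto
    have FSn: "F (Suc n) = (\<lambda>s. LINT t:{..s}|M. prod (F n t) (h t))" using FS by blast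
    have "continuous_on UNIV (F (Suc n))"
      unfolding FSn by (rule continuous_primitive[OF M(2) int M(3)])
    moreover have "norm (F (Suc n) s) \<le> norm x0 * (w s ^ Suc n / fact (Suc n))" for s
    proof -
      have ipow: "integrable M (\<lambda>t. w t ^ n * \<nu> t)" using pow by blast
      have "norm (F (Suc n) s) \<le> (LINT t|M. norm (indicator {..s} t *\<^sub>R prod (F n t) (h t)))"
        unfolding FS set_lebesgue_integral_def by (rule integral_norm_bound)
      also have "\<dots> \<le> (LINT t|M. indicator {..s} t *\<^sub>R ((norm x0 / fact n) * (w t ^ n * \<nu> t)))"
      proof (rule integral_mono)
        show "integrable M (\<lambda>t. norm (indicator {..s} t *\<^sub>R prod (F n t) (h t)))"
          using int by (intro integrable_norm integrable_mult_indicator) (auto simp: M(2))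
        show "integrable M (\<lambda>t. indicator {..s} t *\<^sub>R ((norm x0 / fact n) * (w t ^ n * \<nu> t)))"
          using ipow by (intro integrable_mult_indicator integrable_mult_right) (auto simp: M(2))
        fix t
        have "norm (prod (F n t) (h t)) \<le> norm (F n t) * \<nu> t" using K(2)[of "F n t" "h t"] by (simp add: \<nu>_def mult.assoc)
        also have "\<dots> \<le> (norm x0 * (w t ^ n / fact n)) * \<nu> t" using Suc \<nu>0 by (intro mult_right_mono) auto
        also have "\<dots> = (norm x0 / fact n) * (w t ^ n * \<nu> t)" by simp
        finally show "norm (indicator {..s} t *\<^sub>R prod (F n t) (h t)) \<le> indicator {..s} t *\<^sub>R ((norm x0 / fact n) * (w t ^ n * \<nu> t))"
          by (auto simp: indicator_def)
      qed
      also have "\<dots> = (norm x0 / fact n) * (LINT t:{..s}|M. w t ^ n * \<nu> t)"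
        unfolding set_lebesgue_integral_def by (subst integral_mult_right_zero[symmetric]) (simp add: ac_simps)
      also have "(LINT t:{..s}|M. w t ^ n * \<nu> t) = w s ^ Suc n / real (Suc n)"
      proof -
        have "w s ^ Suc n = real (Suc n) * (LINT t:{..s}|M. w t ^ n * \<nu> t)"
          using pow[of n] by (simp del: power_Suc of_nat_Suc)
        then show ?thesis by (simp del: power_Suc of_nat_Suc)
      qed
      also have "(norm x0 / fact n) * (w s ^ Suc n / real (Suc n)) = norm x0 * (w s ^ Suc n / fact (Suc n))"
        by (simp add: field_simps)
      finally show ?thesis .
    qed
    ultimately show ?case by blast
  qed
  \<comment> \<open>Replacing \<open>w s\<close> by the total mass \<open>W\<close> makes the bound
    independent of \<open>s\<close>, as the Weierstrass test requires.\<close>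
  define c where "c n = norm x0 * (W ^ n / fact n)" for n
  have Fbd: "norm (F n s) \<le> c n" for n s
    unfolding c_def using F[of n] w_bounds
    by (intro order_trans[OF F[THEN conjunct2, rule_format]] mult_left_mono divide_right_mono power_mono) auto
  have c: "summable c"
    unfolding c_def using summable_exp[of W] by (intro summable_mult) (simp add: field_simps)
  have Fsum: "summable (\<lambda>n. norm (F n s))" for s
    by (rule summable_comparison_test'[OF c, of 0]) (simp add: Fbd)
  define G where "G s = (\<Sum>n. F n s)" for s
  have Gcont: "continuous_on UNIV G"
  proof (rule uniform_limit_theorem)
    show "uniform_limit UNIV (\<lambda>n s. \<Sum>i<n. F i s) G sequentially"
      unfolding G_def by (rule Weierstrass_m_test[OF Fbd c])
    show "\<forall>\<^sub>F n in sequentially. continuous_on UNIV (\<lambda>s. \<Sum>i<n. F i s)"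
      using F by (intro always_eventually allI continuous_on_sum) auto
  qed simp
  have Gbd: "norm (G s) \<le> suminf c" for s
  proof -
    have "norm (G s) \<le> (\<Sum>n. norm (F n s))" unfolding G_def by (rule summable_norm[OF Fsum])
    also have "\<dots> \<le> suminf c" by (rule suminf_le[OF Fbd Fsum c])
    finally show ?thesis .
  qed
  have Gint: "integrable M (\<lambda>t. prod (G t) (h t))" by (rule cont_int[OF Gcont Gbd])
  have "G s = x0 + (LINT t:{..s}|M. prod (G t) (h t))" for s
  proof -
    define f where "f n t = indicator {..s} t *\<^sub>R prod (F n t) (h t)" for n t
    have fint: "integrable M (f n)" for n
      unfolding f_def using F Fbd by (intro integrable_mult_indicator cont_int[of _ "c n"]) (auto simp: M(2))
    have nf: "norm (f n t) \<le> c n * \<nu> t" for n t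
    proof -
      have "norm (f n t) \<le> norm (prod (F n t) (h t))" by (auto simp: f_def indicator_def)
      also have "\<dots> \<le> norm (F n t) * \<nu> t" using K(2)[of "F n t" "h t"] by (simp add: \<nu>_def mult.assoc)
      also have "\<dots> \<le> c n * \<nu> t" using Fbd \<nu>0 by (intro mult_right_mono)
      finally show ?thesis .
    qed
    have s1: "AE t in M. summable (\<lambda>n. norm (f n t))"
      by (rule AE_I2, rule summable_comparison_test'[OF summable_mult2[OF c], of 0, OF order_trans[OF eq_refl nf]]) simp
    have "norm (LINT t|M. norm (f n t)) \<le> c n * W" for n
    proof -
      have "(LINT t|M. norm (f n t)) \<le> (LINT t|M. c n * \<nu> t)"
        using fint \<nu> nf by (intro integral_mono) auto
      then show ?thesis by (simp add: W_def)
    qed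
    then have s2: "summable (\<lambda>n. LINT t|M. norm (f n t))"
      by (rule summable_comparison_test'[OF summable_mult2[OF c], of 0])
    have pt: "(\<lambda>n. f n t) sums (indicator {..s} t *\<^sub>R prod (G t) (h t))" for t
      unfolding f_def G_def
      by (intro sums_scaleR_right bounded_linear.sums[OF bounded_linear_left] summable_sums summable_norm_cancel[OF Fsum])
    have "(\<lambda>n. integral\<^sup>L M (f n)) sums (LINT t|M. (\<Sum>n. f n t))"
      by (rule sums_integral[OF fint s1 s2])
    also have "(\<lambda>t. \<Sum>n. f n t) = (\<lambda>t. indicator {..s} t *\<^sub>R prod (G t) (h t))"
      using pt by (auto simp: sums_unique[symmetric])
    also have "(\<lambda>n. integral\<^sup>L M (f n)) = (\<lambda>n. F (Suc n) s)"
      by (simp add: FS f_def[abs_def] set_lebesgue_integral_def)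
    finally have "(\<Sum>n. F (Suc n) s) = (LINT t:{..s}|M. prod (G t) (h t))"
      by (simp add: sums_iff set_lebesgue_integral_def)
    \<comment> \<open>Termwise integration shifts the series by one index; the head that is lost is
      the constant \<open>x0\<close>.\<close>
    moreover have "(\<Sum>n. F (Suc n) s) = G s - F 0 s"
      unfolding G_def by (rule suminf_split_head[OF summable_norm_cancel[OF Fsum]])
    ultimately show ?thesis by (simp add: F0 algebra_simps)
  qed
  then show ?thesis using that Gcont Gint by blast
qed

section \<open>Matrix-valued functions\<close>

lemma matrix_add_rdistrib_real: "(B + C) ** A = B ** A + C ** (A :: real^'p^'n)"
  by (simp add: matrix_matrix_mult_def vec_eq_iff distrib_right sum.distrib)

lemma bounded_bilinear_matrix_mult: "bounded_bilinear ((**) :: real^'n^'m \<Rightarrow> real^'p^'n \<Rightarrow> real^'p^'m)"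
  unfolding bilinear_conv_bounded_bilinear[symmetric] bilinear_def
  by (intro conjI allI linearI)
     (auto simp: matrix_add_ldistrib matrix_add_rdistrib_real matrix_scalar_ac scalar_matrix_assoc)

lemma bounded_linear_transpose: "bounded_linear (transpose :: real^'n^'m \<Rightarrow> real^'m^'n)"
  unfolding linear_conv_bounded_linear[symmetric]
  by (rule linearI) (auto simp: transpose_def vec_eq_iff)

lemma continuous_on_det:
  fixes f :: "'a::topological_space \<Rightarrow> real^'n^'n"
  assumes "continuous_on S f" shows "continuous_on S (\<lambda>x. det (f x))"
  unfolding det_def using assms by (intro continuous_intros) auto

text \<open>For an orthogonal matrix inversion undoes transposition; this is how the nonlinear
  right-hand side becomes linear. As \<open>matrix_inv\<close> is a choice operator, its defining
  property is obtained by exhibiting \<open>A\<close> as a witness.\<close>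

lemma matrix_inv_transpose:
  fixes A :: "real^'n^'n"
  assumes "transpose A ** A = mat 1" shows "matrix_inv (transpose A) = A"
proof -
  have AA: "A ** transpose A = mat 1" using assms matrix_left_right_inverse by blast
  have "transpose A ** matrix_inv (transpose A) = mat 1"
    using someI[of "\<lambda>B. transpose A ** B = mat 1 \<and> B ** transpose A = mat 1" A] assms AA
    by (auto simp: matrix_inv_def)
  then have "A ** (transpose A ** matrix_inv (transpose A)) = A ** mat 1" by simp
  then show ?thesis by (simp add: matrix_mul_assoc AA)
qed

lemma matrix_inv_transpose_cancel:
  fixes A :: "real^'n^'n"
  assumes "invertible A"
  shows "transpose A ** matrix_inv (transpose A) = mat 1" "transpose (matrix_inv (transpose A)) ** A = mat 1"
proof -
  have "invertible (transpose A)" using assms by (simp add: transpose_invertible)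
  then have "\<exists>B. transpose A ** B = mat 1 \<and> B ** transpose A = mat 1" by (simp add: invertible_def)
  then show *: "transpose A ** matrix_inv (transpose A) = mat 1"
    unfolding matrix_inv_def by (rule someI2_ex) simp
  have "transpose (transpose A ** matrix_inv (transpose A)) = transpose (mat 1)" using * by simp
  then show "transpose (matrix_inv (transpose A)) ** A = mat 1"
    by (simp add: matrix_transpose_mul)
qed

lemma SO_iff: "Q \<in> SO \<longleftrightarrow> transpose Q ** Q = mat 1 \<and> det Q = 1"
  by (simp add: SO_def rotation_matrix_def orthogonal_matrix)

lemma transpose_uminus: "transpose (- A) = - transpose (A :: real^'n^'m)"
  by (simp add: transpose_def vec_eq_iff)

text \<open>The linear equation is posed with multiplication by -h from the right, so that the
  density of G G^T is -G (h + h^T) G^T and vanishes almost everywhere. Orthogonality leaves only 1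
  and -1 for the determinant, and continuity excludes the second value.\<close>

lemma orthogonal_solution:
  fixes h :: "real \<Rightarrow> real^'n^'n"
  assumes M: "sigma_finite_measure M" "sets M = sets borel" "\<And>s. emeasure M {s} = 0"
    and h: "integrable M h" "AE t in M. h t + transpose (h t) = 0" "\<And>t. t \<le> 0 \<Longrightarrow> h t = 0"
    and G0: "G0 \<in> SO"
  obtains G where "continuous_on UNIV G" "integrable M (\<lambda>t. - (G t ** h t))"
    "\<And>s. G s = G0 + (LINT t:{..s}|M. - (G t ** h t))" "\<And>s. G s \<in> SO" "G 0 = G0"
proof -
  interpret mm: bounded_bilinear "(**) :: real^'n^'n \<Rightarrow> real^'n^'n \<Rightarrow> real^'n^'n"
    by (rule bounded_bilinear_matrix_mult)
  have h': "integrable M (\<lambda>t. - h t)" using h by auto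
  obtain G where G: "continuous_on UNIV G" "integrable M (\<lambda>t. G t ** (- h t))"
    "\<And>s. G s = G0 + (LINT t:{..s}|M. G t ** (- h t))"
    using linear_equation_solution[OF bounded_bilinear_matrix_mult M h', of G0] by blast
  note G' = G(2,3)[unfolded mm.minus_right]
  interpret tr: bounded_linear "transpose :: real^'n^'n \<Rightarrow> real^'n^'n"
    by (rule bounded_linear_transpose)
  have Gt: "transpose (G s) = transpose G0 + (LINT t:{..s}|M. transpose (- (G t ** h t)))" for s
  proof -
    have "integrable M (\<lambda>t. indicator {..s} t *\<^sub>R (- (G t ** h t)))"
      using G'(1) M(2) by (intro integrable_mult_indicator) auto
    then have "(LINT t:{..s}|M. transpose (- (G t ** h t))) = transpose (LINT t:{..s}|M. - (G t ** h t))"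
      unfolding set_lebesgue_integral_def tr.scaleR[symmetric]
      by (rule integral_bounded_linear[OF bounded_linear_transpose])
    then show ?thesis by (subst G'(2)) (simp add: tr.add)
  qed
  have Gti: "integrable M (\<lambda>t. transpose (- (G t ** h t)))"
    by (rule integrable_bounded_linear[OF bounded_linear_transpose G'(1)])
  have GG: "G s ** transpose (G s) = mat 1" for s
  proof -
    have "G s ** transpose (G s) = G0 ** transpose G0 +
        (LINT t:{..s}|M. G t ** transpose (- (G t ** h t)) + (- (G t ** h t)) ** transpose (G t))"
      by (rule primitive_bilinear(2)[OF bounded_bilinear_matrix_mult M G'(1) Gti G'(2) Gt])
    also have "(LINT t:{..s}|M. G t ** transpose (- (G t ** h t)) + (- (G t ** h t)) ** transpose (G t)) = 0"
      unfolding set_lebesgue_integral_def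
    proof (rule integral_eq_zero_AE)
      show "AE t in M. indicator {..s} t *\<^sub>R (G t ** transpose (- (G t ** h t)) + - (G t ** h t) ** transpose (G t)) = 0"
        using h(2)
      proof eventually_elim
        case (elim t)
        have "G t ** transpose (- (G t ** h t)) + - (G t ** h t) ** transpose (G t)
            = - (G t ** (h t + transpose (h t)) ** transpose (G t))"
          by (simp add: transpose_uminus matrix_transpose_mul mm.minus_right mm.minus_left mm.add_right mm.add_left matrix_mul_assoc)
        then show ?case by (simp add: elim mm.zero_left mm.zero_right)
      qed
    qed
    also have "G0 ** transpose G0 = mat 1" using G0 matrix_left_right_inverse by (auto simp: SO_iff)
    finally show ?thesis by simp
  qed
  have orth: "transpose (G s) ** G s = mat 1" for s using GG matrix_left_right_inverse by blast
  \<comment> \<open>The integral equation prescribes the value at minus infinity; as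
    \<open>h\<close> vanishes up to 0, \<open>G\<close> has not moved by then.\<close>
  have G00: "G 0 = G0"
  proof -
    have "(\<lambda>t. indicator {..0} t *\<^sub>R - (G t ** h t)) = (\<lambda>t. 0)"
      using h(3) by (auto simp: indicator_def mm.zero_right)
    then show ?thesis using G'(2)[of 0] by (simp add: set_lebesgue_integral_def)
  qed
  \<comment> \<open>A determinant -1 somewhere and 1 at 0 would force the value 0 in between, which
    an orthogonal matrix cannot have.\<close>
  have det: "det (G s) = 1" for s
  proof (rule ccontr)
    assume "det (G s) \<noteq> 1"
    then have m: "det (G s) = - 1"
      using det_orthogonal_matrix[of "G s"] orth by (auto simp: orthogonal_matrix)
    have "connected ((\<lambda>s. det (G s)) ` UNIV)"
      by (intro connected_continuous_image continuous_on_det G(1)) simp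
    moreover have "- 1 \<in> range (\<lambda>s. det (G s))" by (rule image_eqI[of _ _ s]) (simp_all add: m)
    moreover have "1 \<in> range (\<lambda>s. det (G s))"
      by (rule image_eqI[of _ _ 0]) (use G0 in \<open>simp_all add: G00 SO_iff\<close>)
    ultimately have "{- 1..1} \<subseteq> range (\<lambda>s. det (G s))"
      by (rule connected_contains_Icc)
    then have "0 \<in> range (\<lambda>s. det (G s))" by (rule subsetD) simp
    then obtain r where "det (G r) = 0" by auto
    then show False using det_orthogonal_matrix[of "G r"] orth by (auto simp: orthogonal_matrix)
  qed
  show ?thesis
    by (rule that[OF G(1) G' _ G00]) (simp add: SO_iff det orth)
qed

section \<open>Matrix entries and integrals against test functions\<close>

lemma integral_entry:
  fixes g :: "'a \<Rightarrow> real^'m^'n"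
  assumes "integrable M g" "A \<in> sets M"
  shows "(LINT t:A|M. g t) $ i $ j = (LINT t:A|M. g t $ i $ j)"
proof -
  have "integrable M (\<lambda>t. indicator A t *\<^sub>R g t)" using assms by (intro integrable_mult_indicator)
  then show ?thesis
    unfolding set_lebesgue_integral_def
    by (subst integral_bounded_linear[OF bounded_linear_entry, symmetric]) auto
qed

lemma integrable_entry: "integrable M g \<Longrightarrow> integrable M (\<lambda>t. (g t :: real^'m^'n) $ i $ j)"
  by (rule integrable_bounded_linear[OF bounded_linear_entry])

lemma test_function_bounded:
  assumes "\<phi> \<in> test_functions {a<..<b}" "a < b"
  obtains B where "\<And>x. \<bar>\<phi> x\<bar> \<le> B"
proof -
  obtain c d where cd: "a < c" "c \<le> d" "d < b" "\<And>x. x \<notin> {c..d} \<Longrightarrow> \<phi> x = 0"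
    using test_function_support[OF assms] by metis
  have "\<exists>B. \<forall>x. \<bar>\<phi> x\<bar> \<le> B"
    by (rule bounded_continuous_support[OF smooth_real_continuous[OF test_function_smooth[OF assms(1)]] cd(4)]) auto
  then show ?thesis using that by blast
qed

lemma test_function_measurable: "\<phi> \<in> test_functions I \<Longrightarrow> \<phi> \<in> borel_measurable borel"
  by (intro borel_measurable_continuous_onI smooth_real_continuous test_function_smooth)

lemma integrable_test_function_mult:
  fixes g :: "real \<Rightarrow> real"
  assumes "\<phi> \<in> test_functions {a<..<b}" "a < b" "sets M = sets borel" "integrable M g"
  shows "integrable M (\<lambda>t. \<phi> t * g t)"
proof -
  obtain B where B: "\<And>x. \<bar>\<phi> x\<bar> \<le> B" using test_function_bounded[OF assms(1,2)] by blast
  show ?thesis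
  proof (rule Bochner_Integration.integrable_bound)
    show "integrable M (\<lambda>t. B * g t)" using assms by auto
    have "\<phi> \<in> borel_measurable M"
      unfolding measurable_cong_sets[OF assms(3) refl] using assms(1) by (rule test_function_measurable)
    then show "(\<lambda>t. \<phi> t * g t) \<in> borel_measurable M" using assms(4) by (intro borel_measurable_times) auto
    show "AE t in M. norm (\<phi> t * g t) \<le> norm (B * g t)"
      using B by (intro AE_I2) (auto simp: abs_mult intro!: mult_right_mono order_trans[OF B abs_ge_self])
  qed
qed

lemma test_function_outside:
  assumes "\<phi> \<in> test_functions I" "x \<notin> I" shows "\<phi> x = 0"
  using assms closure_subset[of "{x. \<phi> x \<noteq> 0}"] by (auto simp: test_functions_def)

lemma set_integral_test_function_mult:
  fixes g :: "real \<Rightarrow> real"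
  assumes "\<phi> \<in> test_functions I"
  shows "(LINT t:I|M. \<phi> t * g t) = (LINT t|M. \<phi> t * g t)"
  unfolding set_lebesgue_integral_def
  by (intro Bochner_Integration.integral_cong) (use test_function_outside[OF assms] in \<open>auto simp: indicator_def\<close>)

lemma signed_integral_test_function:
  fixes h :: "real \<Rightarrow> real^'n^'m"
  assumes M: "sets M = sets borel" and h: "integrable M h" and ab: "a < b"
    and \<mu>: "\<And>A. A \<in> sets borel \<Longrightarrow> A \<subseteq> {a<..<b} \<Longrightarrow> \<mu> A = (LINT x:A|M. h x)"
    and \<phi>: "\<phi> \<in> test_functions {a<..<b}"
  shows "signed_integral (borel_on {a<..<b}) (\<lambda>A. \<mu> A $ i $ j) \<phi> = (LINT t|M. \<phi> t * h t $ i $ j)"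
proof -
  have "signed_integral (borel_on {a<..<b}) (\<lambda>A. \<mu> A $ i $ j) \<phi> = (LINT t:{a<..<b}|M. \<phi> t * h t $ i $ j)"
  proof (rule signed_integral_density(2)[OF M integrable_entry[OF h]])
    show "\<mu> A $ i $ j = (LINT x:A|M. h x $ i $ j)" if "A \<in> sets borel" "A \<subseteq> {a<..<b}" for A
      using \<mu>[OF that] integral_entry[OF h, of A i j] that M by simp
    show "\<phi> \<in> borel_measurable (borel_on {a<..<b})"
      using test_function_measurable[OF \<phi>] by (rule measurable_restrict_space1)
    show "set_integrable M {a<..<b} (\<lambda>t. \<phi> t * h t $ i $ j)"
      unfolding set_integrable_def
      using integrable_test_function_mult[OF \<phi> ab M integrable_entry[OF h]] M
      by (intro integrable_mult_indicator) auto
  qed simp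
  then show ?thesis using set_integral_test_function_mult[OF \<phi>] by simp
qed

section \<open>Matrix functions as primitives of their derivatives\<close>

lemma distr_primitive_matrix:
  fixes u h :: "real \<Rightarrow> real^'n^'n"
  assumes M: "finite_measure M" "sets M = sets borel" and h: "integrable M h" and ab: "a < b"
    and u: "set_integrable lebesgue {a<..<b} u"
    and eq: "\<And>\<phi> i j. \<phi> \<in> test_functions {a<..<b} \<Longrightarrow>
      (LINT s:{a<..<b}|lebesgue. u s $ i $ j * deriv \<phi> s) = - (LINT t|M. \<phi> t * h t $ i $ j)"
  obtains c where "AE s\<in>{a<..<b} in lebesgue. u s = c + (LINT t:{..s}|M. h t)"
proof -
  have ex: "\<exists>c. AE s\<in>{a<..<b} in lebesgue. u s $ i $ j = c + (LINT t:{..s}|M. h t $ i $ j)" for i j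
  proof (rule distr_primitive[OF M integrable_entry[OF h] ab, of "\<lambda>s. u s $ i $ j" i j])
    show "set_integrable lebesgue {a<..<b} (\<lambda>s. u s $ i $ j)"
      using integrable_entry[OF u[unfolded set_integrable_def], of i j] by (simp add: set_integrable_def)
  qed (rule eq, assumption, blast)
  define c where "c i j = (SOME c. AE s\<in>{a<..<b} in lebesgue. u s $ i $ j = c + (LINT t:{..s}|M. h t $ i $ j))" for i j
  have c: "AE s\<in>{a<..<b} in lebesgue. u s $ i $ j = c i j + (LINT t:{..s}|M. h t $ i $ j)" for i j
    unfolding c_def by (rule someI_ex[OF ex])
  have "AE s in lebesgue. \<forall>i j. s \<in> {a<..<b} \<longrightarrow> u s $ i $ j = c i j + (LINT t:{..s}|M. h t $ i $ j)"
    using c by (intro eventually_all_finite)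
  then have "AE s\<in>{a<..<b} in lebesgue. u s = (\<chi> i j. c i j) + (LINT t:{..s}|M. h t)"
    by eventually_elim (auto simp: vec_eq_iff integral_entry[OF h] M(2))
  then show ?thesis by (rule that)
qed

lemma has_distr_deriv_primitive:
  fixes u :: "real \<Rightarrow> real^'n^'n"
  assumes M: "finite_measure M" "sets M = sets borel" and h: "integrable M h" and ab: "a < b"
    and \<mu>: "\<And>A. A \<in> sets borel \<Longrightarrow> A \<subseteq> {a<..<b} \<Longrightarrow> \<mu> A = (LINT x:A|M. h x)"
    and u: "set_integrable lebesgue {a<..<b} u" "has_distr_deriv {a<..<b} u \<mu>"
  obtains c where "AE s\<in>{a<..<b} in lebesgue. u s = c + (LINT t:{..s}|M. h t)"
proof (rule distr_primitive_matrix[OF M h ab u(1)])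
  fix \<phi> i j assume \<phi>: "\<phi> \<in> test_functions {a<..<b}"
  show "(LINT s:{a<..<b}|lebesgue. u s $ i $ j * deriv \<phi> s) = - (LINT t|M. \<phi> t * h t $ i $ j)"
    using u(2) \<phi> signed_integral_test_function[OF M(2) h ab \<mu> \<phi>] by (auto simp: has_distr_deriv_def)
qed (rule that)

text \<open>The second claim expresses the weak derivative through \<open>M\<close>; the first
  repackages it as a signed integral, the form that membership in \<open>BV\<close> asks
  for.\<close>

lemma primitive_has_distr_deriv:
  fixes g :: "real \<Rightarrow> real^'n^'n"
  assumes M: "finite_measure M" "sets M = sets borel" and g: "integrable M g" and ab: "a < b"
    and U: "\<And>s. U s = c + (LINT t:{..s}|M. g t)"
  shows "has_distr_deriv {a<..<b} U (\<lambda>A. LINT t:A|M. g t)"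
    and "\<phi> \<in> test_functions {a<..<b} \<Longrightarrow>
      (LINT s:{a<..<b}|lebesgue. U s $ i $ j * deriv \<phi> s) = - (LINT t|M. \<phi> t * g t $ i $ j)"
proof -
  have *: "(LINT s:{a<..<b}|lebesgue. U s $ i $ j * deriv \<phi> s) = - (LINT t|M. \<phi> t * g t $ i $ j)"
    if "\<phi> \<in> test_functions {a<..<b}" for \<phi> i j
  proof -
    have "U s $ i $ j = c $ i $ j + (LINT t:{..s}|M. g t $ i $ j)" for s
      by (simp add: U integral_entry[OF g] M(2))
    then show ?thesis using integration_by_parts[OF M integrable_entry[OF g] that ab] by simp
  qed
  then show "\<phi> \<in> test_functions {a<..<b} \<Longrightarrow>
      (LINT s:{a<..<b}|lebesgue. U s $ i $ j * deriv \<phi> s) = - (LINT t|M. \<phi> t * g t $ i $ j)" by blast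
  have vm: "vector_measure (borel_on {a<..<b}) (\<lambda>A. LINT t:A|M. g t)"
    by (rule vector_measure_set_integral[OF g]) (auto simp: M(2) sets_restrict_space_iff)
  show "has_distr_deriv {a<..<b} U (\<lambda>A. LINT t:A|M. g t)"
    unfolding has_distr_deriv_def
  proof (intro conjI ballI allI vm)
    fix \<phi> i j assume \<phi>: "\<phi> \<in> test_functions {a<..<b}"
    show "(LINT s:{a<..<b}|lebesgue. U s $ i $ j * deriv \<phi> s) =
       - signed_integral (borel_on {a<..<b}) (\<lambda>A. (LINT t:A|M. g t) $ i $ j) \<phi>"
      unfolding *[OF \<phi>] using signed_integral_test_function[OF M(2) g ab refl \<phi>] by simp
  qed
qed

lemma has_distr_deriv_distr_deriv:
  assumes "u \<in> BV I X" shows "has_distr_deriv I u (distr_deriv I u)"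
proof -
  have "\<exists>\<mu>. has_distr_deriv I u \<mu>" using assms by (simp add: BV_def)
  then show ?thesis unfolding distr_deriv_def by (rule someI_ex)
qed

text \<open>\<open>distr_deriv\<close> is merely some derivative of \<open>u\<close>, so its atoms
  have to be read off from \<open>u\<close>. The one-sided limits at \<open>s\<close> of the
  primitive of this derivative differ by the mass of \<open>{s}\<close>, and continuity forces both
  to be \<open>u s\<close>.\<close>

lemma no_jump_part_continuous:
  fixes u :: "real \<Rightarrow> real^'n^'n"
  assumes ab: "a < b" and u: "u \<in> BV {a<..<b} X" and cont: "continuous_on {a<..<b} u"
  shows "no_jump_part {a<..<b} u"
  unfolding no_jump_part_def
proof
  fix s assume s: "s \<in> {a<..<b}"
  define \<mu> where "\<mu> = distr_deriv {a<..<b} u"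
  have \<mu>: "has_distr_deriv {a<..<b} u \<mu>" unfolding \<mu>_def by (rule has_distr_deriv_distr_deriv[OF u])
  then have vm: "vector_measure (borel_on {a<..<b}) \<mu>" by (simp add: has_distr_deriv_def)
  obtain M h where M: "finite_measure M" "sets M = sets borel" "integrable M h"
    "\<And>A. A \<in> sets borel \<Longrightarrow> A \<subseteq> {a<..<b} \<Longrightarrow> \<mu> A = (LINT x:A|M. h x)"
    by (rule matrix_measure_density[OF vm]) auto
  have ui: "set_integrable lebesgue {a<..<b} u" using u by (simp add: BV_def)
  obtain c where c: "AE s\<in>{a<..<b} in lebesgue. u s = c + (LINT t:{..s}|M. h t)"
    by (rule has_distr_deriv_primitive[OF M(1-3) ab M(4) ui \<mu>])
  have "isCont u s" using cont s by (simp add: continuous_on_eq_continuous_at)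
  then have ulim: "(u \<longlongrightarrow> u s) (at_right s)" "(u \<longlongrightarrow> u s) (at_left s)"
    by (auto simp: isCont_def filterlim_at_split)
  note lim = primitive_tendsto[OF M(2,3), of s]
  have "u s = c + (LINT t:{..s}|M. h t)"
    by (rule AE_eq_one_sided_limits(1)[OF c s ulim(1)]) (intro tendsto_intros lim)
  moreover have "u s = c + (LINT t:{..<s}|M. h t)"
    by (rule AE_eq_one_sided_limits(2)[OF c s ulim(2)]) (intro tendsto_intros lim)
  ultimately have eq: "(LINT t:{..s}|M. h t) = (LINT t:{..<s}|M. h t)" by simp
  have si: "set_integrable M A h" if "A \<in> sets borel" for A
    using M(2,3) that unfolding set_integrable_def by (intro integrable_mult_indicator) auto
  have "(LINT t:{..<s} \<union> {s}|M. h t) = (LINT t:{..<s}|M. h t) + (LINT t:{s}|M. h t)"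
    by (rule set_integral_Un) (auto intro: si)
  moreover have "{..<s} \<union> {s} = {..s}" by auto
  ultimately have "(LINT t:{s}|M. h t) = 0" using eq by simp
  then have "\<mu> {s} = 0" using M(4)[of "{s}"] s by simp
  then show "distr_deriv {a<..<b} u {s} = 0" by (simp add: \<mu>_def)
qed

section \<open>Uniqueness\<close>

text \<open>Skew-symmetry of \<Omega> makes the primitive \<open>Z\<close> of h + h^T almost
  everywhere equal to a constant on the interval, and \<open>Z\<close> is continuous since
  \<open>M\<close> has no atoms. Continuity at 0 shows that the constant is 0, continuity at L that
  the total integral is 0; thus all integrals over half lines vanish.\<close>

lemma skew_density:
  fixes h :: "real \<Rightarrow> real^'n^'n"
  assumes L: "0 < L" and M: "sigma_finite_measure M" "sets M = sets borel" "\<And>s. emeasure M {s} = 0"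
    and h: "integrable M h" "\<And>t. t \<notin> {0<..<L} \<Longrightarrow> h t = 0"
    and \<Omega>: "AE s\<in>{0<..<L} in lebesgue. \<Omega> s = c + (LINT t:{..s}|M. h t)"
    and skew: "AE s\<in>{0<..<L} in lebesgue. transpose (\<Omega> s) = - \<Omega> s"
  shows "AE t in M. h t + transpose (h t) = 0"
proof -
  interpret tr: bounded_linear "transpose :: real^'n^'n \<Rightarrow> real^'n^'n"
    by (rule bounded_linear_transpose)
  define k where "k t = h t + transpose (h t)" for t
  have k: "integrable M k"
    unfolding k_def using h(1) integrable_bounded_linear[OF bounded_linear_transpose h(1)] by auto
  have k0: "k t = 0" if "t \<notin> {0<..<L}" for t using h(2)[OF that] by (simp add: k_def tr.zero)
  define Z where "Z s = (LINT t:{..s}|M. k t)" for s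
  have Z: "Z s = (LINT t:{..s}|M. h t) + transpose (LINT t:{..s}|M. h t)" for s
  proof -
    have i: "integrable M (\<lambda>t. indicator {..s} t *\<^sub>R h t)"
      using h(1) M(2) by (intro integrable_mult_indicator) auto
    have "transpose (LINT t:{..s}|M. h t) = (LINT t:{..s}|M. transpose (h t))"
      unfolding set_lebesgue_integral_def tr.scaleR[symmetric]
      by (rule integral_bounded_linear[OF bounded_linear_transpose i, symmetric])
    moreover have "(LINT t:{..s}|M. h t + transpose (h t)) = (LINT t:{..s}|M. h t) + (LINT t:{..s}|M. transpose (h t))"
    proof (rule set_integral_add)
      show "set_integrable M {..s} (\<lambda>t. transpose (h t))"
        unfolding set_integrable_def tr.scaleR[symmetric] by (rule integrable_bounded_linear[OF bounded_linear_transpose i])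
    qed (use i in \<open>simp add: set_integrable_def\<close>)
    ultimately show ?thesis by (simp add: Z_def k_def)
  qed
  \<comment> \<open>The value of \<open>Z\<close> dictated by \<Omega> + \<Omega>^T = 0 when
    \<Omega> is \<open>c\<close> plus the primitive of \<open>h\<close>.\<close>
  define K where "K = - (c + transpose c)"
  have AE: "AE s\<in>{0<..<L} in lebesgue. Z s = K"
    using \<Omega> skew
  proof eventually_elim
    case (elim s)
    show ?case
    proof
      assume s: "s \<in> {0<..<L}"
      define W where "W = (LINT t:{..s}|M. h t)"
      have 1: "\<Omega> s = c + W" using elim(1) s by (simp add: W_def)
      then have "transpose c + transpose W = - (c + W)"
        using elim(2) s by (simp add: tr.add)
      then show "Z s = K" by (simp add: Z K_def W_def[symmetric] algebra_simps eq_neg_iff_add_eq_0)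
    qed
  qed
  have cont: "isCont Z s" for s
    using continuous_primitive[OF M(2) k M(3), of UNIV] unfolding Z_def
    by (simp add: continuous_on_eq_continuous_at)
  then have lim: "(Z \<longlongrightarrow> Z s) (at_right s)" "(Z \<longlongrightarrow> Z s) (at_left s)" for s
    unfolding isCont_def filterlim_at_split by blast+
  have ZK: "Z s = K" if "s \<in> {0<..<L}" for s
    by (rule AE_eq_one_sided_limits(1)[OF AE that lim(1)]) simp
  have Z0: "Z s = 0" if "s \<le> 0" for s
  proof -
    have "(\<lambda>t. indicator {..s} t *\<^sub>R k t) = (\<lambda>t. 0)" using k0 that by (auto simp: indicator_def)
    then show ?thesis by (simp add: Z_def set_lebesgue_integral_def)
  qed
  have ZL: "Z s = integral\<^sup>L M k" if "s \<ge> L" for s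
    unfolding Z_def set_lebesgue_integral_def
    by (rule Bochner_Integration.integral_cong) (use k0 that in \<open>auto simp: indicator_def\<close>)
  have "(Z \<longlongrightarrow> K) (at_right 0)"
    by (rule tendsto_eventually) (use eventually_at_right_real[OF L] ZK in \<open>auto elim: eventually_mono\<close>)
  then have "Z 0 = K" by (rule tendsto_unique[OF trivial_limit_at_right_real lim(1)])
  then have K: "K = 0" using Z0 by simp
  have "(Z \<longlongrightarrow> K) (at_left L)"
    by (rule tendsto_eventually) (use eventually_at_left_real[OF L] ZK in \<open>auto elim: eventually_mono\<close>)
  then have "Z L = K" by (rule tendsto_unique[OF trivial_limit_at_left_real lim(2)])
  then have tot: "integral\<^sup>L M k = 0" using ZL[of L] K by simp
  have Zzero: "Z s = 0" for s
    using Z0[of s] ZL[of s] ZK[of s] K tot by (cases "s \<le> 0"; cases "s \<ge> L") auto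
  have half: "(LINT t:{x<..}|M. k t) = 0" for x
  proof -
    have si: "set_integrable M A k" if "A \<in> sets borel" for A
      using k M(2) that unfolding set_integrable_def by (intro integrable_mult_indicator) auto
    have "(LINT t:{..x} \<union> {x<..}|M. k t) = (LINT t:{..x}|M. k t) + (LINT t:{x<..}|M. k t)"
      by (rule set_integral_Un) (auto intro: si)
    moreover have "{..x} \<union> {x<..} = UNIV" by auto
    ultimately show ?thesis using Zzero[of x] tot by (simp add: Z_def set_lebesgue_integral_def)
  qed
  have "AE t in M. k t $ i $ j = 0" for i j
  proof (rule AE_eq_0_half_lines[OF M(1,2) integrable_entry[OF k]])
    show "(LINT t:{x<..}|M. k t $ i $ j) = 0" for x
      using half[of x] integral_entry[OF k, of "{x<..}" i j] M(2) by simp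
  qed
  then have "AE t in M. \<forall>i j. k t $ i $ j = 0" by (intro eventually_all_finite)
  then show ?thesis by eventually_elim (simp add: k_def vec_eq_iff)
qed

lemma test_functions_mono: "I \<subseteq> J \<Longrightarrow> test_functions I \<subseteq> test_functions J"
  by (auto simp: test_functions_def)

text \<open>The factors of the bump are monotone in opposite directions, so their values at
  \<open>a\<close> and at \<open>b\<close> bound them from below on \<open>{a..b}\<close>; \<delta>
  is the product of these two values. The choice of \<open>m\<close> makes both positive.\<close>

lemma test_function_positive:
  fixes a b :: real
  assumes "a0 < a" "b < b0"
  obtains \<phi> \<delta> where "\<phi> \<in> test_functions {a0<..<b0}" "\<delta> > 0" "\<And>x. x \<in> {a..b} \<Longrightarrow> \<delta> \<le> \<phi> x"
proof -
  obtain m :: nat where m: "max (1 / (a - a0)) (1 / (b0 - b)) < m" using reals_Archimedean2 by blast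
  define \<delta> where "\<delta> = flat_poly 1 (m * (a - a0) - 1) * flat_poly 1 (m * (b0 - b) - 1)"
  have "m * (a - a0) > 1" "m * (b0 - b) > 1"
    using m assms by (auto simp: field_simps)
  then have "\<delta> > 0" by (simp add: \<delta>_def flat_poly_def)
  moreover have "\<delta> \<le> bump a0 b0 m x" if "x \<in> {a..b}" for x
    unfolding \<delta>_def bump_def using that
    by (intro mult_mono flat_poly_1_mono flat_poly_1_bounds diff_right_mono mult_left_mono) auto
  ultimately show ?thesis using that bump_test by blast
qed

text \<open>The interval is compactly contained in \<open>{0<..<L}\<close> because the integrability of \<open>p ** h\<close> is only known
  after multiplication with a test function.\<close>

lemma solution_primitive:
  fixes h :: "real \<Rightarrow> real^'n^'n"
  assumes L: "0 < L" and M: "finite_measure M" "sets M = sets borel" and h: "integrable M h"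
    and \<mu>: "\<And>A. A \<in> sets borel \<Longrightarrow> A \<subseteq> {0<..<L} \<Longrightarrow> distr_deriv {0<..<L} \<Omega> A = (LINT x:A|M. h x)"
    and sol: "is_solution L \<Omega> G0 H" and ab: "0 < a" "a < b" "b < L"
  defines "p \<equiv> \<lambda>s. matrix_inv (transpose (precise_rep H s))"
  defines "g \<equiv> \<lambda>t. indicator {a<..<b} t *\<^sub>R - (p t ** h t)"
  shows "integrable M g" "\<exists>c. AE s\<in>{a<..<b} in lebesgue. H s = c + (LINT t:{..s}|M. g t)"
proof -
  let ?I = "{0<..<L}"
  have sub: "{a<..<b} \<subseteq> ?I" using ab by auto
  have entry: "distr_deriv ?I \<Omega> A $ k $ j = (LINT x:A|M. h x $ k $ j)" if "A \<in> sets borel" "A \<subseteq> ?I" for A k j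
    using \<mu>[OF that] integral_entry[OF h, of A k j] that M by simp
  have sol1: "signed_integrable (borel_on ?I) (\<lambda>A. distr_deriv ?I \<Omega> A $ k $ j) (\<lambda>s. \<phi> s * p s $ i $ k)"
    if "\<phi> \<in> test_functions ?I" for \<phi> i j k
    using sol that unfolding is_solution_def p_def by blast
  have sol2: "(LINT s:?I|lebesgue. H s $ i $ j * deriv \<phi> s) =
      (\<Sum>k\<in>UNIV. signed_integral (borel_on ?I) (\<lambda>A. distr_deriv ?I \<Omega> A $ k $ j) (\<lambda>s. \<phi> s * p s $ i $ k))"
    if "\<phi> \<in> test_functions ?I" for \<phi> i j
    using sol that unfolding is_solution_def p_def by blast
  have int: "set_integrable M ?I (\<lambda>s. \<phi> s * p s $ i $ k * h s $ k $ j)"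
    "signed_integral (borel_on ?I) (\<lambda>A. distr_deriv ?I \<Omega> A $ k $ j) (\<lambda>s. \<phi> s * p s $ i $ k)
      = (LINT s:?I|M. \<phi> s * p s $ i $ k * h s $ k $ j)"
    if \<phi>: "\<phi> \<in> test_functions ?I" for \<phi> i j k
  proof -
    \<comment> \<open>Measurability of the inverse is not assumed separately; it is contained in the
      integrability clause of the notion of solution.\<close>
    have "(\<lambda>s. \<phi> s * p s $ i $ k) \<in> borel_measurable (upper_variation (borel_on ?I) (\<lambda>A. distr_deriv ?I \<Omega> A $ k $ j))"
      using sol1[OF \<phi>, of k j i] unfolding signed_integrable_def by (blast dest: borel_measurable_integrable)
    then have m: "(\<lambda>s. \<phi> s * p s $ i $ k) \<in> borel_measurable (borel_on ?I)"
      unfolding measurable_cong_sets[OF sets_upper_variation refl] .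
    have I: "?I \<in> sets borel" by simp
    note * = signed_integral_density[where \<nu>="\<lambda>A. distr_deriv ?I \<Omega> A $ k $ j" and h="\<lambda>t. h t $ k $ j",
        OF M(2) integrable_entry[OF h] I entry m]
    show **: "set_integrable M ?I (\<lambda>s. \<phi> s * p s $ i $ k * h s $ k $ j)"
      using *(1) sol1[OF \<phi>, of k j i] by blast
    show "signed_integral (borel_on ?I) (\<lambda>A. distr_deriv ?I \<Omega> A $ k $ j) (\<lambda>s. \<phi> s * p s $ i $ k)
      = (LINT s:?I|M. \<phi> s * p s $ i $ k * h s $ k $ j)"
      by (rule *(2)[OF _ _ **])
  qed
  \<comment> \<open>Division by this test function, which is at least \<delta> on
    \<open>{a..b}\<close>, removes it from the integrability clause.\<close>
  obtain \<phi>0 \<delta> where \<phi>0: "\<phi>0 \<in> test_functions ?I" "\<delta> > 0" "\<And>x. x \<in> {a..b} \<Longrightarrow> \<delta> \<le> \<phi>0 x"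
    using test_function_positive[OF ab(1,3)] by blast
  define q where "q i k j t = indicator {a<..<b} t * (p t $ i $ k * h t $ k $ j)" for i k j t
  have q: "integrable M (q i k j)" for i k j
  proof (rule Bochner_Integration.integrable_bound)
    let ?X = "\<lambda>t. indicator ?I t *\<^sub>R (\<phi>0 t * p t $ i $ k * h t $ k $ j)"
    have X: "integrable M ?X" using int(1)[OF \<phi>0(1)] unfolding set_integrable_def .
    then show "integrable M (\<lambda>t. ?X t / \<delta>)" by (rule integrable_divide)
    have "(\<lambda>t. indicator {a<..<b} t / \<phi>0 t) \<in> borel_measurable borel"
      using test_function_measurable[OF \<phi>0(1)] by measurable
    then have "(\<lambda>t. indicator {a<..<b} t / \<phi>0 t) \<in> borel_measurable M"
      unfolding measurable_cong_sets[OF M(2) refl] .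
    then have "(\<lambda>t. indicator {a<..<b} t / \<phi>0 t * ?X t) \<in> borel_measurable M"
      using X by (intro borel_measurable_times) auto
    also have "(\<lambda>t. indicator {a<..<b} t / \<phi>0 t * ?X t) = q i k j"
    proof
      fix t
      show "indicator {a<..<b} t / \<phi>0 t * ?X t = q i k j t"
        using \<phi>0(3)[of t] \<phi>0(2) sub by (cases "t \<in> {a<..<b}") (auto simp: q_def)
    qed
    finally show "q i k j \<in> borel_measurable M" .
    show "AE t in M. norm (q i k j t) \<le> norm (?X t / \<delta>)"
    proof (rule AE_I2)
      fix t
      show "norm (q i k j t) \<le> norm (?X t / \<delta>)"
      proof (cases "t \<in> {a<..<b}")
        case True
        then have d: "\<delta> \<le> \<phi>0 t" "t \<in> ?I" using \<phi>0(3)[of t] sub by auto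
        have "\<bar>p t $ i $ k * h t $ k $ j\<bar> * \<delta> \<le> \<bar>p t $ i $ k * h t $ k $ j\<bar> * \<phi>0 t"
          using d by (intro mult_left_mono) auto
        also have "\<dots> = \<bar>\<phi>0 t * p t $ i $ k * h t $ k $ j\<bar>"
          using d \<phi>0(2) by (simp add: abs_mult)
        finally have "\<bar>p t $ i $ k * h t $ k $ j\<bar> \<le> \<bar>\<phi>0 t * p t $ i $ k * h t $ k $ j\<bar> / \<delta>"
          using \<phi>0(2) by (simp add: pos_le_divide_eq)
        moreover have "norm (q i k j t) = \<bar>p t $ i $ k * h t $ k $ j\<bar>"
          using True by (simp add: q_def)
        moreover have "norm (?X t / \<delta>) = \<bar>\<phi>0 t * p t $ i $ k * h t $ k $ j\<bar> / \<delta>"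
          using d(2) \<phi>0(2) by (simp add: abs_divide)
        ultimately show ?thesis by simp
      qed (simp add: q_def)
    qed
  qed
  have g_entry: "g t $ i $ j = - (\<Sum>k\<in>UNIV. q i k j t)" for t i j
    by (simp add: g_def q_def matrix_matrix_mult_def sum_distrib_left sum_negf)
  have "integrable M (\<lambda>t. (\<chi> i j. - (\<Sum>k\<in>UNIV. q i k j t)))"
    using q by (intro integrable_matrix) auto
  also have "(\<lambda>t. (\<chi> i j. - (\<Sum>k\<in>UNIV. q i k j t))) = g"
    by (simp add: fun_eq_iff vec_eq_iff g_entry)
  finally show g: "integrable M g" .
  have "set_integrable lebesgue ?I H" using sol by (simp add: is_solution_def BV_def)
  then have H: "set_integrable lebesgue {a<..<b} H" by (rule set_integrable_subset) (use sub in auto)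
  show "\<exists>c. AE s\<in>{a<..<b} in lebesgue. H s = c + (LINT t:{..s}|M. g t)"
  proof (rule distr_primitive_matrix[OF M g ab(2) H])
    fix \<phi> i j assume \<phi>: "\<phi> \<in> test_functions {a<..<b}"
    have \<phi>I: "\<phi> \<in> test_functions ?I" using test_functions_mono[OF sub] \<phi> by blast
    obtain c d where cd: "a < c" "c \<le> d" "d < b" "\<And>x. x \<notin> {c..d} \<Longrightarrow> \<phi> x = 0"
      using test_function_support[OF \<phi> ab(2)] by metis
    have d0: "deriv \<phi> x = 0" if "x \<notin> {a<..<b}" for x
    proof -
      have "x \<notin> {c..d}" using cd that by auto
      from test_function_deriv_0[OF cd(4) this] show ?thesis by auto
    qed
    have "(LINT s:{a<..<b}|lebesgue. H s $ i $ j * deriv \<phi> s) = (LINT s:?I|lebesgue. H s $ i $ j * deriv \<phi> s)"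
      unfolding set_lebesgue_integral_def
    proof (rule Bochner_Integration.integral_cong[OF refl])
      fix s
      show "indicator {a<..<b} s *\<^sub>R (H s $ i $ j * deriv \<phi> s) = indicator ?I s *\<^sub>R (H s $ i $ j * deriv \<phi> s)"
        using d0[of s] sub by (cases "s \<in> {a<..<b}") auto
    qed
    also have "\<dots> = (\<Sum>k\<in>UNIV. LINT s:?I|M. \<phi> s * p s $ i $ k * h s $ k $ j)"
      unfolding sol2[OF \<phi>I] int(2)[OF \<phi>I] ..
    also have "\<dots> = (\<Sum>k\<in>UNIV. LINT t|M. \<phi> t * q i k j t)"
    proof (rule sum.cong[OF refl])
      fix k
      show "(LINT s:?I|M. \<phi> s * p s $ i $ k * h s $ k $ j) = (LINT t|M. \<phi> t * q i k j t)"
        unfolding set_lebesgue_integral_def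
      proof (rule Bochner_Integration.integral_cong[OF refl])
        fix s
        show "indicator ?I s *\<^sub>R (\<phi> s * p s $ i $ k * h s $ k $ j) = \<phi> s * q i k j s"
          using test_function_outside[OF \<phi>, of s] sub by (cases "s \<in> {a<..<b}") (auto simp: q_def)
      qed
    qed
    also have "\<dots> = (LINT t|M. (\<Sum>k\<in>UNIV. \<phi> t * q i k j t))"
      by (rule Bochner_Integration.integral_sum[symmetric])
         (rule integrable_test_function_mult[OF \<phi> ab(2) M(2) q])
    also have "\<dots> = - (LINT t|M. \<phi> t * g t $ i $ j)"
      by (simp add: g_entry sum_distrib_left)
    finally show "(LINT s:{a<..<b}|lebesgue. H s $ i $ j * deriv \<phi> s) = - (LINT t|M. \<phi> t * g t $ i $ j)" .
  qed blast
qed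

text \<open>On each compact subinterval the solution agrees almost everywhere with a continuous
  primitive, which is then its precise representative. The constants of integration depend on the
  subinterval; \<open>primitive_on\<close> eliminates them by speaking of increments.\<close>

lemma solution_precise_rep:
  fixes h :: "real \<Rightarrow> real^'n^'n"
  assumes L: "0 < L" and M: "finite_measure M" "sets M = sets borel" "\<And>s. emeasure M {s} = 0" and h: "integrable M h"
    and \<mu>: "\<And>A. A \<in> sets borel \<Longrightarrow> A \<subseteq> {0<..<L} \<Longrightarrow> distr_deriv {0<..<L} \<Omega> A = (LINT x:A|M. h x)"
    and sol: "is_solution L \<Omega> G0 H"
  defines "P \<equiv> precise_rep H"
  shows "AE s\<in>{0<..<L} in lebesgue. H s = P s"
    and "\<And>a b. 0 < a \<Longrightarrow> a \<le> b \<Longrightarrow> b < L \<Longrightarrow> primitive_on M (\<lambda>t. - (matrix_inv (transpose (P t)) ** h t)) a b P"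
proof -
  define g where "g a b t = indicator {a<..<b} t *\<^sub>R - (matrix_inv (transpose (P t)) ** h t)" for a b t
  have loc: "integrable M (g a b)" "\<exists>c. (AE s\<in>{a<..<b} in lebesgue. H s = P s) \<and> (\<forall>s\<in>{a<..<b}. P s = c + (LINT t:{..s}|M. g a b t))"
    if "0 < a" "a < b" "b < L" for a b
  proof -
    note * = solution_primitive[OF L M(1,2) h \<mu> sol that, folded P_def, folded g_def]
    show gi: "integrable M (g a b)" by (rule *(1))
    obtain c where c: "AE s\<in>{a<..<b} in lebesgue. H s = c + (LINT t:{..s}|M. g a b t)" using *(2) by blast
    have "isCont (\<lambda>s. c + (LINT t:{..s}|M. g a b t)) s" for s
      using continuous_primitive[OF M(2) gi M(3), of UNIV]
      by (intro continuous_intros) (simp add: continuous_on_eq_continuous_at)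
    then have P: "P s = c + (LINT t:{..s}|M. g a b t)" if "s \<in> {a<..<b}" for s
      unfolding P_def using precise_rep_eq[OF c that] by blast
    moreover have "AE s\<in>{a<..<b} in lebesgue. H s = P s"
      using c by eventually_elim (use P in auto)
    ultimately show "\<exists>c. (AE s\<in>{a<..<b} in lebesgue. H s = P s) \<and> (\<forall>s\<in>{a<..<b}. P s = c + (LINT t:{..s}|M. g a b t))"
      by blast
  qed
  show "primitive_on M (\<lambda>t. - (matrix_inv (transpose (P t)) ** h t)) a b P" if ab: "0 < a" "a \<le> b" "b < L" for a b
  proof -
    \<comment> \<open>The local representation holds on an open interval only, so a larger one is
      needed to include the endpoints \<open>a\<close> and \<open>b\<close>.\<close>
    define a0 b0 where "a0 = a / 2" and "b0 = (b + L) / 2"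
    have 0: "0 < a0" "a0 < a" "b < b0" "b0 < L" using ab by (auto simp: a0_def b0_def)
    have "a0 < b0" using 0 ab by linarith
    from loc[OF 0(1) this 0(4)] obtain c where c: "integrable M (g a0 b0)"
      "\<And>s. s \<in> {a0<..<b0} \<Longrightarrow> P s = c + (LINT t:{..s}|M. g a0 b0 t)" by blast
    have "primitive_on M (g a0 b0) a b P"
      by (rule primitive_onI[OF M(2) c(1)]) (rule c(2), use 0 in auto)
    then show ?thesis
      by (rule primitive_on_cong) (use 0 in \<open>auto simp: g_def\<close>)
  qed
  \<comment> \<open>An exhaustion of the interval; the offset 3 guarantees \<open>a n < b n\<close>
    already for \<open>n = 0\<close>.\<close>
  define a b where "a n = L / (real n + 3)" and "b n = L - L / (real n + 3)" for n
  have abn: "0 < a n" "a n < b n" "b n < L" for n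
  proof -
    have "L / (real n + 3) \<le> L / 3" using L by (intro divide_left_mono) auto
    moreover have "0 < L / (real n + 3)" using L by simp
    ultimately show "0 < a n" "a n < b n" "b n < L" using L unfolding a_def b_def by linarith+
  qed
  have "AE s in lebesgue. \<forall>n. s \<in> {a n<..<b n} \<longrightarrow> H s = P s"
    unfolding AE_all_countable using loc(2)[OF abn] by blast
  then show "AE s\<in>{0<..<L} in lebesgue. H s = P s"
  proof eventually_elim
    case (elim s)
    show ?case
    proof
      assume s: "s \<in> {0<..<L}"
      obtain n :: nat where n: "max (L / s) (L / (L - s)) < n" using reals_Archimedean2 by blast
      then have "L / s < real n + 3" "L / (L - s) < real n + 3" by auto
      then have "s \<in> {a n<..<b n}" using s by (simp add: a_def b_def field_simps)
      then show "H s = P s" using elim by blast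
    qed
  qed
qed

text \<open>Conserved quantities are constant only between interior points, while the initial
  condition is an essential limit at 0. The lemma joins the two.\<close>

lemma constant_eq_ess_limit:
  fixes Q :: "real \<Rightarrow> 'a::t2_space"
  assumes "0 < L" and const: "\<And>a b. 0 < a \<Longrightarrow> a \<le> b \<Longrightarrow> b < L \<Longrightarrow> Q b = Q a"
    and lim: "(Q \<longlongrightarrow> q) (ess_at_right 0)" and s: "s \<in> {0<..<L}"
  shows "Q s = q"
proof -
  have eq: "Q x = Q s" if "x \<in> {0<..<L}" for x
    using const[of x s] const[of s x] that s by (cases "x \<le> s") auto
  have "AE x\<in>{0<..<L} in lebesgue. Q x = Q s" by (intro AE_I2 impI eq)
  then have "\<forall>\<^sub>F x in ess_at_right 0. Q x = Q s"
    by (rule eventually_ess_at_right[OF _ order_refl assms(1)])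
  then have "(Q \<longlongrightarrow> Q s) (ess_at_right 0)" by (rule tendsto_eventually)
  then show ?thesis using tendsto_unique[OF ess_at_right_neq_bot] lim by blast
qed

text \<open>Two conserved products do the work: P^T P, which shows that the precise representative
  \<open>P\<close> is orthogonal and hence solves the linear equation, and then P G^T, which
  compares it with the known solution. Both have the value \<open>mat 1\<close> in the limit at
  0.\<close>

lemma solution_unique:
  fixes h :: "real \<Rightarrow> real^'n^'n"
  assumes L: "0 < L" and M: "finite_measure M" "sets M = sets borel" "\<And>s. emeasure M {s} = 0"
    and h: "integrable M h" "AE t in M. h t + transpose (h t) = 0"
    and \<mu>: "\<And>A. A \<in> sets borel \<Longrightarrow> A \<subseteq> {0<..<L} \<Longrightarrow> distr_deriv {0<..<L} \<Omega> A = (LINT x:A|M. h x)"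
    and G: "\<And>a b. primitive_on M (\<lambda>t. - (G t ** h t)) a b G" "\<And>s. G s \<in> SO" "(G \<longlongrightarrow> G0) (at_right 0)"
    and G0: "G0 \<in> SO"
    and sol: "is_solution L \<Omega> G0 H"
  shows "AE s\<in>{0<..<L} in lebesgue. H s = G s"
proof -
  interpret mm: bounded_bilinear "(**) :: real^'n^'n \<Rightarrow> real^'n^'n \<Rightarrow> real^'n^'n"
    by (rule bounded_bilinear_matrix_mult)
  interpret tr: bounded_linear "transpose :: real^'n^'n \<Rightarrow> real^'n^'n"
    by (rule bounded_linear_transpose)
  have sf: "sigma_finite_measure M" using M(1) finite_measure.axioms(1) by blast
  define P where "P = precise_rep H"
  define p where "p t = matrix_inv (transpose (P t))" for t
  have HP: "AE s\<in>{0<..<L} in lebesgue. H s = P s"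
    unfolding P_def by (rule solution_precise_rep(1)[OF L M h(1) \<mu> sol])
  have prim: "primitive_on M (\<lambda>t. - (p t ** h t)) a b P" if "0 < a" "a \<le> b" "b < L" for a b
    unfolding p_def P_def by (rule solution_precise_rep(2)[OF L M h(1) \<mu> sol that])
  have inv: "invertible (P s)" if "s \<in> {0<..<L}" for s
    using sol that by (simp add: is_solution_def P_def)
  have "(H \<longlongrightarrow> G0) (ess_at_right 0)" using sol by (simp add: is_solution_def)
  then have Plim: "(P \<longlongrightarrow> G0) (ess_at_right 0)"
    using tendsto_cong[OF eventually_ess_at_right[OF HP order_refl L]] by blast
  have orth0: "transpose G0 ** G0 = mat 1" "G0 ** transpose G0 = mat 1"
    using G0 matrix_left_right_inverse by (auto simp: SO_iff)
  have orth: "transpose (P s) ** P s = mat 1" if s: "s \<in> {0<..<L}" for s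
  proof (rule constant_eq_ess_limit[OF L _ _ s])
    show "((\<lambda>s. transpose (P s) ** P s) \<longlongrightarrow> mat 1) (ess_at_right 0)"
      using mm.tendsto[OF tr.tendsto[OF Plim] Plim] orth0 by simp
    fix a b assume ab: "0 < a" "a \<le> b" "b < L"
    note prod = primitive_on_bilinear[OF bounded_bilinear_matrix_mult sf M(2,3)
        primitive_on_bounded_linear[OF bounded_linear_transpose M(2) prim[OF ab]] prim[OF ab]]
    show "transpose (P b) ** P b = transpose (P a) ** P a"
    proof (rule primitive_on_AE_0[OF prod])
      show "AE t in M. t \<in> {a<..b} \<longrightarrow> transpose (P t) ** - (p t ** h t) + transpose (- (p t ** h t)) ** P t = 0"
        using h(2)
      proof (eventually_elim, intro impI)
        fix t assume t: "h t + transpose (h t) = 0" "t \<in> {a<..b}"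
        then have "invertible (P t)" using ab by (intro inv) auto
        \<comment> \<open>Here the pointwise invertibility enters: the inverse cancels against
          \<open>P\<close> and leaves -h and its transpose, without any bound on
          \<open>P\<close>.\<close>
        note c = matrix_inv_transpose_cancel[OF this, folded p_def]
        have 1: "transpose (P t) ** - (p t ** h t) = - h t"
          by (simp add: mm.minus_right matrix_mul_assoc c)
        have 2: "transpose (- (p t ** h t)) ** P t = - transpose (h t)"
          by (simp add: transpose_uminus mm.minus_left matrix_transpose_mul matrix_mul_assoc[symmetric] c)
        show "transpose (P t) ** - (p t ** h t) + transpose (- (p t ** h t)) ** P t = 0"
          unfolding 1 2 using t(1) by (simp add: neg_eq_iff_add_eq_0)
      qed
    qed (use ab in auto)
  qed
  \<comment> \<open>From here on \<open>P\<close> satisfies the linear equation.\<close>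
  have pP: "p s = P s" if "s \<in> {0<..<L}" for s
    unfolding p_def by (rule matrix_inv_transpose[OF orth[OF that]])
  have Glim: "(G \<longlongrightarrow> G0) (ess_at_right 0)"
    by (rule tendsto_ess_at_right[OF _ order_refl L G(3)]) simp
  have PG: "P s ** transpose (G s) = mat 1" if s: "s \<in> {0<..<L}" for s
  proof (rule constant_eq_ess_limit[OF L _ _ s])
    show "((\<lambda>s. P s ** transpose (G s)) \<longlongrightarrow> mat 1) (ess_at_right 0)"
      using mm.tendsto[OF Plim tr.tendsto[OF Glim]] orth0 by simp
    fix a b assume ab: "0 < a" "a \<le> b" "b < L"
    note prod = primitive_on_bilinear[OF bounded_bilinear_matrix_mult sf M(2,3)
        prim[OF ab] primitive_on_bounded_linear[OF bounded_linear_transpose M(2) G(1)]]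
    show "P b ** transpose (G b) = P a ** transpose (G a)"
    proof (rule primitive_on_AE_0[OF prod])
      show "AE t in M. t \<in> {a<..b} \<longrightarrow> P t ** transpose (- (G t ** h t)) + - (p t ** h t) ** transpose (G t) = 0"
        using h(2)
      proof (eventually_elim, intro impI)
        fix t assume t: "h t + transpose (h t) = 0" "t \<in> {a<..b}"
        then have p: "p t = P t" using ab by (intro pP) auto
        have "P t ** transpose (- (G t ** h t)) + - (p t ** h t) ** transpose (G t)
            = - (P t ** (h t + transpose (h t)) ** transpose (G t))"
          by (simp add: p transpose_uminus matrix_transpose_mul mm.minus_right mm.minus_left mm.add_right mm.add_left matrix_mul_assoc)
        then show "P t ** transpose (- (G t ** h t)) + - (p t ** h t) ** transpose (G t) = 0"
          by (simp add: t(1) mm.zero_left mm.zero_right)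
      qed
    qed (use ab in auto)
  qed
  have "P s = G s" if "s \<in> {0<..<L}" for s
  proof -
    have "P s = P s ** (transpose (G s) ** G s)" using G(2)[of s] by (simp add: SO_iff)
    also have "\<dots> = G s" by (simp add: matrix_mul_assoc PG[OF that])
    finally show ?thesis .
  qed
  then show ?thesis using HP by (auto elim!: eventually_mono)
qed

section \<open>Existence\<close>

lemma set_integrable_continuous:
  fixes f :: "real \<Rightarrow> 'a::euclidean_space"
  assumes "continuous_on UNIV f"
  shows "set_integrable lebesgue {a<..<b} f"
proof -
  have "set_integrable lborel {a..b} f"
    unfolding set_integrable_def using continuous_on_subset[OF assms]
    by (intro borel_integrable_compact) auto
  then have "set_integrable lborel {a<..<b} f"
    by (rule set_integrable_subset) auto
  then show ?thesis
    unfolding set_integrable_def by (subst integrable_completion) auto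
qed

text \<open>Orthogonality turns the inverse transpose back into \<open>G\<close>, so the linear
  equation is the required one. It also bounds the entries, which settles the integrability
  clause.\<close>

lemma orthogonal_is_solution:
  fixes h :: "real \<Rightarrow> real^'n^'n"
  assumes L: "0 < L" and M: "finite_measure M" "sets M = sets borel" and h: "integrable M h"
    "\<And>t. t \<notin> {0<..<L} \<Longrightarrow> h t = 0"
    and \<mu>: "\<And>A. A \<in> sets borel \<Longrightarrow> A \<subseteq> {0<..<L} \<Longrightarrow> distr_deriv {0<..<L} \<Omega> A = (LINT x:A|M. h x)"
    and G: "continuous_on UNIV G" "integrable M (\<lambda>t. - (G t ** h t))"
      "\<And>s. G s = G0 + (LINT t:{..s}|M. - (G t ** h t))" "\<And>s. G s \<in> SO" "G 0 = G0"
  shows "is_solution L \<Omega> G0 G" "G \<in> BV {0<..<L} SO"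
proof -
  let ?I = "{0<..<L}"
  have orth: "transpose (G s) ** G s = mat 1" for s using G(4)[of s] by (simp add: SO_iff)
  have cont: "isCont G s" for s using G(1) by (simp add: continuous_on_eq_continuous_at)
  have AE: "AE s\<in>?I in lebesgue. G s = G s" by simp
  have P: "precise_rep G s = G s" if "s \<in> ?I" for s
    by (rule precise_rep_eq[OF AE that cont])
  have pG: "matrix_inv (transpose (precise_rep G s)) = G s" if "s \<in> ?I" for s
    unfolding P[OF that] by (rule matrix_inv_transpose[OF orth])
  have D: "has_distr_deriv ?I G (\<lambda>A. LINT t:A|M. - (G t ** h t))"
    by (rule primitive_has_distr_deriv(1)[OF M G(2) L G(3)])
  show BV: "G \<in> BV ?I SO"
    unfolding BV_def using set_integrable_continuous[OF G(1)] D G(4) by blast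
  have entry: "distr_deriv ?I \<Omega> A $ k $ j = (LINT x:A|M. h x $ k $ j)" if "A \<in> sets borel" "A \<subseteq> ?I" for A k j
    using \<mu>[OF that] integral_entry[OF h(1), of A k j] that M by simp
  have Gm: "(\<lambda>t. G t $ i $ k) \<in> borel_measurable borel" for i k
    using G(1) by (intro borel_measurable_continuous_onI continuous_intros)
  have Gbd: "\<bar>G t $ i $ k\<bar> \<le> 1" for t i k
  proof -
    \<comment> \<open>The diagonal entries of G^T G are the squared norms of the columns of
      \<open>G\<close>, hence every entry has modulus at most 1.\<close>
    have "(\<Sum>l\<in>UNIV. G t $ l $ k * G t $ l $ k) = (transpose (G t) ** G t) $ k $ k"
      by (simp add: matrix_matrix_mult_def transpose_def)
    then have "(\<Sum>l\<in>UNIV. G t $ l $ k * G t $ l $ k) = 1" unfolding orth by (simp add: mat_def)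
    moreover have "G t $ i $ k * G t $ i $ k \<le> (\<Sum>l\<in>UNIV. G t $ l $ k * G t $ l $ k)"
      by (rule member_le_sum) auto
    ultimately have "(G t $ i $ k)\<^sup>2 \<le> 1" by (simp add: power2_eq_square)
    then show ?thesis by (simp add: abs_square_le_1)
  qed
  have Gh: "integrable M (\<lambda>t. G t $ i $ k * h t $ k $ j)" for i j k
  proof (rule Bochner_Integration.integrable_bound[OF integrable_entry[OF h(1), of k j]])
    have "(\<lambda>t. G t $ i $ k) \<in> borel_measurable M"
      unfolding measurable_cong_sets[OF M(2) refl] by (rule Gm)
    then show "(\<lambda>t. G t $ i $ k * h t $ k $ j) \<in> borel_measurable M"
      using integrable_entry[OF h(1), of k j] by (intro borel_measurable_times) auto
    show "AE t in M. norm (G t $ i $ k * h t $ k $ j) \<le> norm (h t $ k $ j)"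
      using Gbd by (intro AE_I2) (auto simp: abs_mult intro!: mult_left_le_one_le)
  qed
  let ?f = "\<lambda>\<phi> i k s. \<phi> s * matrix_inv (transpose (precise_rep G s)) $ i $ k"
  have rhs: "signed_integrable (borel_on ?I) (\<lambda>A. distr_deriv ?I \<Omega> A $ k $ j) (?f \<phi> i k)"
    "signed_integral (borel_on ?I) (\<lambda>A. distr_deriv ?I \<Omega> A $ k $ j) (?f \<phi> i k) = (LINT t|M. \<phi> t * (G t $ i $ k * h t $ k $ j))"
    if \<phi>: "\<phi> \<in> test_functions ?I" for \<phi> i j k
  proof -
    have "(\<lambda>s. \<phi> s * G s $ i $ k) \<in> borel_measurable (borel_on ?I)"
      by (intro measurable_restrict_space1 borel_measurable_times test_function_measurable[OF \<phi>] Gm)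
    also have "(\<lambda>s. \<phi> s * G s $ i $ k) \<in> borel_measurable (borel_on ?I) \<longleftrightarrow> ?f \<phi> i k \<in> borel_measurable (borel_on ?I)"
      by (rule measurable_cong) (simp add: space_restrict_space pG)
    finally have m: "?f \<phi> i k \<in> borel_measurable (borel_on ?I)" .
    \<comment> \<open>The inverse is identified with \<open>G\<close> only inside the interval;
      elsewhere both sides vanish.\<close>
    have eq: "indicator ?I t *\<^sub>R (?f \<phi> i k t * h t $ k $ j) = \<phi> t * (G t $ i $ k * h t $ k $ j)" for t
      using test_function_outside[OF \<phi>, of t] pG[of t] by (cases "t \<in> ?I") auto
    have si: "set_integrable M ?I (\<lambda>t. ?f \<phi> i k t * h t $ k $ j)"
      unfolding set_integrable_def eq by (rule integrable_test_function_mult[OF \<phi> L M(2) Gh])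
    have I: "?I \<in> sets borel" by simp
    note * = signed_integral_density[where \<nu>="\<lambda>A. distr_deriv ?I \<Omega> A $ k $ j" and h="\<lambda>t. h t $ k $ j",
        OF M(2) integrable_entry[OF h(1)] I entry m]
    show "signed_integrable (borel_on ?I) (\<lambda>A. distr_deriv ?I \<Omega> A $ k $ j) (?f \<phi> i k)"
      using *(1) si by blast
    have "signed_integral (borel_on ?I) (\<lambda>A. distr_deriv ?I \<Omega> A $ k $ j) (?f \<phi> i k) = (LINT t:?I|M. ?f \<phi> i k t * h t $ k $ j)"
      by (rule *(2)[OF _ _ si])
    then show "signed_integral (borel_on ?I) (\<lambda>A. distr_deriv ?I \<Omega> A $ k $ j) (?f \<phi> i k) = (LINT t|M. \<phi> t * (G t $ i $ k * h t $ k $ j))"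
      unfolding set_lebesgue_integral_def eq .
  qed
  have lhs: "(LINT s:?I|lebesgue. G s $ i $ j * deriv \<phi> s) = (\<Sum>k\<in>UNIV. LINT t|M. \<phi> t * (G t $ i $ k * h t $ k $ j))"
    if \<phi>: "\<phi> \<in> test_functions ?I" for \<phi> i j
  proof -
    have "(LINT s:?I|lebesgue. G s $ i $ j * deriv \<phi> s) = - (LINT t|M. \<phi> t * (- (G t ** h t)) $ i $ j)"
      by (rule primitive_has_distr_deriv(2)[OF M G(2) L G(3) \<phi>])
    also have "\<dots> = (LINT t|M. (\<Sum>k\<in>UNIV. \<phi> t * (G t $ i $ k * h t $ k $ j)))"
      by (simp add: matrix_matrix_mult_def sum_distrib_left)
    also have "\<dots> = (\<Sum>k\<in>UNIV. LINT t|M. \<phi> t * (G t $ i $ k * h t $ k $ j))"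
      by (rule Bochner_Integration.integral_sum) (rule integrable_test_function_mult[OF \<phi> L M(2) Gh])
    finally show ?thesis .
  qed
  have lim: "(G \<longlongrightarrow> G0) (ess_at_right 0)"
  proof (rule tendsto_ess_at_right[OF AE order_refl L])
    show "(G \<longlongrightarrow> G0) (at_right 0)"
      using cont[of 0] by (auto simp: isCont_def filterlim_at_split G(5))
  qed
  show "is_solution L \<Omega> G0 G"
    unfolding is_solution_def
  proof (intro conjI ballI allI)
    show "G \<in> BV ?I UNIV" using BV by (simp add: BV_def)
    show "invertible (precise_rep G s)" if "s \<in> ?I" for s
      unfolding P[OF that] using orth[of s] invertible_left_inverse by blast
    show "(LINT s:?I|lebesgue. G s $ i $ j * deriv \<phi> s) =
        (\<Sum>k\<in>UNIV. signed_integral (borel_on ?I) (\<lambda>A. distr_deriv ?I \<Omega> A $ k $ j) (?f \<phi> i k))"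
      if "\<phi> \<in> test_functions ?I" for \<phi> i j
      unfolding lhs[OF that] rhs(2)[OF that] ..
  qed (use rhs(1) lim in blast)+
qed

theorem theorem0p1:
  fixes L :: real and \<Omega> :: "real \<Rightarrow> real^'n^'n" and G0 :: "real^'n^'n"
  assumes "CARD('n) \<ge> 2"
    and "L > 0"
    and "\<Omega> \<in> BV {0<..<L} Sk"
    and "no_jump_part {0<..<L} \<Omega>"
    and "G0 \<in> SO"
  shows "\<exists>G. is_solution L \<Omega> G0 G \<and>
           (\<forall>H. is_solution L \<Omega> G0 H \<longrightarrow> (AE s\<in>{0<..<L} in lebesgue. H s = G s)) \<and>
           G \<in> BV {0<..<L} SO \<and> no_jump_part {0<..<L} G \<and>
           continuous_on {0<..<L} G \<and> (\<forall>s\<in>{0<..<L}. G s \<in> SO)"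
proof -
  let ?I = "{0<..<L}"
  note L = \<open>L > 0\<close>
  have \<mu>: "has_distr_deriv ?I \<Omega> (distr_deriv ?I \<Omega>)"
    by (rule has_distr_deriv_distr_deriv[OF assms(3)])
  then have vm: "vector_measure (borel_on ?I) (distr_deriv ?I \<Omega>)" by (simp add: has_distr_deriv_def)
  obtain M h where M: "finite_measure M" "sets M = sets borel" and h: "integrable M h"
    "\<And>t. t \<notin> ?I \<Longrightarrow> h t = 0"
    and \<mu>_h: "\<And>A. A \<in> sets borel \<Longrightarrow> A \<subseteq> ?I \<Longrightarrow> distr_deriv ?I \<Omega> A = (LINT x:A|M. h x)"
    and atomless: "\<And>s. emeasure M {s} = 0"
  \<comment> \<open>The conclusion about atoms is conditional; its premise is the absence of a jump
    part of \<Omega>.\<close>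
  proof (rule matrix_measure_density[OF vm])
    fix M h
    assume *: "finite_measure M" "sets M = sets borel" "integrable M h" "\<And>t. t \<notin> ?I \<Longrightarrow> h t = 0"
      "\<And>A. A \<in> sets borel \<Longrightarrow> A \<subseteq> ?I \<Longrightarrow> distr_deriv ?I \<Omega> A = (LINT x:A|M. h x)"
      and "\<And>s. (\<And>s. s \<in> ?I \<Longrightarrow> distr_deriv ?I \<Omega> {s} = 0) \<Longrightarrow> emeasure M {s} = 0"
    moreover have "\<And>s. s \<in> ?I \<Longrightarrow> distr_deriv ?I \<Omega> {s} = 0" using assms(4) by (simp add: no_jump_part_def)
    ultimately have "\<And>s. emeasure M {s} = 0" by blast
    with * show thesis by (rule that)
  qed simp
  have sf: "sigma_finite_measure M" using M(1) finite_measure.axioms(1) by blast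
  have \<Omega>i: "set_integrable lebesgue ?I \<Omega>" using assms(3) by (simp add: BV_def)
  obtain c where c: "AE s\<in>?I in lebesgue. \<Omega> s = c + (LINT t:{..s}|M. h t)"
    by (rule has_distr_deriv_primitive[OF M h(1) L \<mu>_h \<Omega>i \<mu>])
  have skew: "AE s\<in>?I in lebesgue. transpose (\<Omega> s) = - \<Omega> s"
    using assms(3) by (simp add: BV_def Sk_def)
  have hskew: "AE t in M. h t + transpose (h t) = 0"
    by (rule skew_density[OF L sf M(2) atomless h c skew])
  \<comment> \<open>This places the initial value of the linear equation at 0 instead of minus
    infinity.\<close>
  have h0: "h t = 0" if "t \<le> 0" for t using h(2)[of t] that by simp
  obtain G where G: "continuous_on UNIV G" "integrable M (\<lambda>t. - (G t ** h t))"
    "\<And>s. G s = G0 + (LINT t:{..s}|M. - (G t ** h t))" "\<And>s. G s \<in> SO" "G 0 = G0"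
  proof (rule orthogonal_solution[OF sf M(2) atomless h(1) hskew h0 assms(5)])
  qed (assumption, rule that)
  note sol = orthogonal_is_solution[OF L M h \<mu>_h G]
  have cont: "continuous_on ?I G" using G(1) continuous_on_subset by blast
  have "isCont G 0" using G(1) by (simp add: continuous_on_eq_continuous_at)
  then have lim: "(G \<longlongrightarrow> G0) (at_right 0)" by (simp add: isCont_def filterlim_at_split G(5))
  have prim: "primitive_on M (\<lambda>t. - (G t ** h t)) a b G" for a b
    by (rule primitive_onI[OF M(2) G(2) G(3)])
  have "AE s\<in>?I in lebesgue. H s = G s" if "is_solution L \<Omega> G0 H" for H
    by (rule solution_unique[OF L M atomless h(1) hskew \<mu>_h prim G(4) lim assms(5) that])
  then show ?thesis
    using sol cont G(4) no_jump_part_continuous[OF L sol(2) cont] by blast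
qed

end
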